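(* Let $\mathcal{A}$ be a unital C$^*$-algebra on which there exists a faithful state, and let $\{\phi_t\}_{t\ge0}$ be a cp$_0$-semigroup on $\mathcal{A}$. Then there exist a unital C$^*$-algebra $\mathfrak{A}$, an injective unital $*$-homomorphism $i:\mathcal{A}\to\mathfrak{A}$, a completely positive map $\mathbb{E}:\mathfrak{A}\to\mathcal{A}$ with $\mathbb{E}\circ i=\mathrm{id}_{\mathcal{A}}$, and an e$_0$-semigroup $\{\sigma_t\}_{t\ge0}$ on $\mathfrak{A}$ such that $\mathbb{E}\circ\sigma_t=\phi_t\circ\mathbb{E}$ for all $t\ge0$ (hence $\phi_t=\mathbb{E}\circ\sigma_t\circ i$).
   Context: A cp$_0$-semigroup on a unital C$^*$-algebra $\mathcal{A}$ is a family $\{\phi_t\}_{t\ge0}$ of unital completely positive maps $\mathcal{A}\to\mathcal{A}$ with $\phi_0=\mathrm{id}$ and $\phi_s\circ\phi_t=\phi_{s+t}$ for all $s,t\ge0$ (no continuity in $t$ is assumed). An e$_0$-semigroup is a cp$_0$-semigroup consisting of unital $*$-endomorphisms. *)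

theory Defs
  imports Complex_Main
begin

record 'a cstar_alg =
  cs_carrier :: "'a set"
  cs_add :: "'a \<Rightarrow> 'a \<Rightarrow> 'a"
  cs_smult :: "complex \<Rightarrow> 'a \<Rightarrow> 'a"
  cs_mult :: "'a \<Rightarrow> 'a \<Rightarrow> 'a"
  cs_star :: "'a \<Rightarrow> 'a"
  cs_norm :: "'a \<Rightarrow> real"
  cs_zero :: 'a
  cs_one :: 'a

definition cs_sub :: "('a, 'm) cstar_alg_scheme \<Rightarrow> 'a \<Rightarrow> 'a \<Rightarrow> 'a" where
  "cs_sub A x y = cs_add A x (cs_smult A (-1) y)"

definition unital_cstar_algebra :: "('a, 'm) cstar_alg_scheme \<Rightarrow> bool" where
  "unital_cstar_algebra A \<longleftrightarrow>
    (let S = cs_carrier A; add = cs_add A; sm = cs_smult A; mul = cs_mult A;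
         st = cs_star A; nm = cs_norm A; z = cs_zero A; u = cs_one A in
    \<comment> \<open>closure\<close>
    z \<in> S \<and> u \<in> S \<and>
    (\<forall>x\<in>S. \<forall>y\<in>S. add x y \<in> S \<and> mul x y \<in> S) \<and>
    (\<forall>c. \<forall>x\<in>S. sm c x \<in> S) \<and> (\<forall>x\<in>S. st x \<in> S) \<and>
    \<comment> \<open>complex vector space\<close>
    (\<forall>x\<in>S. \<forall>y\<in>S. \<forall>w\<in>S. add (add x y) w = add x (add y w)) \<and>
    (\<forall>x\<in>S. \<forall>y\<in>S. add x y = add y x) \<and>
    (\<forall>x\<in>S. add z x = x) \<and>
    (\<forall>x\<in>S. \<exists>y\<in>S. add x y = z) \<and>
    (\<forall>x\<in>S. sm 1 x = x) \<and>
    (\<forall>a b. \<forall>x\<in>S. sm a (sm b x) = sm (a * b) x) \<and>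
    (\<forall>a b. \<forall>x\<in>S. sm (a + b) x = add (sm a x) (sm b x)) \<and>
    (\<forall>a. \<forall>x\<in>S. \<forall>y\<in>S. sm a (add x y) = add (sm a x) (sm a y)) \<and>
    \<comment> \<open>unital associative algebra\<close>
    (\<forall>x\<in>S. \<forall>y\<in>S. \<forall>w\<in>S. mul (mul x y) w = mul x (mul y w)) \<and>
    (\<forall>x\<in>S. mul u x = x \<and> mul x u = x) \<and>
    (\<forall>x\<in>S. \<forall>y\<in>S. \<forall>w\<in>S. mul x (add y w) = add (mul x y) (mul x w)
                          \<and> mul (add x y) w = add (mul x w) (mul y w)) \<and>
    (\<forall>a. \<forall>x\<in>S. \<forall>y\<in>S. sm a (mul x y) = mul (sm a x) y \<and> sm a (mul x y) = mul x (sm a y)) \<and>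
    \<comment> \<open>involution\<close>
    (\<forall>x\<in>S. \<forall>y\<in>S. st (add x y) = add (st x) (st y)) \<and>
    (\<forall>a. \<forall>x\<in>S. st (sm a x) = sm (cnj a) (st x)) \<and>
    (\<forall>x\<in>S. \<forall>y\<in>S. st (mul x y) = mul (st y) (st x)) \<and>
    (\<forall>x\<in>S. st (st x) = x) \<and>
    \<comment> \<open>norm, submultiplicative, C*-identity\<close>
    (\<forall>x\<in>S. nm x \<ge> 0 \<and> (nm x = 0 \<longleftrightarrow> x = z)) \<and>
    (\<forall>x\<in>S. \<forall>y\<in>S. nm (add x y) \<le> nm x + nm y) \<and>
    (\<forall>a. \<forall>x\<in>S. nm (sm a x) = cmod a * nm x) \<and>
    (\<forall>x\<in>S. \<forall>y\<in>S. nm (mul x y) \<le> nm x * nm y) \<and>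
    (\<forall>x\<in>S. nm (mul (st x) x) = (nm x)\<^sup>2) \<and>
    \<comment> \<open>completeness\<close>
    (\<forall>X::nat \<Rightarrow> 'a. (\<forall>n. X n \<in> S) \<and>
        (\<forall>e>0. \<exists>N. \<forall>m\<ge>N. \<forall>n\<ge>N. nm (cs_sub A (X m) (X n)) < e)
      \<longrightarrow> (\<exists>x\<in>S. (\<lambda>n. nm (cs_sub A (X n) x)) \<longlonglongrightarrow> 0)))"

primrec cs_sum :: "('a, 'm) cstar_alg_scheme \<Rightarrow> nat \<Rightarrow> (nat \<Rightarrow> 'a) \<Rightarrow> 'a" where
  "cs_sum A 0 f = cs_zero A"
| "cs_sum A (Suc n) f = cs_add A (cs_sum A n f) (f n)"

text \<open>An n x n matrix over A (entries M i j, i,j < n) is positive in M_n(A) iff it is of the form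
  X* X for some X in M_n(A), computed with the operations of A.\<close>
definition mat_pos :: "('a, 'm) cstar_alg_scheme \<Rightarrow> nat \<Rightarrow> (nat \<Rightarrow> nat \<Rightarrow> 'a) \<Rightarrow> bool" where
  "mat_pos A n M \<longleftrightarrow>
     (\<forall>i<n. \<forall>j<n. M i j \<in> cs_carrier A) \<and>
     (\<exists>X. (\<forall>i<n. \<forall>j<n. X i j \<in> cs_carrier A) \<and>
          (\<forall>i<n. \<forall>j<n. M i j = cs_sum A n (\<lambda>k. cs_mult A (cs_star A (X k i)) (X k j))))"

definition linear_map :: "('a, 'm) cstar_alg_scheme \<Rightarrow> ('b, 'n) cstar_alg_scheme \<Rightarrow> ('a \<Rightarrow> 'b) \<Rightarrow> bool" where
  "linear_map A B f \<longleftrightarrow>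
     (\<forall>x\<in>cs_carrier A. f x \<in> cs_carrier B) \<and>
     (\<forall>x\<in>cs_carrier A. \<forall>y\<in>cs_carrier A. f (cs_add A x y) = cs_add B (f x) (f y)) \<and>
     (\<forall>c. \<forall>x\<in>cs_carrier A. f (cs_smult A c x) = cs_smult B c (f x))"

definition cp_map :: "('a, 'm) cstar_alg_scheme \<Rightarrow> ('b, 'n) cstar_alg_scheme \<Rightarrow> ('a \<Rightarrow> 'b) \<Rightarrow> bool" where
  "cp_map A B f \<longleftrightarrow> linear_map A B f \<and>
     (\<forall>n M. mat_pos A n M \<longrightarrow> mat_pos B n (\<lambda>i j. f (M i j)))"

definition ucp_map :: "('a, 'm) cstar_alg_scheme \<Rightarrow> ('b, 'n) cstar_alg_scheme \<Rightarrow> ('a \<Rightarrow> 'b) \<Rightarrow> bool" where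
  "ucp_map A B f \<longleftrightarrow> cp_map A B f \<and> f (cs_one A) = cs_one B"

definition unital_star_hom :: "('a, 'm) cstar_alg_scheme \<Rightarrow> ('b, 'n) cstar_alg_scheme \<Rightarrow> ('a \<Rightarrow> 'b) \<Rightarrow> bool" where
  "unital_star_hom A B f \<longleftrightarrow> linear_map A B f \<and>
     (\<forall>x\<in>cs_carrier A. \<forall>y\<in>cs_carrier A. f (cs_mult A x y) = cs_mult B (f x) (f y)) \<and>
     (\<forall>x\<in>cs_carrier A. f (cs_star A x) = cs_star B (f x)) \<and>
     f (cs_one A) = cs_one B"

definition state :: "('a, 'm) cstar_alg_scheme \<Rightarrow> ('a \<Rightarrow> complex) \<Rightarrow> bool" where
  "state A \<omega> \<longleftrightarrow>
     (\<forall>x\<in>cs_carrier A. \<forall>y\<in>cs_carrier A. \<omega> (cs_add A x y) = \<omega> x + \<omega> y) \<and>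
     (\<forall>c. \<forall>x\<in>cs_carrier A. \<omega> (cs_smult A c x) = c * \<omega> x) \<and>
     (\<forall>x\<in>cs_carrier A. Im (\<omega> (cs_mult A (cs_star A x) x)) = 0 \<and>
                        Re (\<omega> (cs_mult A (cs_star A x) x)) \<ge> 0) \<and>
     \<omega> (cs_one A) = 1"

definition faithful_state :: "('a, 'm) cstar_alg_scheme \<Rightarrow> ('a \<Rightarrow> complex) \<Rightarrow> bool" where
  "faithful_state A \<omega> \<longleftrightarrow> state A \<omega> \<and>
     (\<forall>x\<in>cs_carrier A. \<omega> (cs_mult A (cs_star A x) x) = 0 \<longrightarrow> x = cs_zero A)"

section \<open>Semigroups (no continuity in t assumed)\<close>

definition cp0_semigroup :: "('a, 'm) cstar_alg_scheme \<Rightarrow> (real \<Rightarrow> 'a \<Rightarrow> 'a) \<Rightarrow> bool" where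
  "cp0_semigroup A \<phi> \<longleftrightarrow>
     (\<forall>t\<ge>0. ucp_map A A (\<phi> t)) \<and>
     (\<forall>x\<in>cs_carrier A. \<phi> 0 x = x) \<and>
     (\<forall>s\<ge>0. \<forall>t\<ge>0. \<forall>x\<in>cs_carrier A. \<phi> s (\<phi> t x) = \<phi> (s + t) x)"

definition e0_semigroup :: "('a, 'm) cstar_alg_scheme \<Rightarrow> (real \<Rightarrow> 'a \<Rightarrow> 'a) \<Rightarrow> bool" where
  "e0_semigroup A \<sigma> \<longleftrightarrow>
     (\<forall>t\<ge>0. unital_star_hom A A (\<sigma> t)) \<and>
     (\<forall>x\<in>cs_carrier A. \<sigma> 0 x = x) \<and>
     (\<forall>s\<ge>0. \<forall>t\<ge>0. \<forall>x\<in>cs_carrier A. \<sigma> s (\<sigma> t x) = \<sigma> (s + t) x)"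

end

theory Submission
  imports Defs "HOL-Analysis.Analysis"
begin

text \<open>Let \<open>j\<^sub>t\<close> be the weak Markov flow of Bhat that dilates \<open>\<phi>\<close>: nonunital homomorphisms with increasing
  projections \<open>p\<^sub>t = j\<^sub>t 1\<close> and \<open>p\<^sub>s j\<^sub>t(a) p\<^sub>s = j\<^sub>s(\<phi>\<^bsub>t-s\<^esub>(a))\<close> for \<open>s \<le> t\<close>.  It is made unital by tensoring with
  the GNS representation \<open>\<pi>\<close> of the faithful state \<open>\<omega>\<close>: put \<open>a\<^sub>t = j\<^sub>t(a) \<otimes> 1 + (1 - p\<^sub>t) \<otimes> \<pi>(a)\<close>.  The
  dilating algebra is generated by all \<open>a\<^sub>t\<close>, with \<open>i(a) = a\<^sub>0\<close>, the shift \<open>\<sigma>\<^sub>s(a\<^sub>t) = a\<^bsub>s+t\<^esub>\<close>, and the vacuum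
  expectation in both tensor factors as \<open>E\<close>.  The norm of an operator expression is the supremum of the
  operator norms of all its shifts, which makes the shifts contractive.

  No representation theory is needed to see that \<open>E\<close> is completely positive: a matrix over \<open>A\<close> is
  positive as soon as the quadratic form defined by \<open>\<omega>\<close> is, because the negative part of a
  hermitian element can be isolated with the square root of its square.  Since the algebra is generated by
  \<open>A \<times> real\<close>, its elements can be coded by sequences over this set.\<close>

section \<open>Unital C*-algebras\<close>

text \<open>The two summands of \<open>a\<^sub>t\<close> live on the ranges of
  \<open>p\<^sub>t\<close> and \<open>1 - p\<^sub>t\<close>, so passing from \<open>a\<close> to
  \<open>a\<^sub>t\<close> is again a homomorphism. The projection \<open>p\<^sub>0\<close> fixes
  the vacuum, so at time 0 the correction is invisible to \<open>E\<close>. The obstacle is that the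
  shift is neither visibly well defined nor visibly bounded on operators. Delaying vectors by
  \<open>r\<close> intertwines an expression with its shift, but it replaces the algebra-valued
  inner product of words by its image under \<open>\<phi> r\<close>, and \<open>\<omega>\<close>
  need not be invariant. Hence an element is recorded as the family of matrix coefficients of all
  its shifts: the shift then translates an index, and the algebra consists of uniform limits of such
  bounded functions. Coefficients do not see null vectors, so semi-inner products are used as they
  are, without quotient or completion of the space. \<open>E\<close> takes values in the algebra
  because words have an algebra-valued inner product before \<open>\<omega>\<close> is applied, and
  because right multiplication at time 0 commutes with all operators.\<close>

notation cs_add (infixl "\<oplus>\<index>" 65)
notation cs_sub (infixl "\<ominus>\<index>" 65)
notation cs_mult (infixl "\<otimes>\<index>" 70)
notation cs_smult (infixr "\<odot>\<index>" 75)
notation cs_star ("_\<^sup>\<star>\<index>" [999] 999)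
notation cs_norm ("\<parallel>_\<parallel>\<index>")
notation cs_zero ("\<zero>\<index>")
notation cs_one ("\<one>\<index>")

locale cstar =
  fixes A :: "'a cstar_alg" (structure)
  assumes cstar: "unital_cstar_algebra A"
begin

abbreviation S where "S \<equiv> cs_carrier A"

lemma laws:
  "\<zero> \<in> S" "\<one> \<in> S"
  "\<forall>x\<in>S. \<forall>y\<in>S. x \<oplus> y \<in> S \<and> x \<otimes> y \<in> S"
  "\<forall>c. \<forall>x\<in>S. c \<odot> x \<in> S"
  "\<forall>x\<in>S. x\<^sup>\<star> \<in> S"
  "\<forall>x\<in>S. \<forall>y\<in>S. \<forall>z\<in>S. x \<oplus> y \<oplus> z = x \<oplus> (y \<oplus> z)"
  "\<forall>x\<in>S. \<forall>y\<in>S. x \<oplus> y = y \<oplus> x"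
  "\<forall>x\<in>S. \<zero> \<oplus> x = x"
  "\<forall>x\<in>S. 1 \<odot> x = x"
  "\<forall>a b. \<forall>x\<in>S. a \<odot> b \<odot> x = (a * b) \<odot> x"
  "\<forall>a b. \<forall>x\<in>S. (a + b) \<odot> x = a \<odot> x \<oplus> b \<odot> x"
  "\<forall>a. \<forall>x\<in>S. \<forall>y\<in>S. a \<odot> (x \<oplus> y) = a \<odot> x \<oplus> a \<odot> y"
  "\<forall>x\<in>S. \<forall>y\<in>S. \<forall>z\<in>S. x \<otimes> y \<otimes> z = x \<otimes> (y \<otimes> z)"
  "\<forall>x\<in>S. \<one> \<otimes> x = x \<and> x \<otimes> \<one> = x"
  "\<forall>x\<in>S. \<forall>y\<in>S. \<forall>z\<in>S. x \<otimes> (y \<oplus> z) = x \<otimes> y \<oplus> x \<otimes> z \<and> (x \<oplus> y) \<otimes> z = x \<otimes> z \<oplus> y \<otimes> z"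
  "\<forall>a. \<forall>x\<in>S. \<forall>y\<in>S. a \<odot> (x \<otimes> y) = (a \<odot> x) \<otimes> y \<and> a \<odot> (x \<otimes> y) = x \<otimes> (a \<odot> y)"
  "\<forall>x\<in>S. \<forall>y\<in>S. (x \<oplus> y)\<^sup>\<star> = x\<^sup>\<star> \<oplus> y\<^sup>\<star>"
  "\<forall>a. \<forall>x\<in>S. (a \<odot> x)\<^sup>\<star> = cnj a \<odot> x\<^sup>\<star>"
  "\<forall>x\<in>S. \<forall>y\<in>S. (x \<otimes> y)\<^sup>\<star> = y\<^sup>\<star> \<otimes> x\<^sup>\<star>"
  "\<forall>x\<in>S. x\<^sup>\<star>\<^sup>\<star> = x"
  "\<forall>x\<in>S. 0 \<le> \<parallel>x\<parallel> \<and> (\<parallel>x\<parallel> = 0 \<longleftrightarrow> x = \<zero>)"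
  "\<forall>x\<in>S. \<forall>y\<in>S. \<parallel>x \<oplus> y\<parallel> \<le> \<parallel>x\<parallel> + \<parallel>y\<parallel>"
  "\<forall>a. \<forall>x\<in>S. \<parallel>a \<odot> x\<parallel> = cmod a * \<parallel>x\<parallel>"
  "\<forall>x\<in>S. \<forall>y\<in>S. \<parallel>x \<otimes> y\<parallel> \<le> \<parallel>x\<parallel> * \<parallel>y\<parallel>"
  "\<forall>x\<in>S. \<parallel>x\<^sup>\<star> \<otimes> x\<parallel> = \<parallel>x\<parallel>\<^sup>2"
  "\<forall>X. (\<forall>n. X n \<in> S) \<and> (\<forall>e>0. \<exists>N. \<forall>m\<ge>N. \<forall>n\<ge>N. \<parallel>X m \<ominus> X n\<parallel> < e)
      \<longrightarrow> (\<exists>x\<in>S. (\<lambda>n. \<parallel>X n \<ominus> x\<parallel>) \<longlonglongrightarrow> 0)"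
  by (insert cstar[unfolded unital_cstar_algebra_def Let_def], (elim conjE, assumption)+)

lemma sub_closed: "x \<in> S \<Longrightarrow> y \<in> S \<Longrightarrow> x \<ominus> y \<in> S"
  using laws(3,4) by (simp add: cs_sub_def)

lemmas closed [simp, intro] =
  laws(1,2) laws(3)[rule_format, THEN conjunct1] laws(3)[rule_format, THEN conjunct2]
  laws(4,5)[rule_format] sub_closed
lemmas add_assoc = laws(6)[rule_format]
lemmas add_comm = laws(7)[rule_format]
lemmas add_zero_left [simp] = laws(8)[rule_format]
lemmas smult_one [simp] = laws(9)[rule_format]
lemmas smult_smult [simp] = laws(10)[rule_format]
lemmas smult_add_left = laws(11)[rule_format]
lemmas smult_add_right = laws(12)[rule_format]
lemmas mult_assoc = laws(13)[rule_format]
lemmas mult_one [simp] = laws(14)[rule_format, THEN conjunct1] laws(14)[rule_format, THEN conjunct2]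
lemmas distrib_left = laws(15)[rule_format, THEN conjunct1]
lemmas distrib_right = laws(15)[rule_format, THEN conjunct2]
lemmas smult_mult_left = laws(16)[rule_format, THEN conjunct1, symmetric]
lemmas smult_mult_right = laws(16)[rule_format, THEN conjunct2, symmetric]
lemmas star_add = laws(17)[rule_format]
lemmas star_smult = laws(18)[rule_format]
lemmas star_mult = laws(19)[rule_format]
lemmas star_star [simp] = laws(20)[rule_format]
lemmas norm_nonneg [simp] = laws(21)[rule_format, THEN conjunct1]
lemmas norm_eq_0 = laws(21)[rule_format, THEN conjunct2]
lemmas norm_triangle = laws(22)[rule_format]
lemmas norm_smult [simp] = laws(23)[rule_format]
lemmas norm_mult = laws(24)[rule_format]
lemmas norm_cstar = laws(25)[rule_format]

section \<open>Convergence in norm\<close>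

definition conv :: "(nat \<Rightarrow> 'a) \<Rightarrow> 'a \<Rightarrow> bool" where
  "conv X x \<longleftrightarrow> (\<lambda>n. \<parallel>X n \<ominus> x\<parallel>) \<longlonglongrightarrow> 0"

lemma complete:
  assumes "\<And>n. X n \<in> S" "\<And>e. e > 0 \<Longrightarrow> \<exists>N. \<forall>m\<ge>N. \<forall>n\<ge>N. \<parallel>X m \<ominus> X n\<parallel> < e"
  shows "\<exists>x\<in>S. conv X x"
proof -
  show ?thesis using laws(26) assms unfolding conv_def by blast
qed

text \<open>Definiteness of the norm gives this directly: \<open>0 \<odot> x\<close> has norm
  \<open>0 * \<parallel>x\<parallel>\<close>.\<close>

lemma smult_zero [simp]: "x \<in> S \<Longrightarrow> 0 \<odot> x = \<zero>"
  using norm_eq_0[of "0 \<odot> x"] by simp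

lemma add_zero_right [simp]: "x \<in> S \<Longrightarrow> x \<oplus> \<zero> = x"
  using add_comm[of x \<zero>] by simp

lemma smult_right_zero [simp]: "c \<odot> \<zero> = \<zero>"
  using smult_smult[of \<zero> c 0] by simp

lemma mult_zero [simp]: "x \<in> S \<Longrightarrow> x \<otimes> \<zero> = \<zero>" "x \<in> S \<Longrightarrow> \<zero> \<otimes> x = \<zero>"
  using smult_mult_right[of x \<zero> 0] smult_mult_left[of \<zero> x 0] by simp_all

lemma star_zero [simp]: "\<zero>\<^sup>\<star> = \<zero>"
  using star_smult[of \<zero> 0] by simp

lemma star_one [simp]: "\<one>\<^sup>\<star> = \<one>"
  using star_mult[of "\<one>\<^sup>\<star>" \<one>] by simp

lemma norm_zero [simp]: "\<parallel>\<zero>\<parallel> = 0"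
  using norm_eq_0[of \<zero>] by simp

text \<open>The C*-identity makes the norm of \<open>\<one>\<close> equal to its square, hence 0 or
  1; the value 0 belongs to the zero algebra, which the axioms admit.\<close>

lemma norm_one: "\<parallel>\<one>\<parallel> \<le> 1"
  using norm_cstar[of \<one>] by (auto simp add: power2_eq_square)

text \<open>The C*-identity and submultiplicativity give \<open>\<parallel>y\<parallel>\<^sup>2
  \<le> \<parallel>y\<^sup>\<star>\<parallel> * \<parallel>y\<parallel>\<close>; one factor is
  cancelled, and the bound is used for \<open>x\<close> and for its adjoint.\<close>

lemma norm_star [simp]:
  assumes "x \<in> S" shows "\<parallel>x\<^sup>\<star>\<parallel> = \<parallel>x\<parallel>"
proof -
  have le: "\<parallel>y\<parallel> \<le> \<parallel>y\<^sup>\<star>\<parallel>" if "y \<in> S" for y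
  proof (cases "\<parallel>y\<parallel> = 0")
    case False
    then have "\<parallel>y\<parallel> > 0" using that norm_nonneg[of y] by linarith
    moreover have "\<parallel>y\<parallel> * \<parallel>y\<parallel> \<le> \<parallel>y\<^sup>\<star>\<parallel> * \<parallel>y\<parallel>"
      using norm_mult[of "y\<^sup>\<star>" y] norm_cstar[of y] that by (simp add: power2_eq_square)
    ultimately show ?thesis by simp
  qed (use that in simp)
  show ?thesis using le[of x] le[of "x\<^sup>\<star>"] assms by simp
qed

lemma sub_self [simp]: "x \<in> S \<Longrightarrow> x \<ominus> x = \<zero>"
  using smult_add_left[of x 1 "-1"] by (simp add: cs_sub_def)

lemma add_left_comm: "x \<in> S \<Longrightarrow> y \<in> S \<Longrightarrow> z \<in> S \<Longrightarrow> x \<oplus> (y \<oplus> z) = y \<oplus> (x \<oplus> z)"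
  by (metis add_assoc add_comm closed(3))

lemma sub_add_sub: "x \<in> S \<Longrightarrow> y \<in> S \<Longrightarrow> z \<in> S \<Longrightarrow> (x \<ominus> y) \<oplus> (y \<ominus> z) = x \<ominus> z"
proof -
  assume *: "x \<in> S" "y \<in> S" "z \<in> S"
  have "(x \<ominus> y) \<oplus> (y \<ominus> z) = (x \<ominus> z) \<oplus> (y \<ominus> y)"
    unfolding cs_sub_def using * by (simp add: add_assoc add_comm add_left_comm)
  then show ?thesis using * by simp
qed

lemma sub_eq_0: "x \<in> S \<Longrightarrow> y \<in> S \<Longrightarrow> x \<ominus> y = \<zero> \<longleftrightarrow> x = y"
proof
  assume *: "x \<in> S" "y \<in> S" "x \<ominus> y = \<zero>"
  have "x \<ominus> \<zero> = (x \<ominus> y) \<oplus> (y \<ominus> \<zero>)" using sub_add_sub[of x y \<zero>] * by simp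
  then show "x = y" using * by (simp add: cs_sub_def)
qed simp

lemma norm_sub_eq_0: "x \<in> S \<Longrightarrow> y \<in> S \<Longrightarrow> \<parallel>x \<ominus> y\<parallel> = 0 \<longleftrightarrow> x = y"
  by (simp add: norm_eq_0 sub_eq_0)

lemma norm_sub_triangle:
  "x \<in> S \<Longrightarrow> y \<in> S \<Longrightarrow> z \<in> S \<Longrightarrow> \<parallel>x \<ominus> z\<parallel> \<le> \<parallel>x \<ominus> y\<parallel> + \<parallel>y \<ominus> z\<parallel>"
  using norm_triangle[of "x \<ominus> y" "y \<ominus> z"] by (simp add: sub_add_sub)

lemma smult_sub: "x \<in> S \<Longrightarrow> y \<in> S \<Longrightarrow> c \<odot> (x \<ominus> y) = c \<odot> x \<ominus> c \<odot> y"
  by (simp add: cs_sub_def smult_add_right)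

lemma sub_swap: "x \<in> S \<Longrightarrow> y \<in> S \<Longrightarrow> (-1) \<odot> (x \<ominus> y) = y \<ominus> x"
  by (simp add: cs_sub_def smult_add_right add_comm)

lemma norm_sub_commute: "x \<in> S \<Longrightarrow> y \<in> S \<Longrightarrow> \<parallel>x \<ominus> y\<parallel> = \<parallel>y \<ominus> x\<parallel>"
  using norm_smult[of "x \<ominus> y" "-1"] by (simp add: sub_swap)

lemma norm_sub_le: "x \<in> S \<Longrightarrow> y \<in> S \<Longrightarrow> \<parallel>x \<ominus> y\<parallel> \<le> \<parallel>x\<parallel> + \<parallel>y\<parallel>"
  using norm_triangle[of x "(-1) \<odot> y"] by (simp add: cs_sub_def)

lemma sub_add_cancel [simp]: "x \<in> S \<Longrightarrow> y \<in> S \<Longrightarrow> (x \<ominus> y) \<oplus> y = x"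
  using sub_add_sub[of x y \<zero>] by (simp add: cs_sub_def)

lemma norm_diff_bound: "x \<in> S \<Longrightarrow> y \<in> S \<Longrightarrow> \<bar>\<parallel>x\<parallel> - \<parallel>y\<parallel>\<bar> \<le> \<parallel>x \<ominus> y\<parallel>"
  using norm_triangle[of "x \<ominus> y" y] norm_triangle[of "y \<ominus> x" x] norm_sub_commute[of x y]
  by (auto simp: sub_add_cancel abs_le_iff)

lemma star_sub: "x \<in> S \<Longrightarrow> y \<in> S \<Longrightarrow> (x \<ominus> y)\<^sup>\<star> = x\<^sup>\<star> \<ominus> y\<^sup>\<star>"
  by (simp add: cs_sub_def star_add star_smult)

lemma distrib_left_sub: "x \<in> S \<Longrightarrow> y \<in> S \<Longrightarrow> z \<in> S \<Longrightarrow> x \<otimes> (y \<ominus> z) = x \<otimes> y \<ominus> x \<otimes> z"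
  by (simp add: cs_sub_def distrib_left smult_mult_right)

lemma distrib_right_sub: "x \<in> S \<Longrightarrow> y \<in> S \<Longrightarrow> z \<in> S \<Longrightarrow> (x \<ominus> y) \<otimes> z = x \<otimes> z \<ominus> y \<otimes> z"
  by (simp add: cs_sub_def distrib_right smult_mult_left)

lemma sub_add_add: "x \<in> S \<Longrightarrow> y \<in> S \<Longrightarrow> z \<in> S \<Longrightarrow> w \<in> S
    \<Longrightarrow> (x \<oplus> y) \<ominus> (z \<oplus> w) = (x \<ominus> z) \<oplus> (y \<ominus> w)"
  by (simp add: cs_sub_def smult_add_right add_assoc add_comm add_left_comm)

lemma conv_unique:
  assumes "\<And>n. X n \<in> S" "x \<in> S" "y \<in> S" "conv X x" "conv X y"
  shows "x = y"
proof -
  have "(\<lambda>n. \<parallel>X n \<ominus> x\<parallel> + \<parallel>X n \<ominus> y\<parallel>) \<longlonglongrightarrow> 0 + 0"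
    using assms(4,5) unfolding conv_def by (intro tendsto_add)
  moreover have "\<parallel>x \<ominus> y\<parallel> \<le> \<parallel>X n \<ominus> x\<parallel> + \<parallel>X n \<ominus> y\<parallel>" for n
    using norm_sub_triangle[of x "X n" y] norm_sub_commute[of x "X n"] assms by simp
  ultimately have "\<parallel>x \<ominus> y\<parallel> \<le> 0"
    using LIMSEQ_le_const[of _ "0 + 0"] by fastforce
  then show ?thesis using norm_sub_eq_0[of x y] norm_nonneg[of "x \<ominus> y"] assms by (simp del: norm_nonneg)
qed

lemma conv_le:
  assumes "\<And>n. \<parallel>Y n \<ominus> y\<parallel> \<le> b n" "b \<longlonglongrightarrow> 0" "\<And>n. Y n \<in> S" "y \<in> S"
  shows "conv Y y"
  unfolding conv_def
  by (rule tendsto_sandwich[OF _ _ tendsto_const assms(2)]) (use assms in auto)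

lemma conv_const: "x \<in> S \<Longrightarrow> conv (\<lambda>_. x) x"
  by (simp add: conv_def)

lemma conv_norm:
  assumes "\<And>n. X n \<in> S" "x \<in> S" "conv X x" shows "(\<lambda>n. \<parallel>X n\<parallel>) \<longlonglongrightarrow> \<parallel>x\<parallel>"
proof -
  have "(\<lambda>n. \<parallel>X n\<parallel> - \<parallel>x\<parallel>) \<longlonglongrightarrow> 0"
    by (rule Lim_null_comparison[OF _ assms(3)[unfolded conv_def]])
      (use norm_diff_bound assms in auto)
  then show ?thesis by (simp add: LIM_zero_iff)
qed

lemma conv_add:
  assumes "\<And>n. X n \<in> S" "\<And>n. Y n \<in> S" "x \<in> S" "y \<in> S" "conv X x" "conv Y y"
  shows "conv (\<lambda>n. X n \<oplus> Y n) (x \<oplus> y)"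
proof (rule conv_le)
  show "(\<lambda>n. \<parallel>X n \<ominus> x\<parallel> + \<parallel>Y n \<ominus> y\<parallel>) \<longlonglongrightarrow> 0"
    using tendsto_add[OF assms(5,6)[unfolded conv_def]] by simp
  show "\<parallel>X n \<oplus> Y n \<ominus> (x \<oplus> y)\<parallel> \<le> \<parallel>X n \<ominus> x\<parallel> + \<parallel>Y n \<ominus> y\<parallel>" for n
    using assms by (simp add: sub_add_add norm_triangle)
qed (use assms in auto)

lemma conv_smult:
  assumes "\<And>n. X n \<in> S" "x \<in> S" "conv X x"
  shows "conv (\<lambda>n. c \<odot> X n) (c \<odot> x)"
  unfolding conv_def using assms tendsto_mult_right_zero[OF assms(3)[unfolded conv_def], of "cmod c"]
  by (simp flip: smult_sub)

lemma conv_star: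
  assumes "\<And>n. X n \<in> S" "x \<in> S" "conv X x"
  shows "conv (\<lambda>n. (X n)\<^sup>\<star>) (x\<^sup>\<star>)"
  using assms unfolding conv_def by (simp flip: star_sub)

lemma conv_mult:
  assumes "\<And>n. X n \<in> S" "\<And>n. Y n \<in> S" "x \<in> S" "y \<in> S" "conv X x" "conv Y y"
  shows "conv (\<lambda>n. X n \<otimes> Y n) (x \<otimes> y)"
proof (rule conv_le)
  show "(\<lambda>n. \<parallel>X n \<ominus> x\<parallel> * \<parallel>Y n\<parallel> + \<parallel>x\<parallel> * \<parallel>Y n \<ominus> y\<parallel>) \<longlonglongrightarrow> 0"
    using tendsto_add[OF tendsto_mult[OF assms(5)[unfolded conv_def] conv_norm[OF assms(2,4,6)]]
        tendsto_mult[OF tendsto_const assms(6)[unfolded conv_def]]] by simp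
  fix n
  have "X n \<otimes> Y n \<ominus> x \<otimes> y = (X n \<ominus> x) \<otimes> Y n \<oplus> x \<otimes> (Y n \<ominus> y)"
    using assms by (simp add: distrib_left_sub distrib_right_sub sub_add_sub)
  then show "\<parallel>X n \<otimes> Y n \<ominus> x \<otimes> y\<parallel> \<le> \<parallel>X n \<ominus> x\<parallel> * \<parallel>Y n\<parallel> + \<parallel>x\<parallel> * \<parallel>Y n \<ominus> y\<parallel>"
    using assms norm_triangle[of "(X n \<ominus> x) \<otimes> Y n" "x \<otimes> (Y n \<ominus> y)"]
      norm_mult[of "X n \<ominus> x" "Y n"] norm_mult[of x "Y n \<ominus> y"] by simp
qed (use assms in auto)

end

section \<open>Square roots of positive elements\<close>

text \<open>The scalar case \<open>h = 1\<close> of the iteration \<open>sqrt_iter\<close> below;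
  its increments dominate those of \<open>sqrt_iter\<close> for every contraction
  \<open>h\<close>.\<close>

primrec sqrt_majorant :: "nat \<Rightarrow> real" where
  "sqrt_majorant 0 = 0"
| "sqrt_majorant (Suc n) = (1 + (sqrt_majorant n)\<^sup>2) / 2"

lemma sqrt_majorant_bounds: "0 \<le> sqrt_majorant n \<and> sqrt_majorant n \<le> 1"
proof (induction n)
  case (Suc n)
  then have "(sqrt_majorant n)\<^sup>2 \<le> 1" by (simp add: power_le_one)
  then show ?case by simp
qed simp

lemma sqrt_majorant_mono: "mono sqrt_majorant"
proof (rule incseq_SucI)
  fix n
  have "0 \<le> (1 - sqrt_majorant n)\<^sup>2" by simp
  then show "sqrt_majorant n \<le> sqrt_majorant (Suc n)"
    by (simp add: power2_eq_square algebra_simps)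
qed

lemma sqrt_majorant_Cauchy: "Cauchy sqrt_majorant"
proof -
  have "Bseq sqrt_majorant"
    by (rule BseqI'[of _ 1]) (use sqrt_majorant_bounds in auto)
  then show ?thesis
    using sqrt_majorant_mono by (intro convergent_Cauchy Bseq_monoseq_convergent incseq_imp_monoseq)
qed

text \<open>A jointly faithful family \<open>P\<close> of positive functionals stands in for
  representation theory. It is a family because the locale is used both for
  \<open>{\<omega>}\<close> on the given algebra and for the vector functionals on the completed
  matrix algebra.\<close>

locale fcstar = cstar +
  fixes P :: "('a \<Rightarrow> complex) set"
  assumes P_add: "f \<in> P \<Longrightarrow> x \<in> S \<Longrightarrow> y \<in> S \<Longrightarrow> f (x \<oplus> y) = f x + f y"
    and P_smult: "f \<in> P \<Longrightarrow> x \<in> S \<Longrightarrow> f (c \<odot> x) = c * f x"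
    and P_pos: "f \<in> P \<Longrightarrow> x \<in> S \<Longrightarrow> Im (f (x\<^sup>\<star> \<otimes> x)) = 0 \<and> 0 \<le> Re (f (x\<^sup>\<star> \<otimes> x))"
    and P_faithful: "x \<in> S \<Longrightarrow> (\<And>f. f \<in> P \<Longrightarrow> f (x\<^sup>\<star> \<otimes> x) = 0) \<Longrightarrow> x = \<zero>"
begin

definition lin :: "('a \<Rightarrow> complex) \<Rightarrow> bool" where
  "lin f \<longleftrightarrow> (\<forall>x\<in>S. \<forall>y\<in>S. f (x \<oplus> y) = f x + f y) \<and> (\<forall>c. \<forall>x\<in>S. f (c \<odot> x) = c * f x)"

lemma lin_P: "f \<in> P \<Longrightarrow> lin f"
  by (simp add: lin_def P_add P_smult)

lemma lin_simps:
  assumes "lin f"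
  shows "x \<in> S \<Longrightarrow> y \<in> S \<Longrightarrow> f (x \<oplus> y) = f x + f y"
    and "x \<in> S \<Longrightarrow> f (c \<odot> x) = c * f x"
    and "x \<in> S \<Longrightarrow> y \<in> S \<Longrightarrow> f (x \<ominus> y) = f x - f y"
    and "f \<zero> = 0"
proof -
  show 1: "f (x \<oplus> y) = f x + f y" if "x \<in> S" "y \<in> S" for x y using assms that by (simp add: lin_def)
  show 2: "f (c \<odot> x) = c * f x" if "x \<in> S" for c x using assms that by (simp add: lin_def)
  show "f (x \<ominus> y) = f x - f y" if "x \<in> S" "y \<in> S" using that by (simp add: cs_sub_def 1 2)
  show "f \<zero> = 0" using 2[of \<zero> 0] by simp
qed

lemma lin_mult_left: "lin f \<Longrightarrow> z \<in> S \<Longrightarrow> lin (\<lambda>x. f (z \<otimes> x))"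
  by (simp add: lin_def distrib_left smult_mult_right)

text \<open>Identities that are linear in their nonscalar monomials are proved by testing against all
  linear functionals, which turns them into identities between complex numbers.\<close>

lemma lin_eqI:
  assumes "x \<in> S" "y \<in> S" "\<And>f. lin f \<Longrightarrow> f x = f y"
  shows "x = y"
proof -
  \<comment> \<open>For \<open>f\<close> in \<open>P\<close> the map sending \<open>z\<close> to
    \<open>f ((x \<ominus> y)\<^sup>\<star> \<otimes> z)\<close> is linear, so it agrees on
    \<open>x\<close> and \<open>y\<close>; faithfulness then applies.\<close>
  have "f ((x \<ominus> y)\<^sup>\<star> \<otimes> (x \<ominus> y)) = 0" if "f \<in> P" for f
  proof -
    let ?g = "\<lambda>z. f ((x \<ominus> y)\<^sup>\<star> \<otimes> z)"
    have "lin ?g" using assms that by (simp add: lin_mult_left lin_P)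
    then show ?thesis using lin_simps(3)[of ?g x y] assms by simp
  qed
  then show ?thesis using P_faithful[of "x \<ominus> y"] assms sub_eq_0 by simp
qed

lemmas expand = distrib_left distrib_right distrib_left_sub distrib_right_sub smult_mult_left
  smult_mult_right mult_assoc star_add star_sub star_smult star_mult

text \<open>A fixed point \<open>y = (h + y\<^sup>2) / 2\<close> satisfies
  \<open>(1 - y)\<^sup>2 = 1 - h\<close>, so the limit provides a square root of
  \<open>\<one> \<ominus> h\<close>.\<close>

primrec sqrt_iter :: "'a \<Rightarrow> nat \<Rightarrow> 'a" where
  "sqrt_iter h 0 = \<zero>"
| "sqrt_iter h (Suc n) = (1/2) \<odot> (h \<oplus> sqrt_iter h n \<otimes> sqrt_iter h n)"

lemma sqrt_iter_closed [simp]: "h \<in> S \<Longrightarrow> sqrt_iter h n \<in> S"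
  by (induction n) simp_all

lemma sqrt_iter_star: "h \<in> S \<Longrightarrow> h\<^sup>\<star> = h \<Longrightarrow> (sqrt_iter h n)\<^sup>\<star> = sqrt_iter h n"
  by (induction n) (simp_all add: expand)

lemma commute_square:
  assumes "z \<in> S" "y \<in> S" "z \<otimes> y = y \<otimes> z"
  shows "z \<otimes> (y \<otimes> y) = y \<otimes> y \<otimes> z"
  using assms by (metis mult_assoc)

text \<open>Every iterate is a polynomial in \<open>h\<close>. Keeping \<open>z\<close> arbitrary
  lets the limit, and all roots built from it, commute with whatever commutes with
  \<open>h\<close>.\<close>

lemma sqrt_iter_commute:
  "h \<in> S \<Longrightarrow> z \<in> S \<Longrightarrow> z \<otimes> h = h \<otimes> z \<Longrightarrow> z \<otimes> sqrt_iter h n = sqrt_iter h n \<otimes> z"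
proof (induction n)
  case (Suc n)
  then show ?case using commute_square[of z "sqrt_iter h n"]
    by (simp add: distrib_left distrib_right smult_mult_left smult_mult_right)
qed simp

lemma sqrt_iter_norm:
  assumes "h \<in> S" "\<parallel>h\<parallel> \<le> 1" shows "\<parallel>sqrt_iter h n\<parallel> \<le> sqrt_majorant n"
proof (induction n)
  case (Suc n)
  let ?y = "sqrt_iter h n"
  have "\<parallel>?y \<otimes> ?y\<parallel> \<le> \<parallel>?y\<parallel> * \<parallel>?y\<parallel>" using assms by (simp add: norm_mult)
  also have "\<dots> \<le> (sqrt_majorant n)\<^sup>2"
    using Suc assms by (simp add: power2_eq_square mult_mono sqrt_majorant_bounds)
  finally show ?case using norm_triangle[of h "?y \<otimes> ?y"] assms by simp
qed simp

text \<open>Commuting iterates allow the factorisation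
  \<open>y\<^sup>2 - x\<^sup>2 = (y - x) (y + x)\<close>; bounding both factors by the majorant
  reproduces the same factorisation for the scalar iteration.\<close>

lemma sqrt_iter_step:
  assumes "h \<in> S" "\<parallel>h\<parallel> \<le> 1"
  shows "\<parallel>sqrt_iter h (Suc n) \<ominus> sqrt_iter h n\<parallel> \<le> sqrt_majorant (Suc n) - sqrt_majorant n"
proof (induction n)
  case 0
  then show ?case using assms by (simp add: cs_sub_def)
next
  case (Suc n)
  have m: "(sqrt_majorant n)\<^sup>2 = 2 * sqrt_majorant (Suc n) - 1" by (simp add: field_simps)
  let ?x = "sqrt_iter h n" and ?y = "sqrt_iter h (Suc n)"
  have S: "?x \<in> S" "?y \<in> S" using assms sqrt_iter_closed by blast+
  have h: "?x \<otimes> h = h \<otimes> ?x" by (rule sqrt_iter_commute[symmetric]) (use assms in auto)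
  have c: "?x \<otimes> ?y = ?y \<otimes> ?x" by (rule sqrt_iter_commute) (use assms h in auto)
  have "sqrt_iter h (Suc (Suc n)) \<ominus> ?y
      = (1/2) \<odot> (h \<oplus> ?y \<otimes> ?y) \<ominus> (1/2) \<odot> (h \<oplus> ?x \<otimes> ?x)"
    by simp
  also have "\<dots> = (1/2) \<odot> ((?y \<ominus> ?x) \<otimes> (?y \<oplus> ?x))"
    using S assms c
    by (intro lin_eqI) (simp_all add: lin_simps expand algebra_simps del: sqrt_iter.simps)
  finally have "\<parallel>sqrt_iter h (Suc (Suc n)) \<ominus> ?y\<parallel> = 1/2 * \<parallel>(?y \<ominus> ?x) \<otimes> (?y \<oplus> ?x)\<parallel>"
    using S by (simp del: sqrt_iter.simps)
  also have "\<dots> \<le> 1/2 * (\<parallel>?y \<ominus> ?x\<parallel> * \<parallel>?y \<oplus> ?x\<parallel>)"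
    using S norm_mult[of "?y \<ominus> ?x" "?y \<oplus> ?x"] by (simp del: sqrt_iter.simps)
  also have "\<dots> \<le> 1/2 * ((sqrt_majorant (Suc n) - sqrt_majorant n) * (sqrt_majorant (Suc n) + sqrt_majorant n))"
  proof (intro mult_left_mono mult_mono)
    show "\<parallel>?y \<oplus> ?x\<parallel> \<le> sqrt_majorant (Suc n) + sqrt_majorant n"
      using norm_triangle[OF S(2,1)] sqrt_iter_norm[OF assms, of n] sqrt_iter_norm[OF assms, of "Suc n"]
      by linarith
  qed (use Suc S sqrt_majorant_mono in \<open>auto simp: mono_iff_le_Suc simp del: sqrt_iter.simps sqrt_majorant.simps\<close>)
  also have "\<dots> = sqrt_majorant (Suc (Suc n)) - sqrt_majorant (Suc n)"
    using m unfolding sqrt_majorant.simps(2)[of "Suc n"]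
    by (simp add: power2_eq_square algebra_simps del: sqrt_majorant.simps)
  finally show ?case .
qed

lemma sqrt_iter_diff:
  assumes "h \<in> S" "\<parallel>h\<parallel> \<le> 1"
  shows "\<parallel>sqrt_iter h (n + k) \<ominus> sqrt_iter h n\<parallel> \<le> sqrt_majorant (n + k) - sqrt_majorant n"
proof (induction k)
  case 0
  then show ?case using assms by simp
next
  case (Suc k)
  show ?case
    using Suc sqrt_iter_step[OF assms, of "n + k"]
      norm_sub_triangle[of "sqrt_iter h (Suc (n + k))" "sqrt_iter h (n + k)" "sqrt_iter h n"] assms
    by (simp del: sqrt_iter.simps sqrt_majorant.simps)
qed

text \<open>The last two properties serve iterated use: \<open>\<one> \<ominus> b\<close> is the
  limit of the iteration and a contraction, hence itself a legitimate argument, and the commutation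
  clause lets roots of commuting elements commute.\<close>

theorem sqrt_one_minus:
  assumes h: "h \<in> S" "h\<^sup>\<star> = h" "\<parallel>h\<parallel> \<le> 1"
  obtains b where "b \<in> S" "b\<^sup>\<star> = b" "b \<otimes> b = \<one> \<ominus> h" "\<parallel>\<one> \<ominus> b\<parallel> \<le> 1"
    "\<And>z. z \<in> S \<Longrightarrow> z \<otimes> h = h \<otimes> z \<Longrightarrow> z \<otimes> b = b \<otimes> z"
proof -
  let ?Y = "sqrt_iter h"
  have Y: "?Y n \<in> S" for n using h by simp
  have "\<exists>y\<in>S. conv ?Y y"
  proof (rule complete[OF Y])
    fix e :: real assume "e > 0"
    then obtain N where N: "\<And>m n. m \<ge> N \<Longrightarrow> n \<ge> N \<Longrightarrow> dist (sqrt_majorant m) (sqrt_majorant n) < e"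
      using sqrt_majorant_Cauchy unfolding Cauchy_def by blast
    have *: "\<parallel>?Y n \<ominus> ?Y m\<parallel> < e" if mn: "m \<ge> N" "n \<ge> m" for m n
    proof -
      obtain k where "n = m + k" using mn(2) le_iff_add by blast
      then show ?thesis using sqrt_iter_diff[OF h(1,3), of m k] N[of n m] mn
        by (simp add: dist_real_def)
    qed
    have "\<parallel>?Y m \<ominus> ?Y n\<parallel> < e" if "m \<ge> N" "n \<ge> N" for m n
      using *[of m n] *[of n m] that norm_sub_commute[OF Y Y, of m n] by (cases "m \<le> n") auto
    then show "\<exists>N. \<forall>m\<ge>N. \<forall>n\<ge>N. \<parallel>?Y m \<ominus> ?Y n\<parallel> < e" by blast
  qed
  then obtain y where y: "y \<in> S" "conv ?Y y" by blast
  have norm: "\<parallel>y\<parallel> \<le> 1"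
    by (rule LIMSEQ_le_const2[OF conv_norm[OF Y y]])
      (use sqrt_iter_norm[OF h(1,3)] sqrt_majorant_bounds order_trans in blast)
  have star: "y\<^sup>\<star> = y"
    using conv_unique[OF Y _ y(1) conv_star[OF Y y, unfolded sqrt_iter_star[OF h(1,2)]] y(2)] y by simp
  have comm: "z \<otimes> y = y \<otimes> z" if z: "z \<in> S" "z \<otimes> h = h \<otimes> z" for z
  proof (rule conv_unique)
    show "conv (\<lambda>n. z \<otimes> ?Y n) (z \<otimes> y)" using z y Y by (intro conv_mult conv_const) auto
    have "conv (\<lambda>n. ?Y n \<otimes> z) (y \<otimes> z)" using z y Y by (intro conv_mult conv_const) auto
    then show "conv (\<lambda>n. z \<otimes> ?Y n) (y \<otimes> z)"
      using sqrt_iter_commute[OF h(1) z] by simp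
  qed (use z y h in auto)
  have fix_eq: "y = (1/2) \<odot> (h \<oplus> y \<otimes> y)"
  proof (rule conv_unique)
    show "conv (\<lambda>n. ?Y (Suc n)) y"
      using y(2) unfolding conv_def by (rule LIMSEQ_Suc)
    show "conv (\<lambda>n. ?Y (Suc n)) ((1/2) \<odot> (h \<oplus> y \<otimes> y))"
      unfolding sqrt_iter.simps using h y by (intro conv_smult conv_add conv_mult conv_const) auto
  qed (use y h in auto)
  show ?thesis
  proof (rule that[of "\<one> \<ominus> y"])
    show "(\<one> \<ominus> y) \<otimes> (\<one> \<ominus> y) = \<one> \<ominus> h"
    proof (rule lin_eqI)
      fix f assume f: "lin f"
      have "f y = (1/2) * (f h + f (y \<otimes> y))"
        using f h y by (subst fix_eq) (simp add: lin_simps)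
      then show "f ((\<one> \<ominus> y) \<otimes> (\<one> \<ominus> y)) = f (\<one> \<ominus> h)"
        using f h y by (simp add: lin_simps expand algebra_simps)
    qed (use h y in auto)
    have "\<one> \<ominus> (\<one> \<ominus> y) = y" using y by (intro lin_eqI) (simp_all add: lin_simps)
    then show "\<parallel>\<one> \<ominus> (\<one> \<ominus> y)\<parallel> \<le> 1" using norm by simp
    show "z \<otimes> (\<one> \<ominus> y) = (\<one> \<ominus> y) \<otimes> z" if "z \<in> S" "z \<otimes> h = h \<otimes> z" for z
      using comm[OF that] that y by (simp add: distrib_left_sub distrib_right_sub)
  qed (use y star in \<open>auto simp: star_sub\<close>)
qed

text \<open>The element \<open>g + i b\<close> is unitary, and \<open>g\<close> is its real part.\<close>

lemma norm_le_one_if_squares_sum: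
  assumes g: "g \<in> S" "g\<^sup>\<star> = g" and b: "b \<in> S" "b\<^sup>\<star> = b"
    and comm: "g \<otimes> b = b \<otimes> g" and sum: "g \<otimes> g \<oplus> b \<otimes> b = \<one>"
  shows "\<parallel>g\<parallel> \<le> 1"
proof -
  let ?u = "g \<oplus> \<i> \<odot> b"
  have "?u\<^sup>\<star> \<otimes> ?u = g \<otimes> g \<oplus> b \<otimes> b"
    using g b comm by (intro lin_eqI) (simp_all add: lin_simps expand algebra_simps)
  then have "\<parallel>?u\<parallel>\<^sup>2 \<le> 1" using sum norm_cstar[of ?u] g b norm_one by simp
  then have u: "\<parallel>?u\<parallel> \<le> 1" using power2_le_imp_le[of "\<parallel>?u\<parallel>" 1] by simp
  have "g = (1/2) \<odot> (?u \<oplus> ?u\<^sup>\<star>)"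
    using g b by (intro lin_eqI) (simp_all add: lin_simps expand algebra_simps)
  then have "\<parallel>g\<parallel> = 1/2 * \<parallel>?u \<oplus> ?u\<^sup>\<star>\<parallel>" using g b norm_smult[of "?u \<oplus> ?u\<^sup>\<star>" "1/2"] by simp
  also have "\<dots> \<le> 1/2 * (\<parallel>?u\<parallel> + \<parallel>?u\<^sup>\<star>\<parallel>)"
    using norm_triangle[of ?u "?u\<^sup>\<star>"] g b by simp
  also have "\<dots> \<le> 1" using u g b by simp
  finally show ?thesis .
qed

text \<open>The root \<open>b\<close> of \<open>1 - h\<^sup>2\<close> satisfies
  \<open>b\<^sup>2 + h\<^sup>2 = 1\<close>, so \<open>1 - h\<^sup>2\<close> has norm at most 1, and
  \<open>h\<^sup>2 = 1 - (1 - h\<^sup>2)\<close> has a root \<open>s\<close>, the absolute value of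
  \<open>h\<close>. Since \<open>1 - s\<close> is again a contraction, \<open>s\<close> has a root
  \<open>r\<close>, which exhibits \<open>s\<close> as a square.\<close>

lemma absolute_value:
  assumes h: "h \<in> S" "h\<^sup>\<star> = h" "\<parallel>h\<parallel> \<le> 1"
  obtains r where "r \<in> S" "r\<^sup>\<star> = r" "(r \<otimes> r) \<otimes> (r \<otimes> r) = h \<otimes> h"
    "\<And>z. z \<in> S \<Longrightarrow> z \<otimes> h = h \<otimes> z \<Longrightarrow> z \<otimes> r = r \<otimes> z"
proof -
  let ?k = "h \<otimes> h"
  have ks: "?k \<in> S" "?k\<^sup>\<star> = ?k" using h(1,2) by (simp_all add: star_mult)
  have k1: "\<parallel>?k\<parallel> \<le> 1"
    using norm_mult[of h h] h mult_mono[of "\<parallel>h\<parallel>" 1 "\<parallel>h\<parallel>" 1] by simp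
  obtain b where b: "b \<in> S" "b\<^sup>\<star> = b" "b \<otimes> b = \<one> \<ominus> ?k"
    "\<And>z. z \<in> S \<Longrightarrow> z \<otimes> ?k = ?k \<otimes> z \<Longrightarrow> z \<otimes> b = b \<otimes> z"
    by (rule sqrt_one_minus[OF ks k1]) (use that in blast)
  have hb: "h \<otimes> b = b \<otimes> h" by (rule b(4)) (use h(1) in \<open>simp_all add: mult_assoc\<close>)
  have sum: "b \<otimes> b \<oplus> h \<otimes> h = \<one>" unfolding b(3) using h(1) by simp
  have "\<parallel>b\<parallel> \<le> 1" by (rule norm_le_one_if_squares_sum[OF b(1,2) h(1,2) hb[symmetric] sum])
  then have nk: "\<parallel>\<one> \<ominus> ?k\<parallel> \<le> 1"
    using norm_mult[of b b] b(1) b(3)[symmetric] mult_mono[of "\<parallel>b\<parallel>" 1 "\<parallel>b\<parallel>" 1] by simp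
  obtain s where s: "s \<in> S" "s\<^sup>\<star> = s" "s \<otimes> s = \<one> \<ominus> (\<one> \<ominus> ?k)" "\<parallel>\<one> \<ominus> s\<parallel> \<le> 1"
    "\<And>z. z \<in> S \<Longrightarrow> z \<otimes> (\<one> \<ominus> ?k) = (\<one> \<ominus> ?k) \<otimes> z \<Longrightarrow> z \<otimes> s = s \<otimes> z"
    using sqrt_one_minus[OF _ _ nk] ks by (metis closed star_sub star_one)
  obtain r where r: "r \<in> S" "r\<^sup>\<star> = r" "r \<otimes> r = \<one> \<ominus> (\<one> \<ominus> s)"
    "\<And>z. z \<in> S \<Longrightarrow> z \<otimes> (\<one> \<ominus> s) = (\<one> \<ominus> s) \<otimes> z \<Longrightarrow> z \<otimes> r = r \<otimes> z"
    using sqrt_one_minus[OF _ _ s(4)] s(1,2) by (metis closed star_sub star_one)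
  have cancel: "\<one> \<ominus> (\<one> \<ominus> x) = x" if "x \<in> S" for x
    using that by (intro lin_eqI) (simp_all add: lin_simps)
  have comm_sub: "z \<otimes> (\<one> \<ominus> x) = (\<one> \<ominus> x) \<otimes> z" if "z \<in> S" "x \<in> S" "z \<otimes> x = x \<otimes> z" for z x
    using that by (simp add: distrib_left_sub distrib_right_sub)
  show ?thesis
  proof (rule that[of r])
    show "(r \<otimes> r) \<otimes> (r \<otimes> r) = h \<otimes> h" using r(3) s(1,3) h by (simp add: cancel)
    show "z \<otimes> r = r \<otimes> z" if "z \<in> S" "z \<otimes> h = h \<otimes> z" for z
      by (intro r(4) comm_sub s(5) commute_square that h(1) s(1)) (use that h(1) s(1) in auto)
  qed (use r in auto)
qed

text \<open>Here \<open>s = r\<^sup>2\<close> is the absolute value of \<open>h\<close>, and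
  \<open>n = s - h\<close> is twice its negative part. As \<open>n h n\<close> is minus
  \<open>(r n)\<^sup>\<star> (r n)\<close>, positivity leaves only \<open>r n = 0\<close>, whence
  \<open>n\<^sup>2 = 0\<close> and \<open>h = s\<close>.\<close>

lemma pos_sqrt_contraction:
  assumes h: "h \<in> S" "h\<^sup>\<star> = h" "\<parallel>h\<parallel> \<le> 1"
    and pos: "\<And>n f. n \<in> S \<Longrightarrow> n\<^sup>\<star> = n \<Longrightarrow> f \<in> P \<Longrightarrow> 0 \<le> Re (f (n \<otimes> h \<otimes> n))"
  obtains r where "r \<in> S" "r\<^sup>\<star> = r" "r \<otimes> r = h"
    "\<And>z. z \<in> S \<Longrightarrow> z \<otimes> h = h \<otimes> z \<Longrightarrow> z \<otimes> r = r \<otimes> z"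
proof -
  obtain r where r: "r \<in> S" "r\<^sup>\<star> = r" "(r \<otimes> r) \<otimes> (r \<otimes> r) = h \<otimes> h"
    "\<And>z. z \<in> S \<Longrightarrow> z \<otimes> h = h \<otimes> z \<Longrightarrow> z \<otimes> r = r \<otimes> z"
    using absolute_value[OF h] by blast
  define s where "s = r \<otimes> r"
  define n where "n = s \<ominus> h"
  have S: "s \<in> S" "n \<in> S" using r(1) h(1) by (auto simp: s_def n_def)
  have star: "s\<^sup>\<star> = s" "n\<^sup>\<star> = n" using r(1,2) h(1,2) by (simp_all add: s_def n_def star_mult star_sub)
  have hr: "h \<otimes> r = r \<otimes> h" by (rule r(4)) (use h in auto)
  have hs: "h \<otimes> s = s \<otimes> h" unfolding s_def by (rule commute_square) (use hr h(1) r(1) in auto)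
  have ss: "s \<otimes> s = h \<otimes> h" using r(3) by (simp add: s_def)
  \<comment> \<open>From \<open>s\<^sup>2 = h\<^sup>2\<close> and commutation:
    \<open>n h = s h - s\<^sup>2 = - n s\<close>.\<close>
  have nh: "n \<otimes> h = (-1) \<odot> (n \<otimes> s)"
    using S h ss hs unfolding n_def by (intro lin_eqI) (simp_all add: lin_simps expand)
  have rn: "r \<otimes> n = \<zero>"
  proof (rule P_faithful)
    fix f assume f: "f \<in> P"
    have "n \<otimes> h \<otimes> n = (-1) \<odot> ((r \<otimes> n)\<^sup>\<star> \<otimes> (r \<otimes> n))"
      unfolding nh using S(2) r(1,2) star(2) by (simp add: s_def star_mult smult_mult_left mult_assoc)
    then have "f (n \<otimes> h \<otimes> n) = - f ((r \<otimes> n)\<^sup>\<star> \<otimes> (r \<otimes> n))"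
      using f S r(1) by (simp add: P_smult)
    then show "f ((r \<otimes> n)\<^sup>\<star> \<otimes> (r \<otimes> n)) = 0"
      using pos[OF S(2) star(2) f] P_pos[OF f, of "r \<otimes> n"] r(1) S by (simp add: complex_eq_iff)
  qed (use r(1) S in auto)
  have sn: "s \<otimes> n = \<zero>" using rn r(1) S(2) by (simp add: s_def mult_assoc)
  have hn: "h \<otimes> n = n \<otimes> h" unfolding n_def using h(1) S(1) hs by (simp add: distrib_left_sub distrib_right_sub)
  have "n \<otimes> s = (s \<otimes> n)\<^sup>\<star>" using S star by (simp add: star_mult)
  then have "n \<otimes> s = \<zero>" "h \<otimes> n = \<zero>" using sn hn nh by simp_all
  moreover have "n \<otimes> n = s \<otimes> n \<ominus> h \<otimes> n"
    unfolding n_def using S(1) h(1) by (simp add: distrib_right_sub)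
  ultimately have "n\<^sup>\<star> \<otimes> n = \<zero>" using sn star by simp
  then have "n = \<zero>" using norm_cstar[OF S(2)] norm_eq_0[OF S(2)] by simp
  then have "r \<otimes> r = h" using S(1) h(1) by (simp add: n_def sub_eq_0 s_def)
  then show ?thesis using that[OF r(1,2) _ r(4)] by blast
qed

theorem pos_sqrt:
  assumes h: "h \<in> S" "h\<^sup>\<star> = h"
    and pos: "\<And>n f. n \<in> S \<Longrightarrow> n\<^sup>\<star> = n \<Longrightarrow> f \<in> P \<Longrightarrow> 0 \<le> Re (f (n \<otimes> h \<otimes> n))"
  obtains r where "r \<in> S" "r\<^sup>\<star> = r" "r \<otimes> r = h"
    "\<And>z. z \<in> S \<Longrightarrow> z \<otimes> h = h \<otimes> z \<Longrightarrow> z \<otimes> r = r \<otimes> z"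
proof -
  \<comment> \<open>The extra 1 keeps the scaling factor invertible when \<open>h\<close> is
    zero.\<close>
  define c where "c = \<parallel>h\<parallel> + 1"
  have c: "c > 0" "\<parallel>h\<parallel> \<le> c" using h by (simp_all add: c_def add_nonneg_pos)
  let ?g = "complex_of_real (1/c) \<odot> h"
  obtain r where r: "r \<in> S" "r\<^sup>\<star> = r" "r \<otimes> r = ?g"
    "\<And>z. z \<in> S \<Longrightarrow> z \<otimes> ?g = ?g \<otimes> z \<Longrightarrow> z \<otimes> r = r \<otimes> z"
  proof (rule pos_sqrt_contraction[of ?g])
    show "?g \<in> S" "?g\<^sup>\<star> = ?g" using h by (auto simp: star_smult)
    show "\<parallel>?g\<parallel> \<le> 1" using c h by (simp add: norm_divide)
    show "0 \<le> Re (f (n \<otimes> ?g \<otimes> n))" if "n \<in> S" "n\<^sup>\<star> = n" "f \<in> P" for n f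
      using pos[OF that] that c h
      by (simp add: smult_mult_left smult_mult_right P_smult mult_assoc Re_divide_of_real)
  qed (use that in blast)
  let ?r = "complex_of_real (sqrt c) \<odot> r"
  have "?r \<otimes> ?r = complex_of_real (sqrt c * sqrt c) \<odot> (r \<otimes> r)"
    using r(1) by (simp add: smult_mult_left smult_mult_right del: real_sqrt_mult_self real_sqrt_abs2 of_real_mult flip: of_real_mult)
  also have "\<dots> = h" unfolding r(3) using c h by simp
  finally have "?r \<otimes> ?r = h" .
  moreover have "z \<otimes> ?r = ?r \<otimes> z" if "z \<in> S" "z \<otimes> h = h \<otimes> z" for z
    using r(1) r(4)[of z] that h by (simp add: smult_mult_left smult_mult_right)
  ultimately show ?thesis using that[of ?r] r by (simp add: star_smult)
qed

text \<open>Recovers the norm from the functionals alone. With \<open>g\<close> the root of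
  \<open>a\<^sup>\<star> a\<close> and \<open>b\<close> that of
  \<open>1 - a\<^sup>\<star> a\<close>, the relation \<open>g\<^sup>2 + b\<^sup>2 = 1\<close> bounds
  \<open>g\<close>, and the C*-identity passes the bound to \<open>a\<close>.\<close>

lemma norm_le_one_if_pos:
  assumes a: "a \<in> S"
    and pos: "\<And>y f. y \<in> S \<Longrightarrow> f \<in> P \<Longrightarrow> Re (f ((a \<otimes> y)\<^sup>\<star> \<otimes> (a \<otimes> y))) \<le> Re (f (y\<^sup>\<star> \<otimes> y))"
  shows "\<parallel>a\<parallel> \<le> 1"
proof -
  let ?k = "a\<^sup>\<star> \<otimes> a"
  obtain g where g: "g \<in> S" "g\<^sup>\<star> = g" "g \<otimes> g = ?k"
  proof (rule pos_sqrt[of ?k])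
    show "?k \<in> S" "?k\<^sup>\<star> = ?k" using a by (auto simp: star_mult)
    show "0 \<le> Re (f (n \<otimes> ?k \<otimes> n))" if "n \<in> S" "n\<^sup>\<star> = n" "f \<in> P" for n f
      using P_pos[of f "a \<otimes> n"] that a by (simp add: star_mult mult_assoc)
  qed (use that in blast)
  obtain b where b: "b \<in> S" "b\<^sup>\<star> = b" "b \<otimes> b = \<one> \<ominus> ?k"
    "\<And>z. z \<in> S \<Longrightarrow> z \<otimes> (\<one> \<ominus> ?k) = (\<one> \<ominus> ?k) \<otimes> z \<Longrightarrow> z \<otimes> b = b \<otimes> z"
  proof (rule pos_sqrt[of "\<one> \<ominus> ?k"])
    show "\<one> \<ominus> ?k \<in> S" "(\<one> \<ominus> ?k)\<^sup>\<star> = \<one> \<ominus> ?k" using a by (auto simp: star_mult star_sub)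
    show "0 \<le> Re (f (n \<otimes> (\<one> \<ominus> ?k) \<otimes> n))" if "n \<in> S" "n\<^sup>\<star> = n" "f \<in> P" for n f
      using pos[of n f] that a lin_simps(3)[OF lin_P[OF that(3)], of "n \<otimes> n" "n \<otimes> (?k \<otimes> n)"]
      by (simp add: star_mult mult_assoc distrib_left_sub distrib_right_sub)
  qed (use that in blast)
  have "g \<otimes> ?k = ?k \<otimes> g" unfolding g(3)[symmetric] using g(1) by (simp add: mult_assoc)
  then have "g \<otimes> b = b \<otimes> g"
    using a g by (intro b(4)) (simp_all add: distrib_left_sub distrib_right_sub)
  moreover have "g \<otimes> g \<oplus> b \<otimes> b = \<one>"
    unfolding g(3) b(3) using a add_comm[of ?k "\<one> \<ominus> ?k"] by simp
  ultimately have "\<parallel>g\<parallel> \<le> 1" using norm_le_one_if_squares_sum[OF g(1,2) b(1,2)] by blast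
  then have "\<parallel>a\<parallel>\<^sup>2 \<le> 1"
    using norm_cstar[OF a] g(1) g(3)[symmetric] norm_mult[of g g] mult_mono[of "\<parallel>g\<parallel>" 1 "\<parallel>g\<parallel>" 1] by simp
  then show ?thesis using power2_le_imp_le[of "\<parallel>a\<parallel>" 1] by simp
qed

lemma norm_le_if_bounded:
  assumes a: "a \<in> S" and c: "c \<ge> 0"
    and pos: "\<And>y f. y \<in> S \<Longrightarrow> f \<in> P \<Longrightarrow> Re (f ((a \<otimes> y)\<^sup>\<star> \<otimes> (a \<otimes> y))) \<le> c\<^sup>2 * Re (f (y\<^sup>\<star> \<otimes> y))"
  shows "\<parallel>a\<parallel> \<le> c"
proof (rule dense_ge)
  \<comment> \<open>Scaling by \<open>d > c\<close> rather than by \<open>c\<close> spares a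
    separate case \<open>c = 0\<close>.\<close>
  fix d assume "c < d"
  then have d: "0 < d" "c\<^sup>2 \<le> d\<^sup>2" using c by (auto intro: power_mono)
  let ?b = "complex_of_real (1/d) \<odot> a"
  have "\<parallel>?b\<parallel> \<le> 1"
  proof (rule norm_le_one_if_pos)
    fix y f assume *: "y \<in> S" "f \<in> P"
    have "(?b \<otimes> y)\<^sup>\<star> \<otimes> (?b \<otimes> y) = complex_of_real (1/d\<^sup>2) \<odot> ((a \<otimes> y)\<^sup>\<star> \<otimes> (a \<otimes> y))"
      using * a by (simp add: smult_mult_left smult_mult_right star_smult power2_eq_square)
    then have "Re (f ((?b \<otimes> y)\<^sup>\<star> \<otimes> (?b \<otimes> y))) = Re (f ((a \<otimes> y)\<^sup>\<star> \<otimes> (a \<otimes> y))) / d\<^sup>2"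
      using * a by (simp add: P_smult Re_divide_of_real flip: of_real_power)
    also have "\<dots> \<le> Re (f (y\<^sup>\<star> \<otimes> y))"
      using pos[OF *] d P_pos[OF *(2,1)] mult_right_mono[OF d(2), of "Re (f (y\<^sup>\<star> \<otimes> y))"]
      by (simp add: divide_le_eq mult.commute)
    finally show "Re (f ((?b \<otimes> y)\<^sup>\<star> \<otimes> (?b \<otimes> y))) \<le> Re (f (y\<^sup>\<star> \<otimes> y))" .
  qed (use a in auto)
  then show "\<parallel>a\<parallel> \<le> d" using a d by (simp add: norm_divide)
qed

text \<open>The hypotheses place \<open>g\<close> between -1 and 1 in the order given by squares.
  With commuting roots \<open>p\<close> of \<open>1 - g\<close> and \<open>q\<close> of
  \<open>1 + g\<close>, the product \<open>p q\<close> has square \<open>1 - g\<^sup>2\<close>, so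
  \<open>g\<close> is the real part of a unitary.\<close>

lemma hermitian_norm_le_one:
  assumes g: "g \<in> S" and r: "r \<in> S" "r\<^sup>\<star> \<otimes> r = \<one> \<ominus> g" and s: "s \<in> S" "s\<^sup>\<star> \<otimes> s = \<one> \<oplus> g"
  shows "\<parallel>g\<parallel> \<le> 1"
proof -
  \<comment> \<open>\<open>\<one> \<oplus> g\<close> is hermitian because it has the form
    \<open>s\<^sup>\<star> \<otimes> s\<close>; hence so is \<open>g\<close>.\<close>
  have "(s\<^sup>\<star> \<otimes> s)\<^sup>\<star> = s\<^sup>\<star> \<otimes> s" using s(1) by (simp add: star_mult)
  then have "\<one> \<oplus> g\<^sup>\<star> = \<one> \<oplus> g" unfolding s(2) using g by (simp add: star_add)
  then have "f (g\<^sup>\<star>) = f g" if "lin f" for f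
    using that g lin_simps(1)[OF that, of \<one> g] lin_simps(1)[OF that, of \<one> "g\<^sup>\<star>"] by simp
  then have gs: "g\<^sup>\<star> = g" using g by (intro lin_eqI) auto
  have pos: "0 \<le> Re (f (n \<otimes> (t\<^sup>\<star> \<otimes> t) \<otimes> n))" if "t \<in> S" "n \<in> S" "n\<^sup>\<star> = n" "f \<in> P" for t n f
    using P_pos[of f "t \<otimes> n"] that by (simp add: star_mult mult_assoc)
  obtain p where p: "p \<in> S" "p\<^sup>\<star> = p" "p \<otimes> p = \<one> \<ominus> g"
    "\<And>z. z \<in> S \<Longrightarrow> z \<otimes> (\<one> \<ominus> g) = (\<one> \<ominus> g) \<otimes> z \<Longrightarrow> z \<otimes> p = p \<otimes> z"
  proof (rule pos_sqrt[of "\<one> \<ominus> g"])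
    show "\<one> \<ominus> g \<in> S" "(\<one> \<ominus> g)\<^sup>\<star> = \<one> \<ominus> g" using g gs by (auto simp: star_sub)
    show "0 \<le> Re (f (n \<otimes> (\<one> \<ominus> g) \<otimes> n))" if "n \<in> S" "n\<^sup>\<star> = n" "f \<in> P" for n f
      using pos[OF r(1) that] r(2) by simp
  qed (use that in blast)
  obtain q where q: "q \<in> S" "q\<^sup>\<star> = q" "q \<otimes> q = \<one> \<oplus> g"
    "\<And>z. z \<in> S \<Longrightarrow> z \<otimes> (\<one> \<oplus> g) = (\<one> \<oplus> g) \<otimes> z \<Longrightarrow> z \<otimes> q = q \<otimes> z"
  proof (rule pos_sqrt[of "\<one> \<oplus> g"])
    show "\<one> \<oplus> g \<in> S" "(\<one> \<oplus> g)\<^sup>\<star> = \<one> \<oplus> g" using g gs by (auto simp: star_add)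
    show "0 \<le> Re (f (n \<otimes> (\<one> \<oplus> g) \<otimes> n))" if "n \<in> S" "n\<^sup>\<star> = n" "f \<in> P" for n f
      using pos[OF s(1) that] s(2) by simp
  qed (use that in blast)
  have comm: "g \<otimes> p = p \<otimes> g" "g \<otimes> q = q \<otimes> g"
    by (rule p(4) q(4); use g in \<open>simp add: distrib_left distrib_right distrib_left_sub distrib_right_sub\<close>)+
  have qp: "q \<otimes> p = p \<otimes> q"
    by (rule p(4)) (use comm q(1) g in \<open>simp_all add: distrib_left_sub distrib_right_sub\<close>)
  let ?b = "p \<otimes> q"
  have "?b \<otimes> ?b = p \<otimes> (q \<otimes> p) \<otimes> q" using p(1) q(1) by (simp add: mult_assoc)
  also have "\<dots> = (p \<otimes> p) \<otimes> (q \<otimes> q)" unfolding qp using p(1) q(1) by (simp add: mult_assoc)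
  also have "\<dots> = (\<one> \<ominus> g) \<otimes> (\<one> \<oplus> g)" unfolding p(3) q(3) ..
  finally have bb: "?b \<otimes> ?b = (\<one> \<ominus> g) \<otimes> (\<one> \<oplus> g)" .
  show ?thesis
  proof (rule norm_le_one_if_squares_sum[of g ?b])
    show "g \<otimes> ?b = ?b \<otimes> g" using comm p(1) q(1) g by (metis mult_assoc)
    show "g \<otimes> g \<oplus> ?b \<otimes> ?b = \<one>"
      unfolding bb using g by (intro lin_eqI) (simp_all add: lin_simps expand)
  qed (use g gs p(1,2) q(1,2) qp in \<open>auto simp: star_mult\<close>)
qed

end

section \<open>Completion of an algebra of expressions\<close>

definition supnorm :: "('i \<Rightarrow> complex) \<Rightarrow> real" where
  "supnorm F = (SUP i. cmod (F i))"

lemma bdd_above_cmod: "bounded (range F) \<Longrightarrow> bdd_above (range (\<lambda>i. cmod (F i)))"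
  by (auto simp: bounded_iff bdd_above_def)

lemma cmod_le_supnorm: "bounded (range F) \<Longrightarrow> cmod (F i) \<le> supnorm F"
  unfolding supnorm_def by (rule cSUP_upper) (auto simp: bdd_above_cmod)

lemma supnorm_le: "(\<And>i. cmod (F i) \<le> c) \<Longrightarrow> supnorm F \<le> c"
  unfolding supnorm_def by (rule cSUP_least) auto

lemma supnorm_nonneg: "bounded (range F) \<Longrightarrow> 0 \<le> supnorm F"
  using cmod_le_supnorm[of F] norm_ge_zero order_trans by blast

lemma supnorm_eq_0: "bounded (range F) \<Longrightarrow> supnorm F = 0 \<longleftrightarrow> F = (\<lambda>_. 0)"
proof
  assume "bounded (range F)" "supnorm F = 0"
  then show "F = (\<lambda>_. 0)" using cmod_le_supnorm[of F] by (metis norm_le_zero_iff)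
qed (simp add: supnorm_def)

lemma bounded_range_scale: "bounded (range F) \<Longrightarrow> bounded (range (\<lambda>i. c * F i :: complex))"
  using bounded_linear_image[OF _ bounded_linear_mult_right, of "range F" c]
  by (simp add: image_image)

lemma supnorm_add:
  assumes "bounded (range F)" "bounded (range G)"
  shows "supnorm (\<lambda>i. F i + G i) \<le> supnorm F + supnorm G"
  by (rule supnorm_le, rule order_trans[OF norm_triangle_ineq])
    (intro add_mono cmod_le_supnorm assms)

lemma supnorm_scale:
  assumes "bounded (range F)"
  shows "supnorm (\<lambda>i. c * F i) = cmod c * supnorm F"
proof (rule antisym)
  show "supnorm (\<lambda>i. c * F i) \<le> cmod c * supnorm F"
    by (rule supnorm_le) (simp add: norm_mult mult_left_mono cmod_le_supnorm assms)
  show "cmod c * supnorm F \<le> supnorm (\<lambda>i. c * F i)"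
  proof (cases "c = 0")
    case False
    have "supnorm F \<le> supnorm (\<lambda>i. c * F i) / cmod c"
      using cmod_le_supnorm[OF bounded_range_scale[OF assms, of c]] False
      by (intro supnorm_le) (simp add: norm_mult pos_le_divide_eq mult.commute)
    then show ?thesis using False by (simp add: pos_le_divide_eq mult.commute)
  qed (simp add: supnorm_def)
qed

text \<open>Expressions are syntax, so the laws of an algebra are only demanded after evaluation by
  \<open>\<Phi>\<close> to functions on an index set. Sums and multiples are pointwise there and the
  involution permutes the index by \<open>fl\<close>, but multiplication has no pointwise
  formula.\<close>

locale star_model =
  fixes W :: "'e set" and add :: "'e \<Rightarrow> 'e \<Rightarrow> 'e" and sm :: "complex \<Rightarrow> 'e \<Rightarrow> 'e"
    and mul :: "'e \<Rightarrow> 'e \<Rightarrow> 'e" and st :: "'e \<Rightarrow> 'e" and one :: 'e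
    and \<Phi> :: "'e \<Rightarrow> 'i \<Rightarrow> complex" and fl :: "'i \<Rightarrow> 'i"
  assumes W_closed [simp]: "x \<in> W \<Longrightarrow> y \<in> W \<Longrightarrow> add x y \<in> W" "x \<in> W \<Longrightarrow> sm c x \<in> W"
      "x \<in> W \<Longrightarrow> y \<in> W \<Longrightarrow> mul x y \<in> W" "x \<in> W \<Longrightarrow> st x \<in> W" "one \<in> W"
    and \<Phi>_add: "x \<in> W \<Longrightarrow> y \<in> W \<Longrightarrow> \<Phi> (add x y) i = \<Phi> x i + \<Phi> y i"
    and \<Phi>_sm: "x \<in> W \<Longrightarrow> \<Phi> (sm c x) i = c * \<Phi> x i"
    and \<Phi>_st: "x \<in> W \<Longrightarrow> \<Phi> (st x) i = cnj (\<Phi> x (fl i))"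
    and fl_fl [simp]: "fl (fl i) = i"
    and bounded_\<Phi>: "x \<in> W \<Longrightarrow> bounded (range (\<Phi> x))"
    and \<Phi>_mul_assoc: "x \<in> W \<Longrightarrow> y \<in> W \<Longrightarrow> z \<in> W \<Longrightarrow> \<Phi> (mul (mul x y) z) = \<Phi> (mul x (mul y z))"
    and \<Phi>_one: "x \<in> W \<Longrightarrow> \<Phi> (mul one x) = \<Phi> x" "x \<in> W \<Longrightarrow> \<Phi> (mul x one) = \<Phi> x"
    and \<Phi>_distrib: "x \<in> W \<Longrightarrow> y \<in> W \<Longrightarrow> z \<in> W \<Longrightarrow> \<Phi> (mul x (add y z)) i = \<Phi> (mul x y) i + \<Phi> (mul x z) i"
      "x \<in> W \<Longrightarrow> y \<in> W \<Longrightarrow> z \<in> W \<Longrightarrow> \<Phi> (mul (add x y) z) i = \<Phi> (mul x z) i + \<Phi> (mul y z) i"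
    and \<Phi>_mul_sm: "x \<in> W \<Longrightarrow> y \<in> W \<Longrightarrow> \<Phi> (mul (sm c x) y) i = c * \<Phi> (mul x y) i"
      "x \<in> W \<Longrightarrow> y \<in> W \<Longrightarrow> \<Phi> (mul x (sm c y)) i = c * \<Phi> (mul x y) i"
    and \<Phi>_st_mul: "x \<in> W \<Longrightarrow> y \<in> W \<Longrightarrow> \<Phi> (st (mul x y)) = \<Phi> (mul (st y) (st x))"
    and norm_mul: "x \<in> W \<Longrightarrow> y \<in> W \<Longrightarrow> supnorm (\<Phi> (mul x y)) \<le> supnorm (\<Phi> x) * supnorm (\<Phi> y)"
    and norm_cstar: "x \<in> W \<Longrightarrow> (supnorm (\<Phi> x))\<^sup>2 \<le> supnorm (\<Phi> (mul (st x) x))"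
begin

definition approx :: "(nat \<Rightarrow> 'e) \<Rightarrow> ('i \<Rightarrow> complex) \<Rightarrow> bool" where
  "approx x F \<longleftrightarrow> (\<forall>n. x n \<in> W) \<and> uniform_limit UNIV (\<lambda>n. \<Phi> (x n)) F sequentially"

definition carrier :: "('i \<Rightarrow> complex) set" where
  "carrier = {F. \<exists>x. approx x F}"

text \<open>For want of a pointwise formula the product is chosen as a limit of products of
  approximants; by \<open>mul_cross_limit\<close> all approximants lead to the same limit.\<close>

definition mulC :: "('i \<Rightarrow> complex) \<Rightarrow> ('i \<Rightarrow> complex) \<Rightarrow> 'i \<Rightarrow> complex" where
  "mulC F G = (SOME H. \<exists>x y. approx x F \<and> approx y G \<and> approx (\<lambda>n. mul (x n) (y n)) H)"

definition completion :: "('i \<Rightarrow> complex) cstar_alg" where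
  "completion = \<lparr>cs_carrier = carrier, cs_add = (\<lambda>F G i. F i + G i), cs_smult = (\<lambda>c F i. c * F i),
     cs_mult = mulC, cs_star = (\<lambda>F i. cnj (F (fl i))), cs_norm = supnorm,
     cs_zero = (\<lambda>_. 0), cs_one = \<Phi> one\<rparr>"

lemma approx_W: "approx x F \<Longrightarrow> x n \<in> W"
  by (simp add: approx_def)

lemma approxI:
  "(\<And>n. x n \<in> W) \<Longrightarrow> (\<And>e. e > 0 \<Longrightarrow> \<exists>N. \<forall>n\<ge>N. \<forall>i. cmod (\<Phi> (x n) i - F i) < e) \<Longrightarrow> approx x F"
  by (auto simp: approx_def uniform_limit_sequentially_iff dist_norm)

lemma approxD:
  assumes "approx x F" "e > 0" obtains N where "\<And>n i. n \<ge> N \<Longrightarrow> cmod (\<Phi> (x n) i - F i) < e"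
  using assms unfolding approx_def uniform_limit_sequentially_iff dist_norm by (meson UNIV_I)

lemma approx_LIMSEQ: "approx x F \<Longrightarrow> (\<lambda>n. \<Phi> (x n) i) \<longlonglongrightarrow> F i"
  by (auto simp: approx_def intro: tendsto_uniform_limitI)

lemma approx_unique:
  assumes "approx x F" "approx y G" "\<And>n. \<Phi> (x n) = \<Phi> (y n)" shows "F = G"
proof
  fix i show "F i = G i"
    using approx_LIMSEQ[OF assms(1), of i] approx_LIMSEQ[OF assms(2), of i]
    unfolding assms(3) by (rule LIMSEQ_unique)
qed

lemma approx_bounded:
  assumes "approx x F" shows "bounded (range F)"
proof -
  obtain N where N: "\<And>n i. n \<ge> N \<Longrightarrow> cmod (\<Phi> (x n) i - F i) < 1" using approxD[OF assms] zero_less_one by blast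
  obtain B where B: "\<And>i. cmod (\<Phi> (x N) i) \<le> B"
    using bounded_\<Phi>[OF approx_W[OF assms]] by (auto simp: bounded_iff)
  have "cmod (F i) \<le> B + 1" for i
    using N[of N i] B[of i] norm_triangle_ineq4[of "\<Phi> (x N) i" "\<Phi> (x N) i - F i"] by simp
  then show ?thesis by (auto simp: bounded_iff)
qed

lemma carrier_bounded: "F \<in> carrier \<Longrightarrow> bounded (range F)"
  using approx_bounded by (auto simp: carrier_def)

lemma approx_carrier: "approx x F \<Longrightarrow> F \<in> carrier"
  by (auto simp: carrier_def)

lemma carrier_approx: assumes "F \<in> carrier" obtains x where "approx x F"
  using assms by (auto simp: carrier_def)

lemma approx_const: "x \<in> W \<Longrightarrow> approx (\<lambda>_. x) (\<Phi> x)"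
  by (simp add: approx_def uniform_limit_const)

lemma approx_add:
  assumes "approx x F" "approx y G"
  shows "approx (\<lambda>n. add (x n) (y n)) (\<lambda>i. F i + G i)"
proof -
  have "uniform_limit UNIV (\<lambda>n i. \<Phi> (x n) i + \<Phi> (y n) i) (\<lambda>i. F i + G i) sequentially"
    using assms by (auto simp: approx_def intro!: uniform_limit_add)
  moreover have "(\<lambda>n i. \<Phi> (x n) i + \<Phi> (y n) i) = (\<lambda>n. \<Phi> (add (x n) (y n)))"
    using assms[THEN approx_W] by (simp add: fun_eq_iff \<Phi>_add)
  ultimately show ?thesis using assms by (simp add: approx_def)
qed

lemma approx_sm:
  assumes "approx x F" shows "approx (\<lambda>n. sm c (x n)) (\<lambda>i. c * F i)"
proof -
  have "uniform_limit UNIV (\<lambda>n i. c * \<Phi> (x n) i) (\<lambda>i. c * F i) sequentially"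
    using assms by (auto simp: approx_def intro: bounded_linear.uniform_limit[OF bounded_linear_mult_right])
  moreover have "(\<lambda>n i. c * \<Phi> (x n) i) = (\<lambda>n. \<Phi> (sm c (x n)))"
    using approx_W[OF assms] by (simp add: fun_eq_iff \<Phi>_sm)
  ultimately show ?thesis using assms by (simp add: approx_def)
qed

lemma approx_st:
  assumes "approx x F" shows "approx (\<lambda>n. st (x n)) (\<lambda>i. cnj (F (fl i)))"
proof (rule approxI)
  fix e :: real assume "e > 0"
  then obtain N where "\<And>n i. n \<ge> N \<Longrightarrow> cmod (\<Phi> (x n) i - F i) < e" using approxD[OF assms] by blast
  then show "\<exists>N. \<forall>n\<ge>N. \<forall>i. cmod (\<Phi> (st (x n)) i - cnj (F (fl i))) < e"
    using approx_W[OF assms] by (auto simp: \<Phi>_st simp flip: complex_cnj_diff)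
qed (use approx_W[OF assms] in simp)

lemma approx_norm:
  assumes "approx x F" shows "(\<lambda>n. supnorm (\<Phi> (x n))) \<longlonglongrightarrow> supnorm F"
proof (rule LIMSEQ_I)
  fix e :: real assume e: "e > 0"
  then obtain N where N: "\<And>n i. n \<ge> N \<Longrightarrow> cmod (\<Phi> (x n) i - F i) < e/2"
    using approxD[OF assms, of "e/2"] by auto
  have "\<bar>supnorm (\<Phi> (x n)) - supnorm F\<bar> < e" if "n \<ge> N" for n
  proof -
    have b: "bounded (range (\<Phi> (x n)))" "bounded (range F)"
      using bounded_\<Phi>[OF approx_W[OF assms]] approx_bounded[OF assms] by auto
    have "supnorm (\<Phi> (x n)) \<le> supnorm F + e/2"
    proof (rule supnorm_le)
      fix i show "cmod (\<Phi> (x n) i) \<le> supnorm F + e/2"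
        using N[OF that, of i] cmod_le_supnorm[OF b(2), of i] norm_triangle_sub[of "\<Phi> (x n) i" "F i"] by simp
    qed
    moreover have "supnorm F \<le> supnorm (\<Phi> (x n)) + e/2"
    proof (rule supnorm_le)
      fix i show "cmod (F i) \<le> supnorm (\<Phi> (x n)) + e/2"
        using N[OF that, of i] cmod_le_supnorm[OF b(1), of i] norm_triangle_sub[of "F i" "\<Phi> (x n) i"]
        by (simp add: norm_minus_commute)
    qed
    ultimately show ?thesis using e by (simp add: abs_less_iff)
  qed
  then show "\<exists>N. \<forall>n\<ge>N. norm (supnorm (\<Phi> (x n)) - supnorm F) < e" by auto
qed

lemma approx_norm_bound:
  assumes "approx x F" obtains B where "B > 0" "\<And>n. supnorm (\<Phi> (x n)) \<le> B"
proof -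
  have "Bseq (\<lambda>n. supnorm (\<Phi> (x n)))"
    using approx_norm[OF assms] convergentI convergent_imp_Bseq by blast
  then show ?thesis using that by (auto elim!: BseqE simp: abs_le_iff)
qed

text \<open>The telescoping \<open>x y - x' y' = (x - x') y + x' (y - y')\<close>, carried out on
  expressions, where a difference is an \<open>add\<close> with \<open>sm\<close> by -1.\<close>

lemma mul_diff:
  assumes "x \<in> W" "y \<in> W" "x' \<in> W" "y' \<in> W"
    and "\<And>i. cmod (\<Phi> x i - \<Phi> x' i) \<le> a" "\<And>i. cmod (\<Phi> y i - \<Phi> y' i) \<le> b"
  shows "cmod (\<Phi> (mul x y) i - \<Phi> (mul x' y') i) \<le> a * supnorm (\<Phi> y) + supnorm (\<Phi> x') * b"
proof -
  let ?d = "add x (sm (-1) x')" and ?e = "add y (sm (-1) y')"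
  have W: "?d \<in> W" "?e \<in> W" using assms by auto
  have s: "supnorm (\<Phi> ?d) \<le> a" "supnorm (\<Phi> ?e) \<le> b"
    using assms by (auto intro!: supnorm_le simp: \<Phi>_add \<Phi>_sm)
  have "\<Phi> (mul x y) i - \<Phi> (mul x' y') i = \<Phi> (mul ?d y) i + \<Phi> (mul x' ?e) i"
    using assms by (simp add: \<Phi>_distrib \<Phi>_mul_sm)
  also have "cmod \<dots> \<le> supnorm (\<Phi> (mul ?d y)) + supnorm (\<Phi> (mul x' ?e))"
    using assms W by (intro order_trans[OF norm_triangle_ineq] add_mono cmod_le_supnorm bounded_\<Phi>) auto
  also have "\<dots> \<le> supnorm (\<Phi> ?d) * supnorm (\<Phi> y) + supnorm (\<Phi> x') * supnorm (\<Phi> ?e)"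
    using assms W by (intro add_mono norm_mul) auto
  also have "\<dots> \<le> a * supnorm (\<Phi> y) + supnorm (\<Phi> x') * b"
    using s assms by (intro add_mono mult_mono order_refl) (auto intro!: supnorm_nonneg bounded_\<Phi> order_trans[OF norm_ge_zero assms(5)])
  finally show ?thesis .
qed

text \<open>Two pairs of approximants with independent indices serve two purposes: equal pairs give
  the Cauchy property of the products, different pairs give independence of the choice.\<close>

lemma mul_cross_limit:
  assumes "approx x F" "approx x' F" "approx y G" "approx y' G" "e > 0"
  shows "\<exists>N. \<forall>m\<ge>N. \<forall>n\<ge>N. \<forall>i. cmod (\<Phi> (mul (x m) (y m)) i - \<Phi> (mul (x' n) (y' n)) i) < e"
proof -
  obtain B where B: "B > 0" "\<And>n. supnorm (\<Phi> (y n)) \<le> B" using approx_norm_bound[OF assms(3)] by blast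
  obtain C where C: "C > 0" "\<And>n. supnorm (\<Phi> (x' n)) \<le> C" using approx_norm_bound[OF assms(2)] by blast
  define D where "D = B + C"
  have D: "D > 0" using B C by (simp add: D_def)
  \<comment> \<open>Both differences are at most \<open>2 * d\<close>, so the total error is at most
    \<open>2 * d * (B + C)\<close>, which is \<open>e / 2\<close>.\<close>
  define d where "d = e / (4 * D)"
  have d: "d > 0" using D assms by (simp add: d_def)
  obtain N1 where N1: "\<And>n i. n \<ge> N1 \<Longrightarrow> cmod (\<Phi> (x n) i - F i) < d" using approxD[OF assms(1) d] by blast
  obtain N2 where N2: "\<And>n i. n \<ge> N2 \<Longrightarrow> cmod (\<Phi> (x' n) i - F i) < d" using approxD[OF assms(2) d] by blast
  obtain N3 where N3: "\<And>n i. n \<ge> N3 \<Longrightarrow> cmod (\<Phi> (y n) i - G i) < d" using approxD[OF assms(3) d] by blast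
  obtain N4 where N4: "\<And>n i. n \<ge> N4 \<Longrightarrow> cmod (\<Phi> (y' n) i - G i) < d" using approxD[OF assms(4) d] by blast
  define N where "N = Max {N1, N2, N3, N4}"
  have N: "N1 \<le> N" "N2 \<le> N" "N3 \<le> N" "N4 \<le> N" by (auto simp: N_def)
  have "cmod (\<Phi> (mul (x m) (y m)) i - \<Phi> (mul (x' n) (y' n)) i) < e" if "m \<ge> N" "n \<ge> N" for m n i
  proof -
    have "cmod (\<Phi> (x m) i - \<Phi> (x' n) i) \<le> 2 * d" for i
      using N1[of m i] N2[of n i] norm_triangle_ineq4[of "\<Phi> (x m) i - F i" "\<Phi> (x' n) i - F i"] N that
      by (simp add: norm_minus_commute)
    moreover have "cmod (\<Phi> (y m) i - \<Phi> (y' n) i) \<le> 2 * d" for i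
      using N3[of m i] N4[of n i] norm_triangle_ineq4[of "\<Phi> (y m) i - G i" "\<Phi> (y' n) i - G i"] N that
      by (simp add: norm_minus_commute)
    ultimately have "cmod (\<Phi> (mul (x m) (y m)) i - \<Phi> (mul (x' n) (y' n)) i)
        \<le> (2 * d) * supnorm (\<Phi> (y m)) + supnorm (\<Phi> (x' n)) * (2 * d)"
      by (intro mul_diff) (use assms approx_W in blast)+
    also have "\<dots> \<le> (2 * d) * B + C * (2 * d)"
      using B C d by (intro add_mono mult_left_mono mult_right_mono) auto
    also have "\<dots> = 2 * (d * D)" by (simp add: D_def algebra_simps)
    also have "\<dots> = e / 2" using D by (simp add: d_def)
    also have "\<dots> < e" using assms by simp
    finally show ?thesis .
  qed
  then show ?thesis by blast
qed

lemma mul_limit_exists: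
  assumes "approx x F" "approx y G" shows "\<exists>H. approx (\<lambda>n. mul (x n) (y n)) H"
proof -
  let ?f = "\<lambda>n. \<Phi> (mul (x n) (y n))"
  have "uniformly_Cauchy_on UNIV ?f"
    unfolding uniformly_Cauchy_on_def dist_norm
    using mul_cross_limit[OF assms(1,1) assms(2,2)] by blast
  then have "uniformly_convergent_on UNIV ?f" by (simp add: Cauchy_uniformly_convergent)
  then show ?thesis using assms by (auto simp: uniformly_convergent_on_def approx_def)
qed

lemma approx_mul:
  assumes "approx x F" "approx y G" shows "approx (\<lambda>n. mul (x n) (y n)) (mulC F G)"
proof -
  obtain H where H: "approx (\<lambda>n. mul (x n) (y n)) H" using mul_limit_exists[OF assms] by blast
  have "\<exists>x y. approx x F \<and> approx y G \<and> approx (\<lambda>n. mul (x n) (y n)) (mulC F G)"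
    unfolding mulC_def by (rule someI[of _ H]) (use assms H in blast)
  then obtain x' y' where x': "approx x' F" "approx y' G" "approx (\<lambda>n. mul (x' n) (y' n)) (mulC F G)"
    by blast
  show ?thesis
  proof (rule approxI)
    fix e :: real assume e: "e > 0"
    obtain N where N: "\<And>m n i. m \<ge> N \<Longrightarrow> n \<ge> N \<Longrightarrow>
        cmod (\<Phi> (mul (x m) (y m)) i - \<Phi> (mul (x' n) (y' n)) i) < e/2"
      using mul_cross_limit[OF assms(1) x'(1) assms(2) x'(2), of "e/2"] e by auto
    obtain M where M: "\<And>n i. n \<ge> M \<Longrightarrow> cmod (\<Phi> (mul (x' n) (y' n)) i - mulC F G i) < e/2"
      using approxD[OF x'(3), of "e/2"] e by auto
    have "cmod (\<Phi> (mul (x n) (y n)) i - mulC F G i) < e" if "n \<ge> N" for n i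
      using N[of n "max M N" i] M[of "max M N" i] that
      norm_diff_triangle_less[of "\<Phi> (mul (x n) (y n)) i" "\<Phi> (mul (x' (max M N)) (y' (max M N))) i" "e/2" "mulC F G i" "e/2"]
      by simp
    then show "\<exists>N. \<forall>n\<ge>N. \<forall>i. cmod (\<Phi> (mul (x n) (y n)) i - mulC F G i) < e" by blast
  qed (use assms approx_W in simp)
qed

lemma \<Phi>_mulC: "x \<in> W \<Longrightarrow> y \<in> W \<Longrightarrow> mulC (\<Phi> x) (\<Phi> y) = \<Phi> (mul x y)"
  using approx_unique[OF approx_mul[OF approx_const approx_const] approx_const] by simp

lemma completion_simps [simp]:
  "cs_carrier completion = carrier" "cs_add completion F G = (\<lambda>i. F i + G i)"
  "cs_smult completion c F = (\<lambda>i. c * F i)" "cs_mult completion = mulC"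
  "cs_star completion F = (\<lambda>i. cnj (F (fl i)))" "cs_norm completion = supnorm"
  "cs_zero completion = (\<lambda>_. 0)" "cs_one completion = \<Phi> one"
  by (simp_all add: completion_def)

lemma completion_sub [simp]: "cs_sub completion F G = (\<lambda>i. F i - G i)"
  by (simp add: cs_sub_def)

text \<open>The uniform limit exists because complex functions are complete; the point is its
  membership in \<open>carrier\<close>, shown by picking an expression within
  \<open>1 / Suc n\<close> of each \<open>X n\<close>.\<close>

lemma carrier_complete:
  assumes X: "\<And>n::nat. X n \<in> carrier"
    and Cauchy: "\<And>e. e > 0 \<Longrightarrow> \<exists>N. \<forall>m\<ge>N. \<forall>n\<ge>N. supnorm (\<lambda>i. X m i - X n i) < e"
  shows "\<exists>F\<in>carrier. (\<lambda>n. supnorm (\<lambda>i. X n i - F i)) \<longlonglongrightarrow> 0"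
proof -
  have b: "bounded (range (\<lambda>i. X m i - X n i))" for m n
    using bounded_minus_comp carrier_bounded[OF X] by blast
  have "uniformly_Cauchy_on UNIV X"
    unfolding uniformly_Cauchy_on_def dist_norm using Cauchy cmod_le_supnorm[OF b] by (meson le_less_trans)
  then obtain F where F: "uniform_limit UNIV X F sequentially"
    using Cauchy_uniformly_convergent uniformly_convergent_on_def by blast
  have "\<exists>y. y \<in> W \<and> (\<forall>i. cmod (\<Phi> y i - X n i) < 1 / real (Suc n))" for n
  proof -
    obtain x where x: "approx x (X n)" using carrier_approx[OF X] by blast
    obtain N where "\<And>k i. k \<ge> N \<Longrightarrow> cmod (\<Phi> (x k) i - X n i) < 1 / real (Suc n)"
      using approxD[OF x, of "1 / real (Suc n)"] by auto
    then show ?thesis using approx_W[OF x] by blast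
  qed
  then obtain y where y: "\<And>n. y n \<in> W" "\<And>n i. cmod (\<Phi> (y n) i - X n i) < 1 / real (Suc n)" by metis
  have "approx y F"
  proof (rule approxI)
    fix e :: real assume e: "e > 0"
    obtain N where N: "\<And>n i. n \<ge> N \<Longrightarrow> cmod (X n i - F i) < e/2"
      using F e unfolding uniform_limit_sequentially_iff dist_norm by (metis UNIV_I half_gt_zero)
    obtain M where M: "1 / real (Suc M) < e/2" using e by (meson half_gt_zero nat_approx_posE)
    have "cmod (\<Phi> (y n) i - F i) < e" if "n \<ge> max M N" for n i
    proof -
      have "1 / real (Suc n) \<le> 1 / real (Suc M)" using that by (simp add: frac_le)
      then have "cmod (\<Phi> (y n) i - X n i) < e/2" using y(2)[of n i] M by linarith
      then show ?thesis using N[of n i] that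
        norm_diff_triangle_less[of "\<Phi> (y n) i" "X n i" "e/2" "F i" "e/2"] by simp
    qed
    then show "\<exists>N. \<forall>n\<ge>N. \<forall>i. cmod (\<Phi> (y n) i - F i) < e" by blast
  qed (rule y)
  then have "F \<in> carrier" by (rule approx_carrier)
  moreover have "(\<lambda>n. supnorm (\<lambda>i. X n i - F i)) \<longlonglongrightarrow> 0"
  proof (rule LIMSEQ_I)
    fix e :: real assume e: "e > 0"
    obtain N where N: "\<And>n i. n \<ge> N \<Longrightarrow> cmod (X n i - F i) < e/2"
      using F e unfolding uniform_limit_sequentially_iff dist_norm by (metis UNIV_I half_gt_zero)
    have "norm (supnorm (\<lambda>i. X n i - F i) - 0) < e" if "n \<ge> N" for n
    proof -
      have "supnorm (\<lambda>i. X n i - F i) \<le> e/2" by (rule supnorm_le) (use N[OF that] less_imp_le in blast)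
      moreover have "0 \<le> supnorm (\<lambda>i. X n i - F i)"
        by (intro supnorm_nonneg bounded_minus_comp carrier_bounded X \<open>F \<in> carrier\<close>)
      ultimately show ?thesis using e by simp
    qed
    then show "\<exists>N. \<forall>n\<ge>N. norm (supnorm (\<lambda>i. X n i - F i) - 0) < e" by blast
  qed
  ultimately show ?thesis by blast
qed

lemma supnorm_fl:
  assumes "bounded (range F)" shows "supnorm (\<lambda>i. cnj (F (fl i))) = supnorm F"
proof -
  have "range (\<lambda>i. cmod (F (fl i))) = range (\<lambda>i. cmod (F i))"
  proof
    show "range (\<lambda>i. cmod (F i)) \<subseteq> range (\<lambda>i. cmod (F (fl i)))"
      by (rule image_subsetI, rule range_eqI[of _ _ "fl _"]) simp
  qed auto
  then show ?thesis by (simp add: supnorm_def)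
qed

lemma mulC_closed [simp]: "F \<in> carrier \<Longrightarrow> G \<in> carrier \<Longrightarrow> mulC F G \<in> carrier"
  using approx_mul approx_carrier by (metis carrier_approx)

text \<open>Each identity holds for approximating expressions and passes to uniform limits by
  \<open>approx_unique\<close>; the norm relations pass to the limit by
  \<open>approx_norm\<close>.\<close>

theorem completion_cstar: "unital_cstar_algebra completion"
proof -
  have zero: "(\<lambda>_. 0) \<in> carrier"
    using approx_sm[OF approx_const[of one], of 0] by (auto intro: approx_carrier)
  have one: "\<Phi> one \<in> carrier" using approx_const[of one] by (auto intro: approx_carrier)
  have add: "(\<lambda>i. F i + G i) \<in> carrier" if "F \<in> carrier" "G \<in> carrier" for F G
    using that approx_add by (metis carrier_approx approx_carrier)
  have sm: "(\<lambda>i. c * F i) \<in> carrier" if "F \<in> carrier" for c F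
    using that approx_sm by (metis carrier_approx approx_carrier)
  have st: "(\<lambda>i. cnj (F (fl i))) \<in> carrier" if "F \<in> carrier" for F
    using that approx_st by (metis carrier_approx approx_carrier)
  have assoc: "mulC (mulC F G) H = mulC F (mulC G H)"
    if mem: "F \<in> carrier" "G \<in> carrier" "H \<in> carrier" for F G H
  proof -
    obtain x y z where *: "approx x F" "approx y G" "approx z H" using mem by (auto simp: carrier_def)
    show ?thesis
      by (rule approx_unique[OF approx_mul[OF approx_mul[OF *(1,2)] *(3)] approx_mul[OF *(1) approx_mul[OF *(2,3)]]])
        (simp add: \<Phi>_mul_assoc *[THEN approx_W])
  qed
  have unit: "mulC (\<Phi> one) F = F" "mulC F (\<Phi> one) = F" if mem: "F \<in> carrier" for F
  proof -
    obtain x where *: "approx x F" using mem by (auto simp: carrier_def)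
    have o: "approx (\<lambda>_. one) (\<Phi> one)" by (rule approx_const) simp
    show "mulC (\<Phi> one) F = F" by (rule approx_unique[OF approx_mul[OF o *] *]) (simp add: \<Phi>_one approx_W[OF *])
    show "mulC F (\<Phi> one) = F" by (rule approx_unique[OF approx_mul[OF * o] *]) (simp add: \<Phi>_one approx_W[OF *])
  qed
  have dist: "mulC F (\<lambda>i. G i + H i) = (\<lambda>i. mulC F G i + mulC F H i)"
      "mulC (\<lambda>i. F i + G i) H = (\<lambda>i. mulC F H i + mulC G H i)"
    if mem: "F \<in> carrier" "G \<in> carrier" "H \<in> carrier" for F G H
  proof -
    obtain x y z where *: "approx x F" "approx y G" "approx z H" using mem by (auto simp: carrier_def)
    show "mulC F (\<lambda>i. G i + H i) = (\<lambda>i. mulC F G i + mulC F H i)"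
      by (rule approx_unique[OF approx_mul[OF *(1) approx_add[OF *(2,3)]]
            approx_add[OF approx_mul[OF *(1,2)] approx_mul[OF *(1,3)]]])
        (simp add: fun_eq_iff \<Phi>_distrib \<Phi>_add *[THEN approx_W])
    show "mulC (\<lambda>i. F i + G i) H = (\<lambda>i. mulC F H i + mulC G H i)"
      by (rule approx_unique[OF approx_mul[OF approx_add[OF *(1,2)] *(3)]
            approx_add[OF approx_mul[OF *(1,3)] approx_mul[OF *(2,3)]]])
        (simp add: fun_eq_iff \<Phi>_distrib \<Phi>_add *[THEN approx_W])
  qed
  have smul: "(\<lambda>i. c * mulC F G i) = mulC (\<lambda>i. c * F i) G" "(\<lambda>i. c * mulC F G i) = mulC F (\<lambda>i. c * G i)"
    if mem: "F \<in> carrier" "G \<in> carrier" for c F G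
  proof -
    obtain x y where *: "approx x F" "approx y G" using mem by (auto simp: carrier_def)
    show "(\<lambda>i. c * mulC F G i) = mulC (\<lambda>i. c * F i) G"
      by (rule approx_unique[OF approx_sm[OF approx_mul[OF *]] approx_mul[OF approx_sm[OF *(1)] *(2)]])
        (simp add: fun_eq_iff \<Phi>_mul_sm \<Phi>_sm *[THEN approx_W])
    show "(\<lambda>i. c * mulC F G i) = mulC F (\<lambda>i. c * G i)"
      by (rule approx_unique[OF approx_sm[OF approx_mul[OF *]] approx_mul[OF *(1) approx_sm[OF *(2)]]])
        (simp add: fun_eq_iff \<Phi>_mul_sm \<Phi>_sm *[THEN approx_W])
  qed
  have stmul: "(\<lambda>i. cnj (mulC F G (fl i))) = mulC (\<lambda>i. cnj (G (fl i))) (\<lambda>i. cnj (F (fl i)))"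
    if mem: "F \<in> carrier" "G \<in> carrier" for F G
  proof -
    obtain x y where *: "approx x F" "approx y G" using mem by (auto simp: carrier_def)
    show ?thesis
      by (rule approx_unique[OF approx_st[OF approx_mul[OF *]] approx_mul[OF approx_st[OF *(2)] approx_st[OF *(1)]]])
        (simp add: \<Phi>_st_mul *[THEN approx_W])
  qed
  have nmul: "supnorm (mulC F G) \<le> supnorm F * supnorm G" if mem: "F \<in> carrier" "G \<in> carrier" for F G
  proof -
    obtain x y where *: "approx x F" "approx y G" using mem by (auto simp: carrier_def)
    show ?thesis
      by (rule LIMSEQ_le[OF approx_norm[OF approx_mul[OF *]] tendsto_mult[OF *[THEN approx_norm]]])
        (use norm_mul *[THEN approx_W] in blast)
  qed
  have ncstar: "supnorm (mulC (\<lambda>i. cnj (F (fl i))) F) = (supnorm F)\<^sup>2" if F: "F \<in> carrier" for F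
  proof (rule antisym)
    show "supnorm (mulC (\<lambda>i. cnj (F (fl i))) F) \<le> (supnorm F)\<^sup>2"
      using nmul[OF st[OF F] F] supnorm_fl[OF carrier_bounded[OF F]] by (simp add: power2_eq_square)
    obtain x where *: "approx x F" using F carrier_approx by metis
    show "(supnorm F)\<^sup>2 \<le> supnorm (mulC (\<lambda>i. cnj (F (fl i))) F)"
      by (rule LIMSEQ_le[OF tendsto_power[OF approx_norm[OF *]] approx_norm[OF approx_mul[OF approx_st[OF *] *]]])
        (use norm_cstar *[THEN approx_W] in blast)
  qed
  have neg: "\<exists>G\<in>carrier. (\<lambda>i. F i + G i) = (\<lambda>_. 0)" if "F \<in> carrier" for F
    using sm[OF that, of "-1"] by (intro bexI[of _ "\<lambda>i. -1 * F i"]) auto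
  show ?thesis
    unfolding unital_cstar_algebra_def Let_def completion_simps completion_sub
    by (intro conjI ballI allI impI)
      (auto simp: zero one add sm st neg assoc unit dist smul[symmetric] stmul nmul ncstar
        supnorm_nonneg supnorm_eq_0 supnorm_add supnorm_scale carrier_bounded algebra_simps
        intro!: carrier_complete)
qed

end

section \<open>Algebras of operators on semi-inner product spaces\<close>

text \<open>The vectors obey no vector space laws: sums and multiples only have to be seen correctly
  by the second argument of \<open>ip\<close>. This admits formal sums, such as lists under
  \<open>append\<close>, and null vectors.\<close>

locale semi_inner =
  fixes V :: "'v set" and vadd :: "'v \<Rightarrow> 'v \<Rightarrow> 'v" and vsm :: "complex \<Rightarrow> 'v \<Rightarrow> 'v"
    and ip :: "'v \<Rightarrow> 'v \<Rightarrow> complex"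
  assumes V_closed [simp]: "v \<in> V \<Longrightarrow> w \<in> V \<Longrightarrow> vadd v w \<in> V" "v \<in> V \<Longrightarrow> vsm c v \<in> V"
    and ip_add: "z \<in> V \<Longrightarrow> v \<in> V \<Longrightarrow> w \<in> V \<Longrightarrow> ip z (vadd v w) = ip z v + ip z w"
    and ip_sm: "z \<in> V \<Longrightarrow> v \<in> V \<Longrightarrow> ip z (vsm c v) = c * ip z v"
    and ip_cnj: "v \<in> V \<Longrightarrow> w \<in> V \<Longrightarrow> ip w v = cnj (ip v w)"
    and ip_pos: "v \<in> V \<Longrightarrow> 0 \<le> Re (ip v v)"
begin

definition vnorm :: "'v \<Rightarrow> real" where
  "vnorm v = sqrt (Re (ip v v))"

lemma ip_self: "v \<in> V \<Longrightarrow> ip v v = complex_of_real ((vnorm v)\<^sup>2)"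
  using ip_cnj[of v v] ip_pos[of v] by (simp add: vnorm_def complex_eq_iff)

lemma vnorm_nonneg [simp]: "v \<in> V \<Longrightarrow> 0 \<le> vnorm v"
  by (simp add: vnorm_def ip_pos)

lemma vnorm_power2: "v \<in> V \<Longrightarrow> (vnorm v)\<^sup>2 = Re (ip v v)"
  by (simp add: vnorm_def ip_pos)

lemma ip_expand:
  assumes "v \<in> V" "w \<in> V"
  shows "Re (ip (vadd v (vsm s w)) (vadd v (vsm s w)))
    = Re (ip v v) + 2 * Re (s * ip v w) + (cmod s)\<^sup>2 * Re (ip w w)"
proof -
  let ?u = "vadd v (vsm s w)"
  have z: "ip z ?u = ip z v + s * ip z w" if "z \<in> V" for z
    using that assms by (simp add: ip_add ip_sm)
  have z': "ip ?u z = ip v z + cnj s * ip w z" if "z \<in> V" for z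
    using z[OF that] ip_cnj[of z ?u] ip_cnj[of z v] ip_cnj[of z w] that assms by simp
  have *: "ip w w = complex_of_real ((vnorm w)\<^sup>2)" using assms ip_self by simp
  have "ip ?u ?u = ip v v + cnj s * cnj (ip v w) + s * ip v w + (s * cnj s) * ip w w"
    using z z' assms ip_cnj[of v w] by (simp add: algebra_simps)
  also have "s * cnj s = complex_of_real ((cmod s)\<^sup>2)"
    by (rule complex_norm_square[symmetric])
  finally show ?thesis using * by (simp add: algebra_simps)
qed

text \<open>The square norm of \<open>v\<close> minus \<open>t * cnj c\<close> times
  \<open>w\<close> is a real quadratic in \<open>t\<close>; if \<open>b > 0\<close>, its value at
  \<open>t = 1 / b\<close> gives the claim.\<close>

lemma Cauchy_Schwarz:
  assumes "v \<in> V" "w \<in> V"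
  shows "cmod (ip v w) \<le> vnorm v * vnorm w"
proof -
  define a b c where "a = Re (ip v v)" and "b = Re (ip w w)" and "c = ip v w"
  have pos: "0 \<le> a - 2 * t * (cmod c)\<^sup>2 + t\<^sup>2 * (cmod c)\<^sup>2 * b" for t :: real
  proof -
    have "(- (complex_of_real t * cnj c)) * c = - complex_of_real (t * (cmod c)\<^sup>2)"
      by (simp only: of_real_mult complex_norm_square) (simp add: mult_ac)
    then have "Re ((- (complex_of_real t * cnj c)) * c) = - (t * (cmod c)\<^sup>2)"
      by (simp only: Re_complex_of_real flip: of_real_minus)
    then show ?thesis
      using ip_expand[OF assms, of "- (complex_of_real t * cnj c)"] assms ip_pos[of "vadd v (vsm (- (complex_of_real t * cnj c)) w)"]
      by (simp add: a_def b_def c_def[symmetric] norm_mult power_mult_distrib)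
  qed
  have a: "0 \<le> a" and b: "0 \<le> b" using assms ip_pos by (simp_all add: a_def b_def)
  have "(cmod c)\<^sup>2 \<le> a * b"
  proof (cases "b = 0")
    case True
    show ?thesis
    proof (rule ccontr)
      assume "\<not> ?thesis"
      then have "(cmod c)\<^sup>2 > 0" using True by simp
      \<comment> \<open>For \<open>b = 0\<close> the quadratic degenerates to a linear function,
        whose value at this \<open>t\<close> is \<open>a - 2 * (a + 1) < 0\<close>.\<close>
      then have "(a + 1) / (cmod c)\<^sup>2 * (cmod c)\<^sup>2 = a + 1" by simp
      then show False using pos[of "(a + 1) / (cmod c)\<^sup>2"] a True by (simp only: mult.assoc) simp
    qed
  next
    case False
    then have "b > 0" using b by simp
    then show ?thesis using pos[of "1 / b"] by (simp add: field_simps power2_eq_square)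
  qed
  then have "sqrt ((cmod c)\<^sup>2) \<le> sqrt (a * b)" by (rule real_sqrt_le_mono)
  then show ?thesis by (simp add: a_def b_def c_def vnorm_def real_sqrt_mult)
qed

lemma vnorm_add:
  assumes "v \<in> V" "w \<in> V" shows "vnorm (vadd v w) \<le> vnorm v + vnorm w"
proof -
  have c: "ip w v = cnj (ip v w)" by (rule ip_cnj[OF assms])
  have "ip (vadd v w) v = cnj (ip v v + ip v w)" "ip (vadd v w) w = cnj (ip w v + ip w w)"
    using assms by (simp_all add: ip_cnj[of _ "vadd v w"] ip_add)
  then have "Re (ip (vadd v w) (vadd v w)) = Re (ip v v) + 2 * Re (ip v w) + Re (ip w w)"
    using assms c by (simp add: ip_add)
  also have "\<dots> \<le> (vnorm v)\<^sup>2 + 2 * (vnorm v * vnorm w) + (vnorm w)\<^sup>2"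
    using Cauchy_Schwarz[OF assms] complex_Re_le_cmod[of "ip v w"] assms by (simp add: vnorm_power2)
  also have "\<dots> = (vnorm v + vnorm w)\<^sup>2" by (simp add: power2_eq_square algebra_simps)
  finally show ?thesis using assms by - (rule power2_le_imp_le, auto simp: vnorm_power2)
qed

end

text \<open>\<open>J\<close> indexes a whole family of representations with bounds uniform in
  \<open>j\<close>. The laws are stated inside \<open>ip\<close>, hence up to null vectors.\<close>

locale star_rep = semi_inner V vadd vsm ip
  for V :: "'v set" and vadd vsm ip +
  fixes W :: "'e set" and add :: "'e \<Rightarrow> 'e \<Rightarrow> 'e" and sm :: "complex \<Rightarrow> 'e \<Rightarrow> 'e"
    and mul :: "'e \<Rightarrow> 'e \<Rightarrow> 'e" and st :: "'e \<Rightarrow> 'e" and one :: 'e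
    and J :: "'j set" and act :: "'j \<Rightarrow> 'e \<Rightarrow> 'v \<Rightarrow> 'v"
  assumes W_closed: "x \<in> W \<Longrightarrow> y \<in> W \<Longrightarrow> add x y \<in> W" "x \<in> W \<Longrightarrow> sm c x \<in> W"
      "x \<in> W \<Longrightarrow> y \<in> W \<Longrightarrow> mul x y \<in> W" "x \<in> W \<Longrightarrow> st x \<in> W" "one \<in> W"
    and act_closed [simp]: "j \<in> J \<Longrightarrow> x \<in> W \<Longrightarrow> v \<in> V \<Longrightarrow> act j x v \<in> V"
    and act_add: "j \<in> J \<Longrightarrow> x \<in> W \<Longrightarrow> y \<in> W \<Longrightarrow> v \<in> V \<Longrightarrow> w \<in> V \<Longrightarrow>
      ip v (act j (add x y) w) = ip v (act j x w) + ip v (act j y w)"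
    and act_sm: "j \<in> J \<Longrightarrow> x \<in> W \<Longrightarrow> v \<in> V \<Longrightarrow> w \<in> V \<Longrightarrow> ip v (act j (sm c x) w) = c * ip v (act j x w)"
    and act_mul: "j \<in> J \<Longrightarrow> x \<in> W \<Longrightarrow> y \<in> W \<Longrightarrow> v \<in> V \<Longrightarrow> w \<in> V \<Longrightarrow>
      ip v (act j (mul x y) w) = ip v (act j x (act j y w))"
    and act_st: "j \<in> J \<Longrightarrow> x \<in> W \<Longrightarrow> v \<in> V \<Longrightarrow> w \<in> V \<Longrightarrow> ip v (act j (st x) w) = ip (act j x v) w"
    and act_one: "j \<in> J \<Longrightarrow> v \<in> V \<Longrightarrow> w \<in> V \<Longrightarrow> ip v (act j one w) = ip v w"
    and act_bounded: "x \<in> W \<Longrightarrow> \<exists>C. \<forall>j\<in>J. \<forall>v\<in>V. vnorm (act j x v) \<le> C * vnorm v"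
begin

text \<open>If one of the vectors has norm \<open>0\<close> then so is the inner product, by the Cauchy--Schwarz
  inequality, and the junk value \<open>0\<close> of the division does no harm.\<close>

definition coeff :: "'e \<Rightarrow> 'j \<times> 'v \<times> 'v \<Rightarrow> complex" where
  "coeff x = (\<lambda>(j, v, w). if j \<in> J \<and> v \<in> V \<and> w \<in> V
     then ip v (act j x w) / complex_of_real (vnorm v * vnorm w) else 0)"

definition flip :: "'j \<times> 'v \<times> 'v \<Rightarrow> 'j \<times> 'v \<times> 'v" where
  "flip = (\<lambda>(j, v, w). (j, w, v))"

lemma ip_coeff:
  assumes "j \<in> J" "x \<in> W" "v \<in> V" "w \<in> V"
  shows "ip v (act j x w) = coeff x (j, v, w) * complex_of_real (vnorm v * vnorm w)"
proof (cases "vnorm v * vnorm w = 0")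
  case True
  \<comment> \<open>If \<open>w\<close> is a null vector, boundedness makes \<open>act j x w\<close>
    null too, so Cauchy-Schwarz covers a null vector on either side.\<close>
  obtain C where C: "vnorm (act j x w) \<le> C * vnorm w" using act_bounded[OF assms(2)] assms by blast
  have "vnorm v * vnorm (act j x w) \<le> vnorm v * (C * vnorm w)"
    using C assms by (simp add: mult_left_mono)
  also have "\<dots> = 0" using True by auto
  finally have "cmod (ip v (act j x w)) \<le> 0"
    using order_trans[OF Cauchy_Schwarz[of v "act j x w"]] assms by (auto simp only: act_closed)
  then show ?thesis using True by (metis mult_zero_right norm_le_zero_iff of_real_0)
qed (simp add: coeff_def assms)

lemma coeff_cong:
  assumes "\<And>j v w. j \<in> J \<Longrightarrow> v \<in> V \<Longrightarrow> w \<in> V \<Longrightarrow> ip v (act j x w) = ip v (act j y w)"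
  shows "coeff x = coeff y"
  using assms by (auto simp: coeff_def fun_eq_iff)

lemma bounded_coeff:
  assumes "x \<in> W" shows "bounded (range (coeff x))"
proof -
  obtain C where C: "\<And>j v. j \<in> J \<Longrightarrow> v \<in> V \<Longrightarrow> vnorm (act j x v) \<le> C * vnorm v"
    using act_bounded[OF assms] by blast
  have "cmod (coeff x (j, v, w)) \<le> \<bar>C\<bar>" for j v w
  proof (cases "j \<in> J \<and> v \<in> V \<and> w \<in> V \<and> vnorm v * vnorm w \<noteq> 0")
    case True
    then have pos: "vnorm v > 0" "vnorm w > 0" using vnorm_nonneg[of v] vnorm_nonneg[of w] by (auto simp: less_le)
    have "cmod (ip v (act j x w)) \<le> vnorm v * vnorm (act j x w)"
      using Cauchy_Schwarz True assms by simp
    also have "\<dots> \<le> vnorm v * (\<bar>C\<bar> * vnorm w)"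
      using C[of j w] True pos mult_right_mono[OF abs_ge_self[of C], of "vnorm w"]
      by (intro mult_left_mono) linarith+
    finally show ?thesis using True pos by (simp add: coeff_def norm_divide norm_mult divide_le_eq mult_ac)
  qed (auto simp: coeff_def)
  then show ?thesis by (auto simp: bounded_iff)
qed

lemma cmod_ip_le:
  assumes "j \<in> J" "x \<in> W" "v \<in> V" "w \<in> V"
  shows "cmod (ip v (act j x w)) \<le> supnorm (coeff x) * (vnorm v * vnorm w)"
  using assms cmod_le_supnorm[OF bounded_coeff[OF assms(2)]]
  by (simp add: ip_coeff norm_mult mult_right_mono)

text \<open>The vector \<open>act j x w\<close> itself serves as left argument of
  \<open>cmod_ip_le\<close>, and one factor is cancelled.\<close>

lemma vnorm_act_le:
  assumes "j \<in> J" "x \<in> W" "w \<in> V"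
  shows "vnorm (act j x w) \<le> supnorm (coeff x) * vnorm w"
proof (cases "vnorm (act j x w) = 0")
  case True
  then show ?thesis using assms supnorm_nonneg[OF bounded_coeff] by simp
next
  case False
  then have pos: "vnorm (act j x w) > 0" using assms vnorm_nonneg[of "act j x w"] by (simp add: less_le)
  have "vnorm (act j x w) * vnorm (act j x w) \<le> (supnorm (coeff x) * vnorm w) * vnorm (act j x w)"
    using cmod_ip_le[of j x "act j x w" w] assms ip_self[of "act j x w"]
    by (simp add: power2_eq_square norm_mult mult_ac)
  then show ?thesis using pos by simp
qed

lemma supnorm_coeff_le:
  assumes "c \<ge> 0" "\<And>j v w. j \<in> J \<Longrightarrow> v \<in> V \<Longrightarrow> w \<in> V \<Longrightarrow> cmod (ip v (act j x w)) \<le> c * (vnorm v * vnorm w)"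
  shows "supnorm (coeff x) \<le> c"
proof (rule supnorm_le)
  fix i :: "'j \<times> 'v \<times> 'v"
  obtain j v w where i: "i = (j, v, w)" using prod_cases3 by blast
  show "cmod (coeff x i) \<le> c"
  proof (cases "j \<in> J \<and> v \<in> V \<and> w \<in> V \<and> vnorm v * vnorm w \<noteq> 0")
    case True
    then have "vnorm v > 0" "vnorm w > 0" using vnorm_nonneg[of v] vnorm_nonneg[of w] by (auto simp: less_le)
    then show ?thesis using True assms(2)[of j v w]
      by (simp add: i coeff_def norm_divide norm_mult divide_le_eq)
  qed (use assms(1) in \<open>auto simp: i coeff_def\<close>)
qed

text \<open>The laws of \<open>star_rep\<close> concern the outermost operator in the right argument
  of \<open>ip\<close>. Moving that operator to the left argument exposes the next one to
  them.\<close>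

lemma act_adjoint:
  assumes "j \<in> J" "x \<in> W" "v \<in> V" "w \<in> V"
  shows "ip v (act j x w) = ip (act j (st x) v) w"
proof -
  have "ip v (act j x w) = cnj (ip (act j x w) v)" using assms by (intro ip_cnj) auto
  also have "\<dots> = cnj (ip w (act j (st x) v))" using assms by (simp add: act_st)
  also have "\<dots> = ip (act j (st x) v) w" using assms W_closed(4) by (intro ip_cnj[symmetric]) auto
  finally show ?thesis .
qed

sublocale star_model W add sm mul st one coeff flip
proof
  fix x y z :: 'e and c :: complex and i :: "'j \<times> 'v \<times> 'v"
  obtain j v w where i: "i = (j, v, w)" using prod_cases3 by blast
  show "flip (flip i) = i" by (simp add: flip_def i)
  assume x: "x \<in> W"
  show "bounded (range (coeff x))" by (rule bounded_coeff[OF x])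
  show "coeff (sm c x) i = c * coeff x i" using x by (simp add: i coeff_def act_sm)
  show "coeff (st x) i = cnj (coeff x (flip i))"
    using x ip_cnj[of "act j x v" w] by (auto simp: i coeff_def flip_def act_st mult.commute)
  show "coeff (mul one x) = coeff x" "coeff (mul x one) = coeff x"
    using x W_closed by (auto intro!: coeff_cong simp: act_mul act_one act_adjoint[of _ x])
  show "(supnorm (coeff x))\<^sup>2 \<le> supnorm (coeff (mul (st x) x))"
  proof -
    let ?s = "supnorm (coeff (mul (st x) x))"
    have nn: "0 \<le> ?s" using x W_closed by (simp add: supnorm_nonneg bounded_coeff)
    have "supnorm (coeff x) \<le> sqrt ?s"
    proof (rule supnorm_coeff_le)
      fix j v w assume *: "j \<in> J" "v \<in> V" "w \<in> V"
      \<comment> \<open>The square norm of \<open>act j x w\<close> is the form of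
        \<open>mul (st x) x\<close> at \<open>w\<close>, which is where the square root of its norm
        comes from.\<close>
      have "(vnorm (act j x w))\<^sup>2 \<le> cmod (ip (act j x w) (act j x w))"
        using * x ip_self[of "act j x w"] by (simp del: of_real_power)
      also have "ip (act j x w) (act j x w) = ip w (act j (mul (st x) x) w)"
        using * x W_closed by (simp add: act_mul act_st)
      also have "cmod \<dots> \<le> ?s * (vnorm w * vnorm w)" using * x W_closed by (intro cmod_ip_le) auto
      also have "\<dots> = (sqrt ?s * vnorm w)\<^sup>2" using nn by (simp add: power_mult_distrib power2_eq_square)
      finally have "vnorm (act j x w) \<le> sqrt ?s * vnorm w"
        using * nn x by - (rule power2_le_imp_le, auto)
      then have "vnorm v * vnorm (act j x w) \<le> vnorm v * (sqrt ?s * vnorm w)"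
        using * by (intro mult_left_mono) auto
      then show "cmod (ip v (act j x w)) \<le> sqrt ?s * (vnorm v * vnorm w)"
        using Cauchy_Schwarz[of v "act j x w"] * x by (simp add: mult_ac)
    qed (use nn in simp)
    then have "(supnorm (coeff x))\<^sup>2 \<le> (sqrt ?s)\<^sup>2"
      using supnorm_nonneg[OF bounded_coeff[OF x]] by (intro power_mono)
    then show ?thesis using nn by simp
  qed
  assume y: "y \<in> W"
  show "coeff (add x y) i = coeff x i + coeff y i" using x y by (simp add: i coeff_def act_add add_divide_distrib)
  show "coeff (mul (sm c x) y) i = c * coeff (mul x y) i" "coeff (mul x (sm c y)) i = c * coeff (mul x y) i"
    using x y W_closed by (auto simp: i coeff_def act_mul act_sm act_adjoint[of _ x])
  show "coeff (st (mul x y)) = coeff (mul (st y) (st x))"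
  proof (rule coeff_cong)
    fix j v w assume *: "j \<in> J" "v \<in> V" "w \<in> V"
    have "ip v (act j (st (mul x y)) w) = cnj (ip w (act j (mul x y) v))"
      using * x y W_closed ip_cnj[of w "act j (mul x y) v"] by (simp add: act_st)
    also have "\<dots> = ip (act j x (act j y v)) w"
      using * x y W_closed ip_cnj[of w "act j x (act j y v)"] by (simp add: act_mul)
    also have "\<dots> = ip v (act j (mul (st y) (st x)) w)"
      using * x y W_closed by (simp add: act_mul act_st)
    finally show "ip v (act j (st (mul x y)) w) = ip v (act j (mul (st y) (st x)) w)" .
  qed
  show "supnorm (coeff (mul x y)) \<le> supnorm (coeff x) * supnorm (coeff y)"
  proof (rule supnorm_coeff_le)
    fix j v w assume *: "j \<in> J" "v \<in> V" "w \<in> V"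
    have "cmod (ip v (act j (mul x y) w)) \<le> supnorm (coeff x) * (vnorm v * vnorm (act j y w))"
      using * x y by (simp add: act_mul cmod_ip_le)
    also have "\<dots> \<le> supnorm (coeff x) * (vnorm v * (supnorm (coeff y) * vnorm w))"
      using * x y by (intro mult_left_mono vnorm_act_le supnorm_nonneg bounded_coeff) auto
    finally show "cmod (ip v (act j (mul x y) w)) \<le> supnorm (coeff x) * supnorm (coeff y) * (vnorm v * vnorm w)"
      by (simp add: mult_ac)
  qed (use x y in \<open>simp add: supnorm_nonneg bounded_coeff\<close>)
  assume z: "z \<in> W"
  show "coeff (mul (mul x y) z) = coeff (mul x (mul y z))"
    using x y z W_closed by (auto intro!: coeff_cong simp: act_mul act_adjoint[of _ x])
  show "coeff (mul x (add y z)) i = coeff (mul x y) i + coeff (mul x z) i"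
      "coeff (mul (add x y) z) i = coeff (mul x z) i + coeff (mul y z) i"
    using x y z W_closed by (auto simp: i coeff_def act_mul act_add act_adjoint[of _ x] add_divide_distrib)
qed (rule W_closed; assumption?)+

end

section \<open>Finite sums in the algebra\<close>

context cstar
begin

lemma cs_sum_closed [simp]: "(\<And>k. k < n \<Longrightarrow> f k \<in> S) \<Longrightarrow> cs_sum A n f \<in> S"
  by (induction n) auto

lemma cs_sum_cong: "(\<And>k. k < n \<Longrightarrow> f k = g k) \<Longrightarrow> cs_sum A n f = cs_sum A n g"
  by (induction n) auto

lemma star_cs_sum: "(\<And>k. k < n \<Longrightarrow> f k \<in> S) \<Longrightarrow> (cs_sum A n f)\<^sup>\<star> = cs_sum A n (\<lambda>k. (f k)\<^sup>\<star>)"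
  by (induction n) (simp_all add: star_add)

lemma cs_sum_mult_left:
  "x \<in> S \<Longrightarrow> (\<And>k. k < n \<Longrightarrow> f k \<in> S) \<Longrightarrow> x \<otimes> cs_sum A n f = cs_sum A n (\<lambda>k. x \<otimes> f k)"
  by (induction n) (simp_all add: distrib_left)

lemma cs_sum_mult_right:
  "x \<in> S \<Longrightarrow> (\<And>k. k < n \<Longrightarrow> f k \<in> S) \<Longrightarrow> cs_sum A n f \<otimes> x = cs_sum A n (\<lambda>k. f k \<otimes> x)"
  by (induction n) (simp_all add: distrib_right)

end

context fcstar
begin

lemma lin_cs_sum: "lin f \<Longrightarrow> (\<And>k. k < n \<Longrightarrow> g k \<in> S) \<Longrightarrow> f (cs_sum A n g) = (\<Sum>k<n. f (g k))"
  by (induction n) (simp_all add: lin_simps)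

end

section \<open>A faithful state and its GNS inner product\<close>

locale state_cstar = cstar +
  fixes \<omega> :: "'a \<Rightarrow> complex"
  assumes faithful: "faithful_state A \<omega>"
begin

sublocale fcstar A "{\<omega>}"
  using faithful by unfold_locales (auto simp: faithful_state_def state_def)

lemma lin_\<omega>: "lin \<omega>" by (rule lin_P) simp

lemmas \<omega>_simps = lin_simps[OF lin_\<omega>]

lemma \<omega>_one [simp]: "\<omega> \<one> = 1"
  using faithful by (simp add: faithful_state_def state_def)

lemma \<omega>_pos: "x \<in> S \<Longrightarrow> Im (\<omega> (x\<^sup>\<star> \<otimes> x)) = 0" "x \<in> S \<Longrightarrow> 0 \<le> Re (\<omega> (x\<^sup>\<star> \<otimes> x))"
  using P_pos[of \<omega> x] by auto

text \<open>Squares have real \<open>\<omega>\<close>; applying this to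
  \<open>x \<oplus> c \<odot> \<one>\<close> with \<open>c = 1\<close> and \<open>c = \<i>\<close>
  determines the imaginary and the real part of \<open>\<omega> (x\<^sup>\<star>)\<close>.\<close>

lemma \<omega>_star:
  assumes "x \<in> S" shows "\<omega> (x\<^sup>\<star>) = cnj (\<omega> x)"
proof -
  have "Im (\<omega> ((x \<oplus> c \<odot> \<one>)\<^sup>\<star> \<otimes> (x \<oplus> c \<odot> \<one>))) = 0" for c
    using assms by (intro \<omega>_pos) auto
  then have "Im (c * \<omega> (x\<^sup>\<star>) + cnj c * \<omega> x + c * cnj c) = 0" for c
    using assms \<omega>_pos(1)[OF assms] by (simp add: expand \<omega>_simps algebra_simps)
  from this[of 1] this[of \<i>] show ?thesis by (simp add: complex_eq_iff)
qed

lemma \<omega>_star_mult: "x \<in> S \<Longrightarrow> y \<in> S \<Longrightarrow> \<omega> (x\<^sup>\<star> \<otimes> y) = cnj (\<omega> (y\<^sup>\<star> \<otimes> x))"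
  by (subst \<omega>_star[symmetric]) (simp_all add: star_mult)

sublocale gns: semi_inner S "cs_add A" "cs_smult A" "\<lambda>x y. \<omega> (x\<^sup>\<star> \<otimes> y)"
  by unfold_locales (auto simp: \<omega>_simps distrib_left smult_mult_right \<omega>_pos intro: \<omega>_star_mult)

text \<open>With \<open>c\<close> the norm of \<open>a\<close>, the element
  \<open>1 - a\<^sup>\<star> a / c\<^sup>2\<close> is a square \<open>b\<^sup>2\<close>, and
  \<open>\<omega>\<close> is nonnegative on \<open>(b y)\<^sup>\<star> (b y)\<close>.\<close>

lemma gns_mult_le:
  assumes a: "a \<in> S" and y: "y \<in> S"
  shows "gns.vnorm (a \<otimes> y) \<le> \<parallel>a\<parallel> * gns.vnorm y"
proof (cases "\<parallel>a\<parallel> = 0")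
  case True
  then show ?thesis using a y by (simp add: norm_eq_0 gns.vnorm_def \<omega>_simps)
next
  case False
  define c where "c = \<parallel>a\<parallel>"
  have c: "c > 0" using False a by (simp add: c_def less_le)
  let ?h = "complex_of_real (1/c\<^sup>2) \<odot> (a\<^sup>\<star> \<otimes> a)"
  have h: "?h \<in> S" "?h\<^sup>\<star> = ?h" using a by (simp_all add: star_smult star_mult)
  have "\<parallel>?h\<parallel> \<le> 1" using a c norm_cstar[OF a] by (simp add: norm_divide norm_power c_def)
  from sqrt_one_minus[OF h this] obtain b where b: "b \<in> S" "b\<^sup>\<star> = b" "b \<otimes> b = \<one> \<ominus> ?h" by metis
  have "(b \<otimes> y)\<^sup>\<star> \<otimes> (b \<otimes> y) = y\<^sup>\<star> \<otimes> (b \<otimes> b) \<otimes> y"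
    using b(1,2) y by (simp add: star_mult mult_assoc)
  also have "\<dots> = y\<^sup>\<star> \<otimes> y \<ominus> complex_of_real (1/c\<^sup>2) \<odot> ((a \<otimes> y)\<^sup>\<star> \<otimes> (a \<otimes> y))"
    unfolding b(3) using a y by (simp add: expand)
  finally have "0 \<le> Re (\<omega> (y\<^sup>\<star> \<otimes> y)) - Re (\<omega> ((a \<otimes> y)\<^sup>\<star> \<otimes> (a \<otimes> y))) / c\<^sup>2"
    using \<omega>_pos(2)[of "b \<otimes> y"] a b(1) y by (simp add: \<omega>_simps Re_divide_of_real flip: of_real_power)
  then have "Re (\<omega> ((a \<otimes> y)\<^sup>\<star> \<otimes> (a \<otimes> y))) \<le> c\<^sup>2 * Re (\<omega> (y\<^sup>\<star> \<otimes> y))"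
    using c by (simp add: divide_le_eq mult.commute)
  then have "(gns.vnorm (a \<otimes> y))\<^sup>2 \<le> (c * gns.vnorm y)\<^sup>2"
    using a y by (simp add: gns.vnorm_power2 power_mult_distrib)
  then show ?thesis using c y by - (rule power2_le_imp_le, auto simp: c_def)
qed

text \<open>Together with \<open>gns_mult_le\<close> this says that the GNS representation of a
  faithful state is isometric; later norm estimates are reduced to estimates on vectors.\<close>

lemma norm_le_if_gns_bounded:
  assumes a: "a \<in> S" and c: "c \<ge> 0"
    and le: "\<And>y. y \<in> S \<Longrightarrow> gns.vnorm (a \<otimes> y) \<le> c * gns.vnorm y"
  shows "\<parallel>a\<parallel> \<le> c"
proof (rule norm_le_if_bounded[OF a c])
  fix y f assume "y \<in> S" "f \<in> {\<omega>}"
  then show "Re (f ((a \<otimes> y)\<^sup>\<star> \<otimes> (a \<otimes> y))) \<le> c\<^sup>2 * Re (f (y\<^sup>\<star> \<otimes> y))"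
    using power_mono[OF le[of y], of 2] a by (simp add: gns.vnorm_power2 power_mult_distrib)
qed

lemma \<omega>_sandwich_le:
  assumes "x \<in> S" "a \<in> S" "y \<in> S"
  shows "cmod (\<omega> (x\<^sup>\<star> \<otimes> (a \<otimes> y))) \<le> \<parallel>a\<parallel> * (gns.vnorm x * gns.vnorm y)"
proof -
  have "cmod (\<omega> (x\<^sup>\<star> \<otimes> (a \<otimes> y))) \<le> gns.vnorm x * gns.vnorm (a \<otimes> y)"
    using gns.Cauchy_Schwarz[of x "a \<otimes> y"] assms by simp
  also have "\<dots> \<le> gns.vnorm x * (\<parallel>a\<parallel> * gns.vnorm y)"
    using assms by (intro mult_left_mono gns_mult_le) auto
  finally show ?thesis by (simp add: mult_ac)
qed

lemma \<omega>_sandwich_limit: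
  assumes "\<And>n. X n \<in> S" "a \<in> S" "conv X a" "x \<in> S" "y \<in> S"
  shows "(\<lambda>n. \<omega> (x\<^sup>\<star> \<otimes> (X n \<otimes> y))) \<longlonglongrightarrow> \<omega> (x\<^sup>\<star> \<otimes> (a \<otimes> y))"
proof -
  have "(\<lambda>n. \<omega> (x\<^sup>\<star> \<otimes> (X n \<otimes> y)) - \<omega> (x\<^sup>\<star> \<otimes> (a \<otimes> y))) \<longlonglongrightarrow> 0"
  proof (rule Lim_null_comparison)
    show "(\<lambda>n. \<parallel>X n \<ominus> a\<parallel> * (gns.vnorm x * gns.vnorm y)) \<longlonglongrightarrow> 0"
      using tendsto_mult_left_zero[OF assms(3)[unfolded conv_def]] .
    have "\<omega> (x\<^sup>\<star> \<otimes> (X n \<otimes> y)) - \<omega> (x\<^sup>\<star> \<otimes> (a \<otimes> y)) = \<omega> (x\<^sup>\<star> \<otimes> ((X n \<ominus> a) \<otimes> y))" for n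
      using assms by (simp add: distrib_left_sub distrib_right_sub \<omega>_simps)
    then show "\<forall>\<^sub>F n in sequentially. norm (\<omega> (x\<^sup>\<star> \<otimes> (X n \<otimes> y)) - \<omega> (x\<^sup>\<star> \<otimes> (a \<otimes> y)))
        \<le> \<parallel>X n \<ominus> a\<parallel> * (gns.vnorm x * gns.vnorm y)"
      using \<omega>_sandwich_le assms by simp
  qed
  then show ?thesis by (simp add: LIM_zero_iff)
qed

text \<open>The choice \<open>x = a \<ominus> b\<close> makes \<open>\<omega>\<close> vanish on a
  square, where faithfulness applies.\<close>

lemma eq_if_\<omega>_sandwich_eq:
  assumes "a \<in> S" "b \<in> S" "\<And>x. x \<in> S \<Longrightarrow> \<omega> (x\<^sup>\<star> \<otimes> (a \<otimes> \<one>)) = \<omega> (x\<^sup>\<star> \<otimes> (b \<otimes> \<one>))"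
  shows "a = b"
proof -
  have "\<omega> ((a \<ominus> b)\<^sup>\<star> \<otimes> (a \<ominus> b)) = 0"
    using assms(3)[of "a \<ominus> b"] assms(1,2) by (simp add: distrib_left_sub[of _ a b] \<omega>_simps)
  then show ?thesis using P_faithful[of "a \<ominus> b"] assms by (simp add: sub_eq_0)
qed

end

section \<open>Positive matrices\<close>

context state_cstar
begin

definition mat_vecs :: "nat \<Rightarrow> (nat \<Rightarrow> 'a) set" where
  "mat_vecs n = {v. \<forall>i<n. v i \<in> S}"

text \<open>Matrices are functions on all of \<open>nat\<close> of which only the entries below
  \<open>n\<close> count, so they are compared entrywise or through their coefficients.\<close>

definition mats :: "nat \<Rightarrow> (nat \<Rightarrow> nat \<Rightarrow> 'a) set" where
  "mats n = {M. \<forall>i<n. \<forall>j<n. M i j \<in> S}"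

definition mat_ip :: "nat \<Rightarrow> (nat \<Rightarrow> 'a) \<Rightarrow> (nat \<Rightarrow> 'a) \<Rightarrow> complex" where
  "mat_ip n v w = (\<Sum>i<n. \<omega> ((v i)\<^sup>\<star> \<otimes> w i))"

definition mat_apply :: "nat \<Rightarrow> (nat \<Rightarrow> nat \<Rightarrow> 'a) \<Rightarrow> (nat \<Rightarrow> 'a) \<Rightarrow> nat \<Rightarrow> 'a" where
  "mat_apply n M v i = cs_sum A n (\<lambda>j. M i j \<otimes> v j)"

definition mat_mul :: "nat \<Rightarrow> (nat \<Rightarrow> nat \<Rightarrow> 'a) \<Rightarrow> (nat \<Rightarrow> nat \<Rightarrow> 'a) \<Rightarrow> nat \<Rightarrow> nat \<Rightarrow> 'a" where
  "mat_mul n M N i j = cs_sum A n (\<lambda>k. M i k \<otimes> N k j)"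

definition mat_star :: "(nat \<Rightarrow> nat \<Rightarrow> 'a) \<Rightarrow> nat \<Rightarrow> nat \<Rightarrow> 'a" where
  "mat_star M i j = (M j i)\<^sup>\<star>"

definition mat_one :: "nat \<Rightarrow> nat \<Rightarrow> 'a" where
  "mat_one i j = (if i = j then \<one> else \<zero>)"

lemma lin_sandwich: "lin f \<Longrightarrow> x \<in> S \<Longrightarrow> y \<in> S \<Longrightarrow> lin (\<lambda>a. f (x \<otimes> (a \<otimes> y)))"
  by (simp add: lin_def distrib_left distrib_right smult_mult_left smult_mult_right)

lemma mat_vecsD: "v \<in> mat_vecs n \<Longrightarrow> i < n \<Longrightarrow> v i \<in> S"
  by (simp add: mat_vecs_def)

lemma mat_apply_closed [simp]: "M \<in> mats n \<Longrightarrow> v \<in> mat_vecs n \<Longrightarrow> mat_apply n M v \<in> mat_vecs n"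
  by (auto simp: mat_vecs_def mats_def mat_apply_def)

lemma mat_ip_apply:
  assumes "M \<in> mats n" "v \<in> mat_vecs n" "w \<in> mat_vecs n"
  shows "mat_ip n v (mat_apply n M w) = (\<Sum>i<n. \<Sum>j<n. \<omega> ((v i)\<^sup>\<star> \<otimes> (M i j \<otimes> w j)))"
  unfolding mat_ip_def mat_apply_def
  using assms by (intro sum.cong refl, subst lin_cs_sum[OF lin_mult_left[OF lin_\<omega>]])
    (auto simp: mat_vecs_def mats_def)

lemma mat_semi_inner:
  "semi_inner (mat_vecs n) (\<lambda>v w i. v i \<oplus> w i) (\<lambda>c v i. c \<odot> v i) (mat_ip n)"
proof
  fix v w assume "v \<in> mat_vecs n" "w \<in> mat_vecs n"
  then show "mat_ip n w v = cnj (mat_ip n v w)"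
    unfolding mat_ip_def cnj_sum by (intro sum.cong refl \<omega>_star_mult) (auto simp: mat_vecs_def)
qed (auto simp: mat_vecs_def mat_ip_def distrib_left smult_mult_right \<omega>_simps \<omega>_pos sum.distrib
    sum_distrib_left intro!: sum_nonneg)

lemma gns_vnorm_cs_sum:
  "(\<And>k. k < n \<Longrightarrow> f k \<in> S) \<Longrightarrow> gns.vnorm (cs_sum A n f) \<le> (\<Sum>k<n. gns.vnorm (f k))"
proof (induction n)
  case 0
  then show ?case by (simp add: gns.vnorm_def \<omega>_simps)
next
  case (Suc n)
  then show ?case using gns.vnorm_add[of "cs_sum A n f" "f n"] by (simp add: add_right_mono order_trans)
qed

lemma mat_vnorm:
  assumes "v \<in> mat_vecs n"
  shows "semi_inner.vnorm (mat_ip n) v = L2_set (\<lambda>i. gns.vnorm (v i)) {..<n}"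
  using assms unfolding semi_inner.vnorm_def[OF mat_semi_inner] L2_set_def mat_ip_def
  by (simp add: gns.vnorm_power2 mat_vecs_def)

lemma mat_apply_bounded:
  assumes M: "M \<in> mats n" and v: "v \<in> mat_vecs n"
  shows "semi_inner.vnorm (mat_ip n) (mat_apply n M v)
    \<le> (\<Sum>i<n. \<Sum>j<n. \<parallel>M i j\<parallel>) * semi_inner.vnorm (mat_ip n) v"
proof -
  let ?N = "semi_inner.vnorm (mat_ip n)"
  have "?N (mat_apply n M v) \<le> (\<Sum>i<n. gns.vnorm (mat_apply n M v i))"
    using mat_vnorm[of "mat_apply n M v" n] M v mat_vecsD[OF mat_apply_closed[OF M v]]
    by (auto intro!: L2_set_le_sum)
  also have "\<dots> \<le> (\<Sum>i<n. \<Sum>j<n. \<parallel>M i j\<parallel> * ?N v)"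
  proof (rule sum_mono)
    fix i assume i: "i \<in> {..<n}"
    have "gns.vnorm (mat_apply n M v i) \<le> (\<Sum>j<n. gns.vnorm (M i j \<otimes> v j))"
      unfolding mat_apply_def using M v i by (intro gns_vnorm_cs_sum) (auto simp: mats_def mat_vecs_def)
    also have "\<dots> \<le> (\<Sum>j<n. \<parallel>M i j\<parallel> * ?N v)"
    proof (rule sum_mono)
      fix j assume j: "j \<in> {..<n}"
      have "gns.vnorm (v j) \<le> ?N v"
        unfolding mat_vnorm[OF v] using j by (intro member_le_L2_set) auto
      then show "gns.vnorm (M i j \<otimes> v j) \<le> \<parallel>M i j\<parallel> * ?N v"
        using M v i j gns_mult_le[of "M i j" "v j"] mult_left_mono[of "gns.vnorm (v j)" "?N v" "\<parallel>M i j\<parallel>"]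
        by (auto simp: mats_def mat_vecs_def intro: order_trans)
    qed
    finally show "gns.vnorm (mat_apply n M v i) \<le> (\<Sum>j<n. \<parallel>M i j\<parallel> * ?N v)" .
  qed
  finally show ?thesis by (simp add: sum_distrib_right)
qed

text \<open>Matrices act on the direct sum of \<open>n\<close> copies of the GNS space; the
  one-point index type stands for a single representation.\<close>

lemma mat_star_rep:
  "star_rep (mat_vecs n) (\<lambda>v w i. v i \<oplus> w i) (\<lambda>c v i. c \<odot> v i) (mat_ip n)
     (mats n) (\<lambda>M N i j. M i j \<oplus> N i j) (\<lambda>c M i j. c \<odot> M i j) (mat_mul n) mat_star mat_one
     UNIV (\<lambda>_::unit. mat_apply n)"
proof (intro star_rep.intro mat_semi_inner star_rep_axioms.intro)
  fix M N v w and c :: complex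
  assume M: "M \<in> mats n"
  show star: "mat_star M \<in> mats n" using M by (simp add: mats_def mat_star_def)
  show sm: "(\<lambda>i j. c \<odot> M i j) \<in> mats n" using M by (simp add: mats_def)
  show "\<exists>C. \<forall>j::unit\<in>UNIV. \<forall>v\<in>mat_vecs n.
      semi_inner.vnorm (mat_ip n) (mat_apply n M v) \<le> C * semi_inner.vnorm (mat_ip n) v"
    using mat_apply_bounded[OF M] by blast
  { assume N: "N \<in> mats n"
    show "(\<lambda>i j. M i j \<oplus> N i j) \<in> mats n" using M N by (simp add: mats_def)
    show "mat_mul n M N \<in> mats n" using M N by (simp add: mats_def mat_mul_def)
  }
  assume w: "v \<in> mat_vecs n" 
  show "mat_apply n M v \<in> mat_vecs n" using M w by simp
  assume v: "w \<in> mat_vecs n"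
  show "mat_ip n v (mat_apply n (\<lambda>i j. c \<odot> M i j) w) = c * mat_ip n v (mat_apply n M w)"
    unfolding mat_ip_apply[OF sm w v] mat_ip_apply[OF M w v] sum_distrib_left
    using M v w by (intro sum.cong refl)
      (auto simp: mats_def mat_vecs_def smult_mult_left smult_mult_right \<omega>_simps)
  have "mat_ip n (mat_apply n M v) w = cnj (mat_ip n w (mat_apply n M v))"
    using M v w by (intro semi_inner.ip_cnj[OF mat_semi_inner]) auto
  also have "\<dots> = (\<Sum>i<n. \<Sum>j<n. cnj (\<omega> ((w i)\<^sup>\<star> \<otimes> (M i j \<otimes> v j))))"
    unfolding mat_ip_apply[OF M v w] by simp
  also have "\<dots> = (\<Sum>i<n. \<Sum>j<n. \<omega> ((v j)\<^sup>\<star> \<otimes> ((M i j)\<^sup>\<star> \<otimes> w i)))"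
    using M v w by (intro sum.cong refl, subst \<omega>_star_mult[symmetric])
      (auto simp: mats_def mat_vecs_def star_mult mult_assoc)
  also have "\<dots> = mat_ip n v (mat_apply n (mat_star M) w)"
    unfolding mat_ip_apply[OF star w v] mat_star_def by (rule sum.swap)
  finally show "mat_ip n v (mat_apply n (mat_star M) w) = mat_ip n (mat_apply n M v) w" by simp
next
  fix v w assume w: "v \<in> mat_vecs n" and v: "w \<in> mat_vecs n"
  have one: "mat_one \<in> mats n" by (simp add: mats_def mat_one_def)
  show "mat_ip n v (mat_apply n mat_one w) = mat_ip n v w"
  proof -
    have "(\<Sum>j<n. \<omega> ((v i)\<^sup>\<star> \<otimes> (mat_one i j \<otimes> w j))) = \<omega> ((v i)\<^sup>\<star> \<otimes> w i)" if "i < n" for i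
    proof -
      have "(\<Sum>j<n. \<omega> ((v i)\<^sup>\<star> \<otimes> (mat_one i j \<otimes> w j))) = (\<Sum>j<n. if i = j then \<omega> ((v i)\<^sup>\<star> \<otimes> w j) else 0)"
        using v w that by (intro sum.cong refl) (auto simp: mat_one_def mat_vecs_def \<omega>_simps)
      then show ?thesis using that by simp
    qed
    then show ?thesis unfolding mat_ip_apply[OF one w v] by (simp add: mat_ip_def)
  qed
next
  fix M N v w assume MN: "M \<in> mats n" "N \<in> mats n" and w: "v \<in> mat_vecs n" and v: "w \<in> mat_vecs n"
  have add: "(\<lambda>i j. M i j \<oplus> N i j) \<in> mats n" using MN by (simp add: mats_def)
  have mul: "mat_mul n M N \<in> mats n" using MN by (simp add: mats_def mat_mul_def)
  show "mat_ip n v (mat_apply n (\<lambda>i j. M i j \<oplus> N i j) w)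
      = mat_ip n v (mat_apply n M w) + mat_ip n v (mat_apply n N w)"
    unfolding mat_ip_apply[OF add w v] mat_ip_apply[OF MN(1) w v] mat_ip_apply[OF MN(2) w v] sum.distrib[symmetric]
    using MN v w by (intro sum.cong refl)
      (auto simp: mats_def mat_vecs_def distrib_left distrib_right \<omega>_simps)
  have "mat_ip n v (mat_apply n (mat_mul n M N) w)
      = (\<Sum>i<n. \<Sum>j<n. \<Sum>k<n. \<omega> ((v i)\<^sup>\<star> \<otimes> ((M i k \<otimes> N k j) \<otimes> w j)))"
    unfolding mat_ip_apply[OF mul w v] mat_mul_def
    using MN v w by (intro sum.cong refl, subst lin_cs_sum[OF lin_sandwich[OF lin_\<omega>]])
      (auto simp: mats_def mat_vecs_def)
  also have "\<dots> = (\<Sum>i<n. \<Sum>k<n. \<Sum>j<n. \<omega> ((v i)\<^sup>\<star> \<otimes> (M i k \<otimes> (N k j \<otimes> w j))))"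
    using MN v w by (subst (2) sum.swap, intro sum.cong refl) (auto simp: mats_def mat_vecs_def mult_assoc)
  also have "\<dots> = (\<Sum>i<n. \<Sum>k<n. \<omega> ((v i)\<^sup>\<star> \<otimes> (M i k \<otimes> mat_apply n N w k)))"
    unfolding mat_apply_def
    using MN v w by (intro sum.cong refl, subst lin_cs_sum[OF lin_mult_left[OF lin_mult_left[OF lin_\<omega>]]])
      (auto simp: mats_def mat_vecs_def)
  also have "\<dots> = mat_ip n v (mat_apply n M (mat_apply n N w))"
    using MN v w by (simp add: mat_ip_apply)
  finally show "mat_ip n v (mat_apply n (mat_mul n M N) w) = mat_ip n v (mat_apply n M (mat_apply n N w))" .
qed (simp add: mats_def mat_one_def)

text \<open>The matrix algebra is already complete in the operator norm, so that square roots in its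
  completion are matrices.\<close>

theorem mat_posI:
  assumes H: "H \<in> mats n" and herm: "\<And>i j. i < n \<Longrightarrow> j < n \<Longrightarrow> (H j i)\<^sup>\<star> = H i j"
    and pos: "\<And>v. v \<in> mat_vecs n \<Longrightarrow> 0 \<le> Re (\<Sum>i<n. \<Sum>j<n. \<omega> ((v i)\<^sup>\<star> \<otimes> (H i j \<otimes> v j)))"
  shows "mat_pos A n H"
proof -
  interpret R: star_rep "mat_vecs n" "\<lambda>v w i. v i \<oplus> w i" "\<lambda>c v i. c \<odot> v i" "mat_ip n"
     "mats n" "\<lambda>M N i j. M i j \<oplus> N i j" "\<lambda>c M i j. c \<odot> M i j" "mat_mul n" mat_star mat_one
     UNIV "\<lambda>_::unit. mat_apply n"
    by (rule mat_star_rep)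
  \<comment> \<open>The vector with \<open>x\<close> in slot \<open>i\<close>; such vectors isolate
    single entries of a matrix.\<close>
  define e where "e i x = (\<lambda>k. if k = i then x else \<zero>)" for i :: nat and x
  have e: "e i x \<in> mat_vecs n" if "x \<in> S" for i x using that by (simp add: e_def mat_vecs_def)
  have ip_e: "mat_ip n (e i x) (mat_apply n M (e j y)) = \<omega> (x\<^sup>\<star> \<otimes> (M i j \<otimes> y))"
    if "M \<in> mats n" "i < n" "j < n" "x \<in> S" "y \<in> S" for M i j x y
  proof -
    have *: "(\<Sum>j'<n. \<omega> ((e i x i')\<^sup>\<star> \<otimes> (M i' j' \<otimes> e j y j')))
        = (if i' = i then \<omega> (x\<^sup>\<star> \<otimes> (M i j \<otimes> y)) else 0)" if "i' < n" for i'
    proof -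
      have "(\<Sum>j'<n. \<omega> ((e i x i')\<^sup>\<star> \<otimes> (M i' j' \<otimes> e j y j')))
          = (\<Sum>j'<n. if j = j' then (if i' = i then \<omega> (x\<^sup>\<star> \<otimes> (M i j \<otimes> y)) else 0) else 0)"
        using \<open>M \<in> mats n\<close> \<open>i < n\<close> \<open>j < n\<close> \<open>x \<in> S\<close> \<open>y \<in> S\<close> that
        by (intro sum.cong refl) (auto simp: e_def mats_def \<omega>_simps)
      then show ?thesis using \<open>j < n\<close> by simp
    qed
    then have "(\<Sum>i'<n. \<Sum>j'<n. \<omega> ((e i x i')\<^sup>\<star> \<otimes> (M i' j' \<otimes> e j y j')))
        = (\<Sum>i'<n. if i = i' then \<omega> (x\<^sup>\<star> \<otimes> (M i j \<otimes> y)) else 0)"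
      by (intro sum.cong refl) auto
    then show ?thesis using mat_ip_apply[of M n "e i x" "e j y"] e that by simp
  qed
  have ne: "R.vnorm (e i x) = gns.vnorm x" if "i < n" "x \<in> S" for i x
  proof -
    have "(\<Sum>k<n. \<omega> ((e i x k)\<^sup>\<star> \<otimes> e i x k)) = (\<Sum>k<n. if i = k then \<omega> (x\<^sup>\<star> \<otimes> x) else 0)"
      using that by (intro sum.cong refl) (auto simp: e_def \<omega>_simps)
    then show ?thesis using that by (simp add: R.vnorm_def gns.vnorm_def mat_ip_def)
  qed
  \<comment> \<open>The operator norm is tested on \<open>e i ?z\<close> and \<open>e j y\<close>.
    Consequently a Cauchy sequence of matrices is Cauchy in every entry.\<close>
  have entry: "\<parallel>M i j\<parallel> \<le> supnorm (R.coeff M)" if M: "M \<in> mats n" "i < n" "j < n" for M i j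
  proof (rule norm_le_if_gns_bounded)
    have Mij: "M i j \<in> S" using M by (simp add: mats_def)
    then show "M i j \<in> S" .
    show "0 \<le> supnorm (R.coeff M)" using M by (simp add: supnorm_nonneg R.bounded_coeff)
    fix y assume y: "y \<in> S"
    let ?z = "M i j \<otimes> y"
    have z: "?z \<in> S" using Mij y by simp
    show "gns.vnorm ?z \<le> supnorm (R.coeff M) * gns.vnorm y"
    proof (cases "gns.vnorm ?z = 0")
      case True
      then show ?thesis using y M by (simp add: supnorm_nonneg R.bounded_coeff)
    next
      case False
      then have p: "gns.vnorm ?z > 0" using z gns.vnorm_nonneg[of ?z] by linarith
      have "gns.vnorm ?z * gns.vnorm ?z = cmod (\<omega> (?z\<^sup>\<star> \<otimes> ?z))"
        using gns.ip_self[OF z] by (simp add: power2_eq_square Real_Vector_Spaces.norm_mult)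
      also have "\<dots> \<le> supnorm (R.coeff M) * (gns.vnorm ?z * gns.vnorm y)"
        using R.cmod_ip_le[of "()" M "e i ?z" "e j y"] M y z e by (simp add: ip_e ne)
      finally show ?thesis using p by (simp add: mult_ac)
    qed
  qed
  have inj: "M i j = N i j" if "M \<in> mats n" "N \<in> mats n" "R.coeff M = R.coeff N" "i < n" "j < n" for M N i j
  proof (rule eq_if_\<omega>_sandwich_eq)
    fix x assume x: "x \<in> S"
    show "\<omega> (x\<^sup>\<star> \<otimes> (M i j \<otimes> \<one>)) = \<omega> (x\<^sup>\<star> \<otimes> (N i j \<otimes> \<one>))"
      using ip_e[of M i j x \<one>] ip_e[of N i j x \<one>] R.ip_coeff[of "()" M "e i x" "e j \<one>"]
        R.ip_coeff[of "()" N "e i x" "e j \<one>"] that x e by simp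
  qed (use that in \<open>auto simp: mats_def\<close>)
  \<comment> \<open>Entrywise limits exist in the algebra, and coefficients follow them because
    \<open>\<omega> (x\<^sup>\<star> \<otimes> (a \<otimes> y))\<close> depends continuously on
    \<open>a\<close>.\<close>
  have closed: "\<exists>M\<in>mats n. F = R.coeff M" if "F \<in> R.carrier" for F
  proof -
    obtain x where x: "R.approx x F" using R.carrier_approx[OF \<open>F \<in> R.carrier\<close>] by blast
    have xW: "x m \<in> mats n" for m using R.approx_W[OF x] .
    have "\<exists>a\<in>S. conv (\<lambda>m. x m i j) a" if ij: "i < n" "j < n" for i j
    proof (rule complete)
      show "x m i j \<in> S" for m using xW[of m] ij by (simp add: mats_def)
      fix d :: real assume d: "d > 0"
      obtain N where N: "\<And>m p. m \<ge> N \<Longrightarrow> cmod (R.coeff (x m) p - F p) < d/4"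
        using R.approxD[OF x, of "d/4"] d by auto
      have "\<parallel>x m i j \<ominus> x k i j\<parallel> < d" if mk: "m \<ge> N" "k \<ge> N" for m k
      proof -
        let ?D = "\<lambda>i j. x m i j \<oplus> (-1) \<odot> x k i j"
        have kW: "(\<lambda>i j. (-1) \<odot> x k i j) \<in> mats n" using xW[of k] by (rule R.W_closed(2))
        then have D: "?D \<in> mats n" using xW[of m] by (intro R.W_closed(1))
        have "supnorm (R.coeff ?D) \<le> d/2"
        proof (rule supnorm_le)
          fix p
          have "R.coeff ?D p = R.coeff (x m) p - R.coeff (x k) p"
            using R.\<Phi>_add[OF xW[of m] kW] R.\<Phi>_sm[OF xW[of k]] by simp
          then show "cmod (R.coeff ?D p) \<le> d/2"
            using N[of m p] N[of k p] mk norm_triangle_ineq4[of "R.coeff (x m) p - F p" "R.coeff (x k) p - F p"]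
            by simp
        qed
        then show ?thesis using entry[OF D ij] d by (simp add: cs_sub_def)
      qed
      then show "\<exists>N. \<forall>m\<ge>N. \<forall>k\<ge>N. \<parallel>x m i j \<ominus> x k i j\<parallel> < d" by blast
    qed
    then obtain M where M: "\<And>i j. i < n \<Longrightarrow> j < n \<Longrightarrow> M i j \<in> S \<and> conv (\<lambda>m. x m i j) (M i j)" by metis
    have MW: "M \<in> mats n" using M by (simp add: mats_def)
    have "R.coeff M p = F p" for p
    proof -
      obtain v w where p: "p = ((), v, w)" by (metis prod_cases3 unit.exhaust)
      have "(\<lambda>m. R.coeff (x m) p) \<longlonglongrightarrow> R.coeff M p"
      proof (cases "v \<in> mat_vecs n \<and> w \<in> mat_vecs n")
        case True
        have "(\<lambda>m. \<Sum>i<n. \<Sum>j<n. \<omega> ((v i)\<^sup>\<star> \<otimes> (x m i j \<otimes> w j)))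
            \<longlonglongrightarrow> (\<Sum>i<n. \<Sum>j<n. \<omega> ((v i)\<^sup>\<star> \<otimes> (M i j \<otimes> w j)))"
          using M True xW by (intro tendsto_sum \<omega>_sandwich_limit) (auto simp: mats_def mat_vecs_def)
        then have "(\<lambda>m. mat_ip n v (mat_apply n (x m) w)) \<longlonglongrightarrow> mat_ip n v (mat_apply n M w)"
          using True xW MW by (simp add: mat_ip_apply)
        then show ?thesis
          using True unfolding p R.coeff_def by (auto simp: divide_inverse intro: tendsto_mult_right)
      qed (auto simp: p R.coeff_def)
      then show ?thesis using R.approx_LIMSEQ[OF x, of p] LIMSEQ_unique by blast
    qed
    then have "F = R.coeff M" by (intro ext) simp
    then show ?thesis using MW by blast
  qed
  \<comment> \<open>The vector functionals. By \<open>square_ip\<close> such a functional sends a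
    square to the square norm of \<open>M v\<close> divided by that of \<open>v\<close>, which gives
    positivity and, with Cauchy-Schwarz, joint faithfulness.\<close>
  let ?P = "(\<lambda>v F. F ((), v, v) :: complex) ` mat_vecs n"
  interpret C: cstar R.completion by unfold_locales (rule R.completion_cstar)
  have square: "cs_mult R.completion (cs_star R.completion (R.coeff M)) (R.coeff N)
      = R.coeff (mat_mul n (mat_star M) N)" if "M \<in> mats n" "N \<in> mats n" for M N
  proof -
    have "cs_star R.completion (R.coeff M) = R.coeff (mat_star M)" using that by (simp add: fun_eq_iff R.\<Phi>_st)
    then show ?thesis using that R.\<Phi>_mulC[OF R.W_closed(4)] by simp
  qed
  have square_ip: "R.coeff (mat_mul n (mat_star M) M) ((), v, v)
      = mat_ip n (mat_apply n M v) (mat_apply n M v) / complex_of_real (R.vnorm v * R.vnorm v)"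
    if "M \<in> mats n" "v \<in> mat_vecs n" for M v
    using that R.W_closed(4)[of M] by (simp add: R.coeff_def R.act_mul R.act_st del: of_real_mult)
  interpret C: fcstar R.completion ?P
  proof
    fix f F G and c :: complex assume "f \<in> ?P"
    then obtain v where v: "v \<in> mat_vecs n" "f = (\<lambda>F. F ((), v, v))" by auto
    show "f (cs_add R.completion F G) = f F + f G" "f (cs_smult R.completion c F) = c * f F"
      using v by simp_all
    assume "F \<in> cs_carrier R.completion"
    then obtain M where M: "M \<in> mats n" "F = R.coeff M" using closed by auto
    show "Im (f (cs_mult R.completion (cs_star R.completion F) F)) = 0
        \<and> 0 \<le> Re (f (cs_mult R.completion (cs_star R.completion F) F))"
      using M v R.ip_self[of "mat_apply n M v"] unfolding v(2) M(2) square[OF M(1) M(1)]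
      by (simp add: square_ip flip: of_real_mult of_real_divide of_real_power)
  next
    fix F assume F: "F \<in> cs_carrier R.completion"
      and 0: "\<And>f. f \<in> ?P \<Longrightarrow> f (cs_mult R.completion (cs_star R.completion F) F) = 0"
    obtain M where M: "M \<in> mats n" "F = R.coeff M" using F closed by auto
    have "R.coeff M (j, v, w) = 0" for j v w
    proof (cases "v \<in> mat_vecs n \<and> w \<in> mat_vecs n")
      case True
      then have "R.coeff (mat_mul n (mat_star M) M) ((), w, w) = 0"
        using 0[of "\<lambda>F. F ((), w, w)"] M square[OF M(1) M(1)] by auto
      then have "R.vnorm (mat_apply n M w) = 0 \<or> R.vnorm w = 0"
        using square_ip[of M w] True M R.ip_self[of "mat_apply n M w"] by auto
      moreover have "R.vnorm (mat_apply n M w) = 0 \<Longrightarrow> mat_ip n v (mat_apply n M w) = 0"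
        using R.Cauchy_Schwarz[of v "mat_apply n M w"] True M by simp
      ultimately show ?thesis using True by (auto simp: R.coeff_def)
    qed (auto simp: R.coeff_def)
    then show "F = cs_zero R.completion" using M(2) by (simp add: fun_eq_iff)
  qed
  have Hstar: "R.coeff (mat_star H) = R.coeff H"
  proof (rule R.coeff_cong)
    fix j :: unit and v w assume vw: "v \<in> mat_vecs n" "w \<in> mat_vecs n"
    show "mat_ip n v (mat_apply n (mat_star H) w) = mat_ip n v (mat_apply n H w)"
      unfolding mat_ip_apply[OF H vw] mat_ip_apply[OF R.W_closed(4)[OF H] vw]
      by (intro sum.cong refl) (simp add: mat_star_def herm)
  qed
  have HC: "R.coeff H \<in> R.carrier" using R.approx_carrier[OF R.approx_const[OF H]] .
  have Hs: "cs_star R.completion (R.coeff H) = R.coeff H"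
    using Hstar R.\<Phi>_st[OF H] by (simp add: fun_eq_iff)
  \<comment> \<open>Up to a nonnegative factor the value is the form of \<open>H\<close> at the
    vector \<open>N v\<close>, where the hypothesis \<open>pos\<close> applies.\<close>
  have Hpos: "0 \<le> Re (f (cs_mult R.completion (cs_mult R.completion F (R.coeff H)) F))"
    if F: "F \<in> cs_carrier R.completion" "cs_star R.completion F = F" "f \<in> ?P" for F f
  proof -
    obtain N where N: "N \<in> mats n" "F = R.coeff N" using F closed by auto
    obtain v where v: "v \<in> mat_vecs n" "f = (\<lambda>F. F ((), v, v))" using F by auto
    have NH: "mat_mul n (mat_star N) H \<in> mats n" "mat_star N \<in> mats n"
      using N H R.W_closed by auto
    have "cs_mult R.completion (cs_mult R.completion F (R.coeff H)) F
        = R.coeff (mat_mul n (mat_mul n (mat_star N) H) N)"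
      using square[OF N(1) H] F(2) N NH by (simp add: R.\<Phi>_mulC)
    moreover have "mat_ip n v (mat_apply n (mat_mul n (mat_mul n (mat_star N) H) N) v)
        = mat_ip n (mat_apply n N v) (mat_apply n H (mat_apply n N v))"
      using N v NH H by (simp add: R.act_mul R.act_st)
    moreover have "0 \<le> Re (mat_ip n (mat_apply n N v) (mat_apply n H (mat_apply n N v)))"
      using pos[of "mat_apply n N v"] N v H by (simp add: mat_ip_apply)
    ultimately show ?thesis using v by (simp add: R.coeff_def Re_divide_of_real del: of_real_mult)
  qed
  obtain F where F: "F \<in> R.carrier" "cs_star R.completion F = F"
      "cs_mult R.completion F F = R.coeff H"
  proof (rule C.pos_sqrt[of "R.coeff H"])
    show "R.coeff H \<in> C.S" using HC by simp
  next
    fix F assume "F \<in> C.S" "cs_star R.completion F = F" "cs_mult R.completion F F = R.coeff H"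
    then show thesis using that[of F] by (simp only: R.completion_simps(1))
  qed (rule Hs, rule Hpos)
  obtain X where X: "X \<in> mats n" "F = R.coeff X" using F closed by auto
  have "R.coeff (mat_mul n (mat_star X) X) = R.coeff H" using F X square[OF X(1) X(1)] by simp
  then have "H i j = mat_mul n (mat_star X) X i j" if "i < n" "j < n" for i j
    using inj[of H "mat_mul n (mat_star X) X" i j] X H that R.W_closed by auto
  then show ?thesis
    using H X unfolding mat_pos_def mats_def mat_mul_def mat_star_def by auto
qed

end

section \<open>The weak Markov flow\<close>

lemma mat_posE:
  assumes "mat_pos A n M"
  obtains X where "\<And>i j. i < n \<Longrightarrow> j < n \<Longrightarrow> X i j \<in> cs_carrier A"
    "\<And>i j. i < n \<Longrightarrow> j < n \<Longrightarrow> M i j = cs_sum A n (\<lambda>k. cs_mult A (cs_star A (X k i)) (X k j))"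
proof -
  obtain X where "(\<forall>i<n. \<forall>j<n. X i j \<in> cs_carrier A) \<and>
      (\<forall>i<n. \<forall>j<n. M i j = cs_sum A n (\<lambda>k. cs_mult A (cs_star A (X k i)) (X k j)))"
    using assms[unfolded mat_pos_def, THEN conjunct2] by (rule exE)
  then show ?thesis by (intro that[of X]) auto
qed

section \<open>Schur products and positive matrices\<close>

context state_cstar
begin

text \<open>The Schur product theorem for two Gram matrices. The last vector \<open>x n\<close> is
  projected out: the Gram matrix of \<open>x\<close> becomes that of \<open>x'\<close>, whose last
  row and column vanish, plus a rank one matrix, and the latter contributes a square.\<close>

lemma schur_nonneg:
  fixes n :: nat
  assumes "\<And>i. i < n \<Longrightarrow> x i \<in> S" "\<And>i. i < n \<Longrightarrow> y i \<in> S"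
  shows "0 \<le> Re (\<Sum>i<n. \<Sum>j<n. \<omega> ((x i)\<^sup>\<star> \<otimes> x j) * \<omega> ((y i)\<^sup>\<star> \<otimes> y j))"
  using assms
proof (induction n arbitrary: x)
  case (Suc n)
  let ?p = "x n"
  have p: "?p \<in> S" using Suc.prems by simp
  define N where "N = (gns.vnorm ?p)\<^sup>2"
  have N: "\<omega> (?p\<^sup>\<star> \<otimes> ?p) = complex_of_real N" using gns.ip_self[OF p] by (simp add: N_def)
  \<comment> \<open>For \<open>N = 0\<close> the quotient is 0, which is right because
    Cauchy-Schwarz then makes \<open>x n\<close> orthogonal to every \<open>x i\<close>.\<close>
  define \<alpha> where "\<alpha> i = \<omega> (?p\<^sup>\<star> \<otimes> x i) / complex_of_real N" for i
  define x' where "x' i = x i \<ominus> \<alpha> i \<odot> ?p" for i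
  have x': "x' i \<in> S" if "i < Suc n" for i using Suc.prems(1)[OF that] p by (simp add: x'_def)
  have px: "\<omega> (?p\<^sup>\<star> \<otimes> x i) = \<alpha> i * complex_of_real N" if "i < Suc n" for i
  proof (cases "N = 0")
    case True
    then have "cmod (\<omega> (?p\<^sup>\<star> \<otimes> x i)) \<le> 0"
      using gns.Cauchy_Schwarz[OF p Suc.prems(1)[OF that]] by (simp add: N_def)
    then show ?thesis using True by simp
  qed (simp add: \<alpha>_def)
  have split: "\<omega> ((x i)\<^sup>\<star> \<otimes> x j) = \<omega> ((x' i)\<^sup>\<star> \<otimes> x' j) + complex_of_real N * (cnj (\<alpha> i) * \<alpha> j)"
    if "i < Suc n" "j < Suc n" for i j
  proof -
    have S: "x i \<in> S" "x j \<in> S" using that Suc.prems by auto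
    have xp: "\<omega> ((x i)\<^sup>\<star> \<otimes> ?p) = cnj (\<alpha> i) * complex_of_real N"
      using \<omega>_star_mult[OF S(1) p] px[OF that(1)] by simp
    show ?thesis
      using S p by (simp add: x'_def expand \<omega>_simps px that xp N algebra_simps)
  qed
  have x'n: "\<omega> ((x' n)\<^sup>\<star> \<otimes> z) = 0" if "z \<in> S" for z
  proof -
    have "gns.vnorm (x' n) = 0"
    proof (cases "N = 0")
      case True
      then have "x' n = ?p" using p by (simp add: x'_def \<alpha>_def cs_sub_def)
      then show ?thesis using True by (simp add: N_def)
    next
      case False
      then show ?thesis using p N by (simp add: x'_def \<alpha>_def gns.vnorm_def \<omega>_simps)
    qed
    then show ?thesis using gns.Cauchy_Schwarz[OF x'[OF lessI] that] by simp
  qed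
  have x'n': "\<omega> (z\<^sup>\<star> \<otimes> x' n) = 0" if "z \<in> S" for z
    using \<omega>_star_mult[OF that x'[OF lessI]] x'n[OF that] by simp
  \<comment> \<open>The square norm of \<open>z\<close> is, up to the factor \<open>N\<close>, the
    Schur product of the rank one part with the Gram matrix of \<open>y\<close>.\<close>
  define z where "z = cs_sum A (Suc n) (\<lambda>i. \<alpha> i \<odot> y i)"
  have z: "z \<in> S" unfolding z_def by (rule cs_sum_closed) (use Suc.prems in auto)
  have zz: "\<omega> (z\<^sup>\<star> \<otimes> z) = (\<Sum>i<Suc n. \<Sum>j<Suc n. cnj (\<alpha> i) * \<alpha> j * \<omega> ((y i)\<^sup>\<star> \<otimes> y j))"
  proof -
    have l: "\<omega> (w\<^sup>\<star> \<otimes> z) = (\<Sum>j<Suc n. \<alpha> j * \<omega> (w\<^sup>\<star> \<otimes> y j))" if "w \<in> S" for w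
      unfolding z_def using Suc.prems that
      by (subst lin_cs_sum[OF lin_mult_left[OF lin_\<omega>]])
        (auto simp: smult_mult_right \<omega>_simps intro!: sum.cong simp del: sum.lessThan_Suc)
    have "\<omega> (z\<^sup>\<star> \<otimes> z) = (\<Sum>j<Suc n. \<alpha> j * \<omega> (z\<^sup>\<star> \<otimes> y j))" using l z by simp
    also have "\<dots> = (\<Sum>j<Suc n. \<Sum>i<Suc n. cnj (\<alpha> i) * \<alpha> j * \<omega> ((y i)\<^sup>\<star> \<otimes> y j))"
    proof (rule sum.cong[OF refl])
      fix j assume "j \<in> {..<Suc n}"
      then have yj: "y j \<in> S" using Suc.prems by simp
      have "\<omega> (z\<^sup>\<star> \<otimes> y j) = cnj (\<Sum>i<Suc n. \<alpha> i * \<omega> ((y j)\<^sup>\<star> \<otimes> y i))"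
        using \<omega>_star_mult[OF z yj] l[OF yj] by simp
      also have "\<dots> = (\<Sum>i<Suc n. cnj (\<alpha> i) * \<omega> ((y i)\<^sup>\<star> \<otimes> y j))"
        unfolding cnj_sum using yj Suc.prems(2)
        by (intro sum.cong refl) (simp add: \<omega>_star_mult[of "y j"])
      finally show "\<alpha> j * \<omega> (z\<^sup>\<star> \<otimes> y j) = (\<Sum>i<Suc n. cnj (\<alpha> i) * \<alpha> j * \<omega> ((y i)\<^sup>\<star> \<otimes> y j))"
        by (simp add: sum_distrib_left mult_ac del: sum.lessThan_Suc)
    qed
    also have "\<dots> = (\<Sum>i<Suc n. \<Sum>j<Suc n. cnj (\<alpha> i) * \<alpha> j * \<omega> ((y i)\<^sup>\<star> \<otimes> y j))" by (rule sum.swap)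
    finally show ?thesis .
  qed
  have "(\<Sum>i<Suc n. \<Sum>j<Suc n. \<omega> ((x i)\<^sup>\<star> \<otimes> x j) * \<omega> ((y i)\<^sup>\<star> \<otimes> y j))
      = (\<Sum>i<Suc n. \<Sum>j<Suc n. \<omega> ((x' i)\<^sup>\<star> \<otimes> x' j) * \<omega> ((y i)\<^sup>\<star> \<otimes> y j)
          + complex_of_real N * (cnj (\<alpha> i) * \<alpha> j * \<omega> ((y i)\<^sup>\<star> \<otimes> y j)))"
    by (intro sum.cong refl) (simp add: split algebra_simps)
  also have "\<dots> = (\<Sum>i<Suc n. \<Sum>j<Suc n. \<omega> ((x' i)\<^sup>\<star> \<otimes> x' j) * \<omega> ((y i)\<^sup>\<star> \<otimes> y j))
      + complex_of_real N * \<omega> (z\<^sup>\<star> \<otimes> z)"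
    unfolding zz sum.distrib sum_distrib_left ..
  also have "(\<Sum>i<Suc n. \<Sum>j<Suc n. \<omega> ((x' i)\<^sup>\<star> \<otimes> x' j) * \<omega> ((y i)\<^sup>\<star> \<otimes> y j))
      = (\<Sum>i<n. \<Sum>j<n. \<omega> ((x' i)\<^sup>\<star> \<otimes> x' j) * \<omega> ((y i)\<^sup>\<star> \<otimes> y j))"
    using x'n x'n' x' by simp
  finally show ?case
    using Suc.IH[of x'] x' Suc.prems \<omega>_pos(2)[OF z] by (simp add: N_def)
qed simp

lemma mat_pos_sandwich:
  assumes M: "mat_pos A n M" and u: "\<And>i. i < n \<Longrightarrow> u i \<in> S"
  shows "mat_pos A n (\<lambda>i j. (u i)\<^sup>\<star> \<otimes> M i j \<otimes> u j)"
proof -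
  obtain X where X: "\<And>i j. i < n \<Longrightarrow> j < n \<Longrightarrow> X i j \<in> S"
    and MX: "\<And>i j. i < n \<Longrightarrow> j < n \<Longrightarrow> M i j = cs_sum A n (\<lambda>k. (X k i)\<^sup>\<star> \<otimes> X k j)"
    using M by (rule mat_posE) blast
  have "(u i)\<^sup>\<star> \<otimes> M i j \<otimes> u j = cs_sum A n (\<lambda>k. (X k i \<otimes> u i)\<^sup>\<star> \<otimes> (X k j \<otimes> u j))"
    if "i < n" "j < n" for i j
  proof -
    have "(u i)\<^sup>\<star> \<otimes> M i j \<otimes> u j = cs_sum A n (\<lambda>k. (u i)\<^sup>\<star> \<otimes> ((X k i)\<^sup>\<star> \<otimes> X k j) \<otimes> u j)"
      unfolding MX[OF that] using that u X by (simp add: cs_sum_mult_left cs_sum_mult_right)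
    also have "\<dots> = cs_sum A n (\<lambda>k. (X k i \<otimes> u i)\<^sup>\<star> \<otimes> (X k j \<otimes> u j))"
      using that u X by (intro cs_sum_cong) (simp add: star_mult mult_assoc)
    finally show ?thesis .
  qed
  then have *: "\<forall>i<n. \<forall>j<n. (u i)\<^sup>\<star> \<otimes> M i j \<otimes> u j = cs_sum A n (\<lambda>k. (X k i \<otimes> u i)\<^sup>\<star> \<otimes> (X k j \<otimes> u j))"
    by blast
  have "\<forall>i<n. \<forall>j<n. M i j \<in> S" using M by (simp add: mat_pos_def)
  then show ?thesis
    unfolding mat_pos_def by (intro conjI exI[of _ "\<lambda>k i. X k i \<otimes> u i"] *) (use u X in simp_all)
qed

text \<open>The factor has ones in row 0 and zeros elsewhere, so exactly one summand
  survives.\<close>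

lemma mat_pos_ones: "mat_pos A n (\<lambda>i j. \<one>)"
proof -
  have *: "cs_sum A m (\<lambda>k. (if k = 0 then \<one> else \<zero>)\<^sup>\<star> \<otimes> (if k = 0 then \<one> else \<zero>)) = \<one>" if "m > 0" for m
    using that by (induction m rule: nat_induct_non_zero) auto
  then show ?thesis
    unfolding mat_pos_def by (intro conjI exI[of _ "\<lambda>k i. if k = 0 then \<one> else \<zero>"]) auto
qed

end

lemma insort_split: "\<exists>xs ys. l = xs @ ys \<and> insort s l = xs @ s # ys"
proof (induction l)
  case (Cons a l)
  show ?case
  proof (cases "s \<le> a")
    case False
    obtain xs ys where l: "l = xs @ ys" "insort s l = xs @ s # ys" using Cons by blast
    have "insort s (a # l) = (a # xs) @ s # ys" using False l(2) by simp
    moreover have "a # l = (a # xs) @ ys" using l(1) by simp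
    ultimately show ?thesis by blast
  qed (intro exI[of _ "[]"] exI[of _ "a # l"], simp)
qed simp

section \<open>Adjoints and continuity of the semigroup maps\<close>

locale cp_flow = state_cstar +
  fixes \<phi> :: "real \<Rightarrow> 'a \<Rightarrow> 'a"
  assumes semigroup: "cp0_semigroup A \<phi>"
begin

lemma \<phi>_cp: "t \<ge> 0 \<Longrightarrow> cp_map A A (\<phi> t)" "t \<ge> 0 \<Longrightarrow> \<phi> t \<one> = \<one>"
  using semigroup by (auto simp: cp0_semigroup_def ucp_map_def)

lemma \<phi>_closed [simp]: "t \<ge> 0 \<Longrightarrow> x \<in> S \<Longrightarrow> \<phi> t x \<in> S"
  and \<phi>_add: "t \<ge> 0 \<Longrightarrow> x \<in> S \<Longrightarrow> y \<in> S \<Longrightarrow> \<phi> t (x \<oplus> y) = \<phi> t x \<oplus> \<phi> t y"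
  and \<phi>_smult: "t \<ge> 0 \<Longrightarrow> x \<in> S \<Longrightarrow> \<phi> t (c \<odot> x) = c \<odot> \<phi> t x"
  using \<phi>_cp(1)[of t] by (auto simp: cp_map_def linear_map_def)

lemma \<phi>_sub: "t \<ge> 0 \<Longrightarrow> x \<in> S \<Longrightarrow> y \<in> S \<Longrightarrow> \<phi> t (x \<ominus> y) = \<phi> t x \<ominus> \<phi> t y"
  by (simp add: cs_sub_def \<phi>_add \<phi>_smult)

lemma \<phi>_0 [simp]: "x \<in> S \<Longrightarrow> \<phi> 0 x = x"
  and \<phi>_\<phi>: "s \<ge> 0 \<Longrightarrow> t \<ge> 0 \<Longrightarrow> x \<in> S \<Longrightarrow> \<phi> s (\<phi> t x) = \<phi> (s + t) x"
  using semigroup by (auto simp: cp0_semigroup_def)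

lemma \<phi>_mat_pos: "t \<ge> 0 \<Longrightarrow> mat_pos A n M \<Longrightarrow> mat_pos A n (\<lambda>i j. \<phi> t (M i j))"
  using \<phi>_cp(1)[of t] by (auto simp: cp_map_def)

lemma \<phi>_square:
  assumes "t \<ge> 0" "x \<in> S" obtains y where "y \<in> S" "\<phi> t (x\<^sup>\<star> \<otimes> x) = y\<^sup>\<star> \<otimes> y"
proof -
  have "mat_pos A 1 (\<lambda>_ _. x\<^sup>\<star> \<otimes> x)"
    unfolding mat_pos_def using assms by (intro conjI exI[of _ "\<lambda>_ _. x"]) auto
  from \<phi>_mat_pos[OF assms(1) this] obtain X where
    "X 0 0 \<in> S" "\<phi> t (x\<^sup>\<star> \<otimes> x) = cs_sum A 1 (\<lambda>k. (X k 0)\<^sup>\<star> \<otimes> X k (0::nat))"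
    unfolding mat_pos_def by auto
  then show ?thesis using that[of "X 0 0"] by simp
qed

text \<open>The definition of \<open>cp_map\<close> does not mention adjoints. Squares have
  hermitian images, and polarising with \<open>x \<oplus> c \<odot> \<one>\<close> for
  \<open>c = 1\<close> and \<open>c = \<i>\<close> yields the claim.\<close>

lemma \<phi>_star:
  assumes t: "t \<ge> 0" and x: "x \<in> S" shows "\<phi> t (x\<^sup>\<star>) = (\<phi> t x)\<^sup>\<star>"
proof -
  have herm: "(\<phi> t (y\<^sup>\<star> \<otimes> y))\<^sup>\<star> = \<phi> t (y\<^sup>\<star> \<otimes> y)" if "y \<in> S" for y
    by (rule \<phi>_square[OF t that]) (simp add: star_mult)
  have e: "\<phi> t ((x \<oplus> c \<odot> \<one>)\<^sup>\<star> \<otimes> (x \<oplus> c \<odot> \<one>))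
      = \<phi> t (x\<^sup>\<star> \<otimes> x) \<oplus> (c \<odot> \<phi> t (x\<^sup>\<star>) \<oplus> (cnj c \<odot> \<phi> t x \<oplus> (c * cnj c) \<odot> \<one>))" for c
  proof -
    have "(x \<oplus> c \<odot> \<one>)\<^sup>\<star> \<otimes> (x \<oplus> c \<odot> \<one>) = x\<^sup>\<star> \<otimes> x \<oplus> (c \<odot> x\<^sup>\<star> \<oplus> (cnj c \<odot> x \<oplus> (c * cnj c) \<odot> \<one>))"
      using x by (intro lin_eqI) (auto simp: lin_simps expand algebra_simps)
    then show ?thesis using t x by (simp add: \<phi>_add \<phi>_smult \<phi>_cp)
  qed
  have h: "f (cnj c \<odot> (\<phi> t (x\<^sup>\<star>))\<^sup>\<star>) + f (c \<odot> (\<phi> t x)\<^sup>\<star>) = f (c \<odot> \<phi> t (x\<^sup>\<star>)) + f (cnj c \<odot> \<phi> t x)"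
    if f: "lin f" for f c
  proof -
    have "f ((\<phi> t ((x \<oplus> c \<odot> \<one>)\<^sup>\<star> \<otimes> (x \<oplus> c \<odot> \<one>)))\<^sup>\<star>) = f (\<phi> t ((x \<oplus> c \<odot> \<one>)\<^sup>\<star> \<otimes> (x \<oplus> c \<odot> \<one>)))"
      using herm[of "x \<oplus> c \<odot> \<one>"] x by simp
    then show ?thesis
      unfolding e using t x herm[OF x] by (simp add: star_add star_smult lin_simps[OF f] mult.commute)
  qed
  show ?thesis
  proof (rule lin_eqI)
    fix f assume f: "lin f"
    show "f (\<phi> t (x\<^sup>\<star>)) = f ((\<phi> t x)\<^sup>\<star>)"
      using h[OF f, of 1] h[OF f, of \<i>] t x by (simp add: lin_simps[OF f] algebra_simps complex_eq_iff)
  qed (use t x in auto)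
qed

text \<open>For a hermitian contraction \<open>h\<close> both \<open>1 - h\<close> and
  \<open>1 + h\<close> are squares, hence so are their images, and
  \<open>hermitian_norm_le_one\<close> applies. The factor 2 comes from splitting \<open>x\<close>
  into two hermitian parts.\<close>

lemma \<phi>_norm_le:
  assumes t: "t \<ge> 0" and x: "x \<in> S" shows "\<parallel>\<phi> t x\<parallel> \<le> 2 * \<parallel>x\<parallel>"
proof -
  have contraction: "\<parallel>\<phi> t h\<parallel> \<le> 1" if h: "h \<in> S" "h\<^sup>\<star> = h" "\<parallel>h\<parallel> \<le> 1" for h
  proof -
    have sq: "\<exists>r\<in>S. r\<^sup>\<star> \<otimes> r = \<one> \<ominus> \<phi> t g" if g: "g \<in> S" "g\<^sup>\<star> = g" "\<parallel>g\<parallel> \<le> 1" for g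
    proof -
      obtain b where b: "b \<in> S" "b\<^sup>\<star> = b" "b \<otimes> b = \<one> \<ominus> g" using sqrt_one_minus[OF g] by metis
      obtain r where r: "r \<in> S" "\<phi> t (b\<^sup>\<star> \<otimes> b) = r\<^sup>\<star> \<otimes> r" using \<phi>_square[OF t b(1)] by blast
      have "r\<^sup>\<star> \<otimes> r = \<phi> t (\<one> \<ominus> g)" using r b by simp
      also have "\<dots> = \<one> \<ominus> \<phi> t g" using t g(1) by (simp add: \<phi>_sub \<phi>_cp)
      finally show ?thesis using r(1) by blast
    qed
    obtain r where r: "r \<in> S" "r\<^sup>\<star> \<otimes> r = \<one> \<ominus> \<phi> t h" using sq[OF h] by blast
    obtain s where s: "s \<in> S" "s\<^sup>\<star> \<otimes> s = \<one> \<ominus> \<phi> t ((-1) \<odot> h)"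
      using sq[of "(-1) \<odot> h"] h by (auto simp: star_smult)
    have "\<one> \<ominus> \<phi> t ((-1) \<odot> h) = \<one> \<oplus> \<phi> t h"
      using t h by (simp add: \<phi>_smult cs_sub_def)
    then show ?thesis using hermitian_norm_le_one[OF _ r s(1)] s(2) t h by simp
  qed
  have herm: "\<parallel>\<phi> t h\<parallel> \<le> \<parallel>h\<parallel>" if h: "h \<in> S" "h\<^sup>\<star> = h" for h
  proof (cases "\<parallel>h\<parallel> = 0")
    case True
    then have "h = \<zero>" using h norm_eq_0 by simp
    then show ?thesis using \<phi>_smult[OF t, of \<zero> 0] t by simp
  next
    case False
    let ?g = "complex_of_real (1 / \<parallel>h\<parallel>) \<odot> h"
    have "\<parallel>\<phi> t ?g\<parallel> \<le> 1" using h False by (intro contraction) (auto simp: star_smult norm_divide)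
    then show ?thesis
      using h t False norm_nonneg[OF h(1)] by (simp add: \<phi>_smult norm_divide divide_le_eq)
  qed
  let ?a = "(1/2) \<odot> (x \<oplus> x\<^sup>\<star>)" and ?b = "(-(\<i>/2)) \<odot> (x \<ominus> x\<^sup>\<star>)"
  have S: "?a \<in> S" "?b \<in> S" using x by auto
  have star: "?a\<^sup>\<star> = ?a" "?b\<^sup>\<star> = ?b"
    using x by (intro lin_eqI; simp add: lin_simps expand algebra_simps)+
  have nab: "\<parallel>?a\<parallel> \<le> \<parallel>x\<parallel>" "\<parallel>?b\<parallel> \<le> \<parallel>x\<parallel>"
    using x norm_triangle[of x "x\<^sup>\<star>"] norm_sub_le[of x "x\<^sup>\<star>"]
    by (simp_all add: norm_divide Real_Vector_Spaces.norm_mult)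
  have "x = ?a \<oplus> \<i> \<odot> ?b" using x by (intro lin_eqI) (auto simp: lin_simps algebra_simps)
  then have "\<phi> t x = \<phi> t ?a \<oplus> \<i> \<odot> \<phi> t ?b" using S t by (metis \<phi>_add \<phi>_smult closed(5))
  then show ?thesis
    using norm_triangle[of "\<phi> t ?a" "\<i> \<odot> \<phi> t ?b"] herm[OF S(1) star(1)] herm[OF S(2) star(2)] nab t S by simp
qed

lemma \<phi>_conv:
  assumes "t \<ge> 0" "\<And>n. X n \<in> S" "x \<in> S" "conv X x"
  shows "conv (\<lambda>n. \<phi> t (X n)) (\<phi> t x)"
proof (rule conv_le)
  show "(\<lambda>n. 2 * \<parallel>X n \<ominus> x\<parallel>) \<longlonglongrightarrow> 0"
    using tendsto_mult_right_zero[OF assms(4)[unfolded conv_def]] .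
  show "\<parallel>\<phi> t (X n) \<ominus> \<phi> t x\<parallel> \<le> 2 * \<parallel>X n \<ominus> x\<parallel>" for n
    using \<phi>_norm_le[of t "X n \<ominus> x"] assms by (simp add: \<phi>_sub)
qed (use assms in auto)

section \<open>Words and their pairing\<close>

text \<open>A word \<open>u\<close> stands for the vector \<open>\<dots> j\<^sub>t (u t) \<dots> j\<^sub>0 (u 0) \<xi>\<close> of the weak Markov flow \<open>j\<close>
  dilating \<open>\<phi>\<close>, times decreasing from left to right and \<open>u t = \<one>\<close> for almost all \<open>t\<close>.  The inner
  product of two words is computed by contracting from the largest time downwards.\<close>

definition supp :: "(real \<Rightarrow> 'a) \<Rightarrow> real set" where
  "supp u = {t. t \<ge> 0 \<and> u t \<noteq> \<one>}"

definition words :: "(real \<Rightarrow> 'a) set" where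
  "words = {u. (\<forall>t. u t \<in> S) \<and> finite (supp u)}"

text \<open>The compression to time \<open>t\<close>: everything above \<open>s\<close> collapses to
  one element at time \<open>s\<close>, is multiplied by the two letters there, and
  \<open>\<phi> (s - t)\<close> carries the result down, as in the compression law of the
  flow.\<close>

fun contract :: "real \<Rightarrow> real list \<Rightarrow> (real \<Rightarrow> 'a) \<Rightarrow> (real \<Rightarrow> 'a) \<Rightarrow> 'a" where
  "contract t [] u v = \<one>"
| "contract t (s # ts) u v = \<phi> (s - t) ((u s)\<^sup>\<star> \<otimes> contract s ts u v \<otimes> v s)"

text \<open>The same recursion cut at time \<open>s\<close>, with \<open>c\<close> in place of all
  that happens from \<open>s\<close> on; it isolates the part of a pairing that an operator at time
  \<open>s\<close> can change.\<close>

fun descend :: "real \<Rightarrow> real list \<Rightarrow> real \<Rightarrow> 'a \<Rightarrow> (real \<Rightarrow> 'a) \<Rightarrow> (real \<Rightarrow> 'a) \<Rightarrow> 'a" where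
  "descend t [] s c u v = \<phi> (s - t) c"
| "descend t (r # rs) s c u v = \<phi> (r - t) ((u r)\<^sup>\<star> \<otimes> descend r rs s c u v \<otimes> v r)"

definition pairing :: "(real \<Rightarrow> 'a) \<Rightarrow> (real \<Rightarrow> 'a) \<Rightarrow> 'a" where
  "pairing u v = contract 0 (sorted_list_of_set (supp u \<union> supp v)) u v"

text \<open>All letters from time \<open>s\<close> on, collapsed into one element at time
  \<open>s\<close>: compressing by \<open>p\<^sub>s\<close> from the left amounts to pairing them
  with letters \<open>\<one>\<close>.\<close>

definition head :: "real \<Rightarrow> (real \<Rightarrow> 'a) \<Rightarrow> 'a" where
  "head s u = contract s (sorted_list_of_set (supp u \<inter> {s..})) (\<lambda>_. \<one>) u"

text \<open>The operator \<open>j\<^sub>s(a)\<close> applied to a word. Since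
  \<open>j\<^sub>s(a) = j\<^sub>s(a) p\<^sub>s\<close>, the letters from \<open>s\<close> on are
  absorbed into one, and the later ones become \<open>\<one>\<close>.\<close>

definition push :: "real \<Rightarrow> 'a \<Rightarrow> (real \<Rightarrow> 'a) \<Rightarrow> real \<Rightarrow> 'a" where
  "push s a u r = (if r < s then u r else if r = s then a \<otimes> head s u else \<one>)"

lemma wordsD: "u \<in> words \<Longrightarrow> u t \<in> S" "u \<in> words \<Longrightarrow> finite (supp u)"
  by (auto simp: words_def)

lemma one_word [simp]: "(\<lambda>_. \<one>) \<in> words" "supp (\<lambda>_. \<one>) = {}"
  by (auto simp: words_def supp_def)

lemma contract_closed [simp]:
  "sorted (t # ts) \<Longrightarrow> u \<in> words \<Longrightarrow> v \<in> words \<Longrightarrow> contract t ts u v \<in> S"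
  by (induction ts arbitrary: t) (auto simp: wordsD)

lemma contract_star:
  "sorted (t # ts) \<Longrightarrow> u \<in> words \<Longrightarrow> v \<in> words \<Longrightarrow> (contract t ts u v)\<^sup>\<star> = contract t ts v u"
  by (induction ts arbitrary: t) (auto simp: wordsD star_mult mult_assoc simp flip: \<phi>_star)

lemma contract_cong:
  "(\<And>s. s \<in> set ts \<Longrightarrow> u s = u' s \<and> v s = v' s) \<Longrightarrow> contract t ts u v = contract t ts u' v'"
  by (induction ts arbitrary: t) auto

text \<open>At such a time the contraction only applies \<open>\<phi>\<close>, and two consecutive
  steps merge by the semigroup law; at the end of the list \<open>\<phi>\<close> fixes
  \<open>\<one>\<close>.\<close>

lemma contract_skip:
  assumes "sorted (t # xs @ s # ys)" "u \<in> words" "v \<in> words" "u s = \<one>" "v s = \<one>"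
  shows "contract t (xs @ s # ys) u v = contract t (xs @ ys) u v"
  using assms
proof (induction xs arbitrary: t)
  case Nil
  then show ?case
    by (cases ys) (auto simp: \<phi>_cp \<phi>_\<phi> wordsD)
qed auto

text \<open>Allows any finite set of times containing the supports, so that several words can be
  contracted over one common list.\<close>

lemma contract_superset:
  assumes "finite G" "F \<subseteq> G" "\<And>s. s \<in> G \<Longrightarrow> t \<le> s" "u \<in> words" "v \<in> words"
    and "\<And>s. s \<in> G \<Longrightarrow> s \<notin> F \<Longrightarrow> u s = \<one> \<and> v s = \<one>"
  shows "contract t (sorted_list_of_set G) u v = contract t (sorted_list_of_set F) u v"
proof -
  have "finite (G - F)" using assms(1) by simp
  then have "(\<And>s. s \<in> G - F \<Longrightarrow> u s = \<one> \<and> v s = \<one>) \<Longrightarrow> (\<And>s. s \<in> F \<union> (G - F) \<Longrightarrow> t \<le> s) \<Longrightarrow>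
      contract t (sorted_list_of_set (F \<union> (G - F))) u v = contract t (sorted_list_of_set F) u v"
  proof (induction "G - F" arbitrary: G rule: finite_induct)
    case empty
    then have "F \<union> (G - F) = F" by auto
    then show ?case by simp
  next
    case (insert s H)
    have fin: "finite (F \<union> H)" using insert.hyps(1) assms(1,2) by (simp add: finite_subset)
    have eq: "F \<union> (G - F) = Set.insert s (F \<union> H)" and s: "s \<notin> F \<union> H" and H: "H = (F \<union> H) - F"
      using insert.hyps by auto
    obtain xs ys where l: "sorted_list_of_set (F \<union> H) = xs @ ys"
        "insort s (sorted_list_of_set (F \<union> H)) = xs @ s # ys"
      using insort_split by blast
    have G: "sorted_list_of_set (F \<union> (G - F)) = xs @ s # ys"
      unfolding eq using fin s l(2) by simp
    have "set (xs @ s # ys) = F \<union> (G - F)"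
      using G fin eq by (metis finite_insert set_sorted_list_of_set)
    then have "sorted (t # xs @ s # ys)"
      using insert.prems(2) G sorted_sorted_list_of_set[of "F \<union> (G - F)"] by simp
    then have "contract t (sorted_list_of_set (F \<union> (G - F))) u v = contract t (sorted_list_of_set (F \<union> H)) u v"
      unfolding G l(1) using insert.prems(1)[of s] insert.hyps(4) assms(4,5) by (intro contract_skip) auto
    also have "\<dots> = contract t (sorted_list_of_set F) u v"
      using insert.hyps(3)[of "F \<union> H"] H insert.prems insert.hyps(4) by (metis (no_types, lifting) Un_iff eq insert_iff)
    finally show ?case .
  qed
  moreover have GF: "F \<union> (G - F) = G" using assms(2) by auto
  ultimately show ?thesis unfolding GF using assms(3,6) by blast
qed

lemma pairing_eq:
  assumes "u \<in> words" "v \<in> words" "finite F" "supp u \<union> supp v \<subseteq> F" "F \<subseteq> {0..}"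
  shows "pairing u v = contract 0 (sorted_list_of_set F) u v"
  unfolding pairing_def using assms
  by (intro contract_superset[symmetric]) (auto simp: supp_def)

lemma head_eq:
  assumes "u \<in> words" "finite F" "supp u \<inter> {s..} \<subseteq> F" "F \<subseteq> {s..}" "s \<ge> 0"
  shows "head s u = contract s (sorted_list_of_set F) (\<lambda>_. \<one>) u"
  unfolding head_def using assms
  by (intro contract_superset[symmetric]) (auto simp: supp_def)

lemma sorted_list_Cons: "finite F \<Longrightarrow> (\<And>s. s \<in> F \<Longrightarrow> t \<le> s) \<Longrightarrow> sorted (t # sorted_list_of_set F)"
  by simp

lemma head_closed [simp]: "u \<in> words \<Longrightarrow> head s u \<in> S"
  unfolding head_def using wordsD(2)[of u] by (intro contract_closed sorted_list_Cons) auto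

lemma pairing_closed [simp]: "u \<in> words \<Longrightarrow> v \<in> words \<Longrightarrow> pairing u v \<in> S"
  unfolding pairing_def using wordsD(2)[of u] wordsD(2)[of v]
  by (intro contract_closed sorted_list_Cons) (auto simp: supp_def)

lemma pairing_star: "u \<in> words \<Longrightarrow> v \<in> words \<Longrightarrow> (pairing u v)\<^sup>\<star> = pairing v u"
  unfolding pairing_def using wordsD(2)[of u] wordsD(2)[of v]
  by (subst contract_star) (auto simp: supp_def Un_commute)

lemma supp_push: "supp (push s a u) \<subseteq> Set.insert s (supp u)"
  by (auto simp: supp_def push_def)

lemma push_closed [simp]: "u \<in> words \<Longrightarrow> a \<in> S \<Longrightarrow> push s a u \<in> words"
proof -
  assume u: "u \<in> words" and a: "a \<in> S"
  have "push s a u r \<in> S" for r using wordsD(1)[OF u] head_closed[OF u] a by (simp add: push_def)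
  moreover have "finite (supp (push s a u))"
    by (rule finite_subset[OF supp_push]) (simp add: wordsD(2)[OF u])
  ultimately show ?thesis by (simp add: words_def)
qed

lemma head_push:
  assumes "u \<in> words" "a \<in> S" "s \<ge> 0" shows "head s (push s a u) = a \<otimes> head s u"
proof -
  have "head s (push s a u) = contract s (sorted_list_of_set {s}) (\<lambda>_. \<one>) (push s a u)"
    using assms by (intro head_eq) (auto simp: supp_def push_def split: if_splits)
  then show ?thesis using assms by (simp add: push_def)
qed

lemma push_push: "u \<in> words \<Longrightarrow> a \<in> S \<Longrightarrow> b \<in> S \<Longrightarrow> s \<ge> 0 \<Longrightarrow> push s a (push s b u) = push s (a \<otimes> b) u"
  by (auto simp: push_def[of s a "push s b u"] head_push mult_assoc push_def fun_eq_iff)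

lemma contract_append:
  "contract t (xs @ s # ys) u v = descend t xs s ((u s)\<^sup>\<star> \<otimes> contract s ys u v \<otimes> v s) u v"
  by (induction xs arbitrary: t) auto

lemma descend_cong:
  "(\<And>r. r \<in> set rs \<Longrightarrow> u r = u' r \<and> v r = v' r) \<Longrightarrow> descend t rs s c u v = descend t rs s c u' v'"
  by (induction rs arbitrary: t) auto

lemma descend_closed [simp]:
  "sorted (t # rs @ [s]) \<Longrightarrow> c \<in> S \<Longrightarrow> u \<in> words \<Longrightarrow> v \<in> words \<Longrightarrow> descend t rs s c u v \<in> S"
  by (induction rs arbitrary: t) (auto simp: wordsD)

lemma descend_linear:
  assumes "sorted (t # rs @ [s])" "c \<in> S" "d \<in> S" "u \<in> words" "v \<in> words"
  shows "descend t rs s (c \<oplus> d) u v = descend t rs s c u v \<oplus> descend t rs s d u v"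
    and "descend t rs s (k \<odot> c) u v = k \<odot> descend t rs s c u v"
  using assms
  by (induction rs arbitrary: t) (auto simp: wordsD \<phi>_add \<phi>_smult distrib_left distrib_right smult_mult_left smult_mult_right)

text \<open>\<open>push s\<close> leaves the letters below \<open>s\<close> alone, so both pairings
  descend along one list \<open>rs\<close>, independent of \<open>a\<close>, and differ only in the
  element inserted at time \<open>s\<close>. Linearity and adjoints in \<open>a\<close> are read off
  from this.\<close>

lemma pairing_push:
  assumes w: "w \<in> words" and u: "u \<in> words" and s: "s \<ge> 0"
  obtains rs where "sorted (0 # rs @ [s])"
    "\<And>a. a \<in> S \<Longrightarrow> pairing w (push s a u) = descend 0 rs s ((head s w)\<^sup>\<star> \<otimes> (a \<otimes> head s u)) w u"
    "\<And>a. a \<in> S \<Longrightarrow> pairing (push s a w) u = descend 0 rs s ((a \<otimes> head s w)\<^sup>\<star> \<otimes> head s u) w u"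
proof -
  define F where "F = Set.insert s (supp w \<union> supp u)"
  have F: "finite F" "F \<subseteq> {0..}" "s \<in> F" using w u s by (simp_all add: F_def wordsD) (auto simp: supp_def)
  define xs ys where "xs = sorted_list_of_set {r\<in>F. r < s}" and "ys = sorted_list_of_set {r\<in>F. r > s}"
  have xs: "\<And>r. r \<in> set xs \<longleftrightarrow> r \<in> F \<and> r < s" and ys: "\<And>r. r \<in> set ys \<longleftrightarrow> r \<in> F \<and> s < r"
    using F by (auto simp: xs_def ys_def)
  have sorted: "sorted (xs @ s # ys)" "distinct (xs @ s # ys)"
    using F by (auto simp: xs_def ys_def sorted_append)
  have set: "set (xs @ s # ys) = F" "set (s # ys) = {r \<in> F. s \<le> r}"
    using F by (auto simp: xs ys)
  have split: "sorted_list_of_set F = xs @ s # ys" "sorted_list_of_set {r \<in> F. s \<le> r} = s # ys"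
    using sorted sorted_list_of_set.idem_if_sorted_distinct[of "xs @ s # ys"]
      sorted_list_of_set.idem_if_sorted_distinct[of "s # ys"]
    unfolding set by (simp_all add: sorted_append)
  have sorted_ys: "sorted (s # ys)" using sorted by (simp add: sorted_append)
  have head: "head s v = contract s ys (\<lambda>_. \<one>) v \<otimes> v s" "(head s v)\<^sup>\<star> = (v s)\<^sup>\<star> \<otimes> contract s ys v (\<lambda>_. \<one>)"
    if "v \<in> words" "supp v \<subseteq> F" for v
  proof -
    have "head s v = contract s (sorted_list_of_set {r \<in> F. s \<le> r}) (\<lambda>_. \<one>) v"
      using that s F by (intro head_eq) auto
    then show *: "head s v = contract s ys (\<lambda>_. \<one>) v \<otimes> v s"
      unfolding split using that sorted_ys by (simp add: wordsD)
    show "(head s v)\<^sup>\<star> = (v s)\<^sup>\<star> \<otimes> contract s ys v (\<lambda>_. \<one>)"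
      unfolding * using that sorted_ys by (simp add: star_mult contract_star wordsD)
  qed
  have sub: "supp w \<subseteq> F" "supp u \<subseteq> F" by (auto simp: F_def)
  have supp: "supp (push s a v) \<subseteq> F" if "supp v \<subseteq> F" for a v
    using supp_push[of s a v] F that by auto
  have below: "push s a v r = v r" if "r \<in> set xs" for a v r using that by (simp add: xs push_def)
  have above: "push s a v r = \<one>" if "r \<in> set ys" for a v r using that by (simp add: ys push_def)
  show ?thesis
  proof (rule that[of xs])
    show "sorted (0 # xs @ [s])" using F sorted by (auto simp: xs sorted_append)
    fix a assume a: "a \<in> S"
    let ?p = "push s a u" and ?q = "push s a w"
    have "pairing w ?p = contract 0 (xs @ s # ys) w ?p"
      unfolding split(1)[symmetric] using w u a F sub supp[OF sub(1)] supp[OF sub(2)] by (intro pairing_eq) auto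
    also have "\<dots> = descend 0 xs s ((w s)\<^sup>\<star> \<otimes> contract s ys w (\<lambda>_. \<one>) \<otimes> (a \<otimes> head s u)) w u"
      unfolding contract_append using contract_cong[of ys w w ?p "\<lambda>_. \<one>"] above[of _ a u] below[of _ a u]
      by (subst descend_cong[of xs w w ?p u]) (auto simp: push_def[of s a u s])
    finally show "pairing w ?p = descend 0 xs s ((head s w)\<^sup>\<star> \<otimes> (a \<otimes> head s u)) w u"
      using head(2)[OF w sub(1)] by simp
    have "pairing ?q u = contract 0 (xs @ s # ys) ?q u"
      unfolding split(1)[symmetric] using w u a F sub supp[OF sub(1)] supp[OF sub(2)] by (intro pairing_eq) auto
    also have "\<dots> = descend 0 xs s ((a \<otimes> head s w)\<^sup>\<star> \<otimes> contract s ys (\<lambda>_. \<one>) u \<otimes> u s) w u"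
      unfolding contract_append using contract_cong[of ys ?q "\<lambda>_. \<one>" u u] above[of _ a w] below[of _ a w]
      by (subst descend_cong[of xs ?q w u u]) (auto simp: push_def[of s a w s])
    also have "(a \<otimes> head s w)\<^sup>\<star> \<otimes> contract s ys (\<lambda>_. \<one>) u \<otimes> u s = (a \<otimes> head s w)\<^sup>\<star> \<otimes> head s u"
      using head(1)[OF u sub(2)] w u a sorted_ys by (simp add: mult_assoc wordsD)
    finally show "pairing ?q u = descend 0 xs s ((a \<otimes> head s w)\<^sup>\<star> \<otimes> head s u) w u" .
  qed
qed

lemma pairing_push_adjoint:
  assumes "w \<in> words" "u \<in> words" "s \<ge> 0" "a \<in> S"
  shows "pairing (push s a w) u = pairing w (push s (a\<^sup>\<star>) u)"
proof -
  obtain rs where "\<And>a. a \<in> S \<Longrightarrow> pairing w (push s a u) = descend 0 rs s ((head s w)\<^sup>\<star> \<otimes> (a \<otimes> head s u)) w u"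
    "\<And>a. a \<in> S \<Longrightarrow> pairing (push s a w) u = descend 0 rs s ((a \<otimes> head s w)\<^sup>\<star> \<otimes> head s u) w u"
    using pairing_push[OF assms(1-3)] by metis
  then show ?thesis using assms by (simp add: star_mult mult_assoc)
qed

lemma pairing_push_linear:
  assumes "w \<in> words" "u \<in> words" "s \<ge> 0" "a \<in> S" "b \<in> S"
  shows "pairing w (push s (a \<oplus> b) u) = pairing w (push s a u) \<oplus> pairing w (push s b u)"
    and "pairing w (push s (c \<odot> a) u) = c \<odot> pairing w (push s a u)"
proof -
  obtain rs where rs: "sorted (0 # rs @ [s])"
    "\<And>a. a \<in> S \<Longrightarrow> pairing w (push s a u) = descend 0 rs s ((head s w)\<^sup>\<star> \<otimes> (a \<otimes> head s u)) w u"
    using pairing_push[OF assms(1-3)] by metis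
  show "pairing w (push s (a \<oplus> b) u) = pairing w (push s a u) \<oplus> pairing w (push s b u)"
    "pairing w (push s (c \<odot> a) u) = c \<odot> pairing w (push s a u)"
    using assms
    by (simp_all add: rs(2) distrib_left distrib_right smult_mult_left smult_mult_right descend_linear[OF rs(1)])
qed

text \<open>From the largest time downwards: the matrix of ones is positive, and sandwiching by
  letters and applying \<open>\<phi>\<close> preserve positivity. Here positivity of
  \<open>\<phi>\<close> on matrices of all sizes enters.\<close>

lemma contract_mat_pos:
  assumes "sorted (t # ts)" "\<And>i. i < n \<Longrightarrow> u i \<in> words"
  shows "mat_pos A n (\<lambda>i j. contract t ts (u i) (u j))"
  using assms
proof (induction ts arbitrary: t)
  case Nil
  then show ?case by (simp add: mat_pos_ones)
next
  case (Cons s ts)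
  then show ?case
    using \<phi>_mat_pos[OF _ mat_pos_sandwich[of n "\<lambda>i j. contract s ts (u i) (u j)" "\<lambda>i. u i s"], of "s - t"]
    by (simp add: wordsD)
qed

lemma pairing_mat_pos:
  assumes "\<And>i. i < n \<Longrightarrow> u i \<in> words"
  shows "mat_pos A n (\<lambda>i j. pairing (u i) (u j))"
proof -
  define F where "F = (\<Union>i<n. supp (u i))"
  have F: "finite F" "F \<subseteq> {0..}" using assms by (auto simp: F_def wordsD) (auto simp: supp_def)
  have "mat_pos A n (\<lambda>i j. contract 0 (sorted_list_of_set F) (u i) (u j))"
    using F assms by (intro contract_mat_pos) auto
  moreover have "contract 0 (sorted_list_of_set F) (u i) (u j) = pairing (u i) (u j)" if "i < n" "j < n" for i j
    using that assms F by (intro pairing_eq[symmetric]) (auto simp: F_def)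
  ultimately show ?thesis unfolding mat_pos_def by auto
qed

text \<open>The inner product of elementary tensors in the flow space of words tensored with the GNS
  space of \<open>\<omega>\<close>.\<close>

definition kernel :: "(real \<Rightarrow> 'a) \<times> 'a \<Rightarrow> (real \<Rightarrow> 'a) \<times> 'a \<Rightarrow> complex" where
  "kernel p q = \<omega> ((snd p)\<^sup>\<star> \<otimes> snd q) * \<omega> (pairing (fst p) (fst q))"

lemma kernel_cnj:
  "p \<in> words \<times> S \<Longrightarrow> q \<in> words \<times> S \<Longrightarrow> kernel q p = cnj (kernel p q)"
  using \<omega>_star_mult[of "snd q" "snd p"] \<omega>_star[of "pairing (fst p) (fst q)"]
  by (auto simp: kernel_def pairing_star)

text \<open>A factorisation \<open>X\<^sup>\<star> X\<close> of the matrix of pairings turns its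
  image under \<open>\<omega>\<close> into a sum over \<open>k\<close> of Gram matrices; each is
  combined with the GNS Gram matrix by the Schur product theorem.\<close>

lemma kernel_pos:
  fixes n :: nat
  assumes "\<And>i. i < n \<Longrightarrow> p i \<in> words \<times> S"
  shows "0 \<le> Re (\<Sum>i<n. \<Sum>j<n. cnj (c i) * c j * kernel (p i) (p j))"
proof -
  have w: "fst (p i) \<in> words" "snd (p i) \<in> S" if "i < n" for i using assms[OF that] by auto
  obtain X where X: "\<And>i j. i < n \<Longrightarrow> j < n \<Longrightarrow> X i j \<in> S"
    and P: "\<And>i j. i < n \<Longrightarrow> j < n \<Longrightarrow> pairing (fst (p i)) (fst (p j)) = cs_sum A n (\<lambda>k. (X k i)\<^sup>\<star> \<otimes> X k j)"
    by (rule mat_posE[OF pairing_mat_pos[of n "\<lambda>i. fst (p i)"]]) (use w in blast)+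
  have "(\<Sum>i<n. \<Sum>j<n. cnj (c i) * c j * kernel (p i) (p j))
      = (\<Sum>i<n. \<Sum>j<n. \<Sum>k<n. \<omega> ((c i \<odot> snd (p i))\<^sup>\<star> \<otimes> (c j \<odot> snd (p j))) * \<omega> ((X k i)\<^sup>\<star> \<otimes> X k j))"
  proof (intro sum.cong refl)
    fix i j assume ij: "i \<in> {..<n}" "j \<in> {..<n}"
    have "\<omega> (pairing (fst (p i)) (fst (p j))) = (\<Sum>k<n. \<omega> ((X k i)\<^sup>\<star> \<otimes> X k j))"
      using ij X by (simp add: P lin_cs_sum[OF lin_\<omega>])
    moreover have "\<omega> ((c i \<odot> snd (p i))\<^sup>\<star> \<otimes> (c j \<odot> snd (p j))) = cnj (c i) * c j * \<omega> ((snd (p i))\<^sup>\<star> \<otimes> snd (p j))"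
      using ij w by (simp add: star_smult smult_mult_left smult_mult_right \<omega>_simps mult_ac)
    ultimately show "cnj (c i) * c j * kernel (p i) (p j)
        = (\<Sum>k<n. \<omega> ((c i \<odot> snd (p i))\<^sup>\<star> \<otimes> (c j \<odot> snd (p j))) * \<omega> ((X k i)\<^sup>\<star> \<otimes> X k j))"
      by (simp add: kernel_def sum_distrib_left mult_ac)
  qed
  also have "\<dots> = (\<Sum>k<n. \<Sum>i<n. \<Sum>j<n. \<omega> ((c i \<odot> snd (p i))\<^sup>\<star> \<otimes> (c j \<odot> snd (p j))) * \<omega> ((X k i)\<^sup>\<star> \<otimes> X k j))"
    by (subst (2) sum.swap, subst sum.swap) simp
  finally have "Re (\<Sum>i<n. \<Sum>j<n. cnj (c i) * c j * kernel (p i) (p j))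
      = (\<Sum>k<n. Re (\<Sum>i<n. \<Sum>j<n. \<omega> ((c i \<odot> snd (p i))\<^sup>\<star> \<otimes> (c j \<odot> snd (p j))) * \<omega> ((X k i)\<^sup>\<star> \<otimes> X k j)))"
    by (simp only: Re_sum)
  also have "\<dots> \<ge> 0" using w X by (intro sum_nonneg schur_nonneg) auto
  finally show ?thesis .
qed

end

section \<open>Operators on the dilation space\<close>

text \<open>Kept as syntax because the shift moves the times of generators, which cannot be read off
  from an operator.\<close>

datatype 'a gen_expr =
  Gen 'a real | Plus "'a gen_expr" "'a gen_expr" | Times "'a gen_expr" "'a gen_expr"
  | Scale complex "'a gen_expr"

primrec shift :: "real \<Rightarrow> 'a gen_expr \<Rightarrow> 'a gen_expr" where
  "shift r (Gen a t) = Gen a (r + t)"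
| "shift r (Plus e f) = Plus (shift r e) (shift r f)"
| "shift r (Times e f) = Times (shift r e) (shift r f)"
| "shift r (Scale c e) = Scale c (shift r e)"

lemma shift_0 [simp]: "shift 0 e = e"
  by (induction e) auto

lemma shift_shift [simp]: "shift r (shift s e) = shift (r + s) e"
  by (induction e) auto

text \<open>A formal sum of elementary tensors, each given by coefficient, word and GNS
  vector.\<close>

type_synonym 'a flow_vec = "(complex \<times> (real \<Rightarrow> 'a) \<times> 'a) list"

context cp_flow
begin

definition vecs :: "'a flow_vec set" where
  "vecs = {v. snd ` set v \<subseteq> words \<times> S}"

definition vip :: "'a flow_vec \<Rightarrow> 'a flow_vec \<Rightarrow> complex" where
  "vip v w = (\<Sum>p\<leftarrow>v. \<Sum>q\<leftarrow>w. cnj (fst p) * fst q * kernel (snd p) (snd q))"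

definition vscale :: "complex \<Rightarrow> 'a flow_vec \<Rightarrow> 'a flow_vec" where
  "vscale c = map (\<lambda>(k, p). (c * k, p))"

lemma vecs_simps [simp]:
  "[] \<in> vecs" "(k, p) # v \<in> vecs \<longleftrightarrow> p \<in> words \<times> S \<and> v \<in> vecs" "v @ w \<in> vecs \<longleftrightarrow> v \<in> vecs \<and> w \<in> vecs"
  by (auto simp: vecs_def)

lemma vscale_vecs [simp]: "v \<in> vecs \<Longrightarrow> vscale c v \<in> vecs"
  by (force simp: vecs_def vscale_def)

lemma vip_Nil [simp]: "vip [] w = 0" "vip v [] = 0"
  by (simp_all add: vip_def)

lemma vip_Cons:
  "vip (p # v) w = vip [p] w + vip v w" "vip v (q # w) = vip v [q] + vip v w"
  by (simp_all add: vip_def sum_list_addf)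

lemma vip_append: "vip (v @ v') w = vip v w + vip v' w" "vip v (w @ w') = vip v w + vip v w'"
  by (simp_all add: vip_def sum_list_addf)

lemma vip_single: "vip [(k, p)] [(l, q)] = cnj k * l * kernel p q"
  by (simp add: vip_def)

lemma vip_scale: "vip v (vscale c w) = c * vip v w"
  by (simp add: vip_def vscale_def case_prod_beta comp_def mult_ac flip: sum_list_const_mult)

lemma vip_cnj: "v \<in> vecs \<Longrightarrow> w \<in> vecs \<Longrightarrow> vip w v = cnj (vip v w)"
proof (induction v)
  case (Cons p v)
  have "w \<in> vecs \<Longrightarrow> vip w [p] = cnj (vip [p] w)"
  proof (induction w)
    case (Cons q w)
    then show ?case using \<open>p # v \<in> vecs\<close> kernel_cnj[of "snd p" "snd q"]
      by (cases p; cases q) (auto simp: vip_Cons(1)[of _ w] vip_Cons(2)[of _ _ w] vip_single)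
  qed simp
  then show ?case using Cons by (cases p) (auto simp: vip_Cons(1)[of _ v] vip_Cons(2)[of _ _ v])
qed simp

lemma vip_pos:
  assumes "v \<in> vecs" shows "0 \<le> Re (vip v v)"
proof -
  have "vip v v = (\<Sum>i<length v. \<Sum>j<length v. cnj (fst (v ! i)) * fst (v ! j) * kernel (snd (v ! i)) (snd (v ! j)))"
    by (simp add: vip_def sum_list_sum_nth atLeast0LessThan)
  moreover have "snd (v ! i) \<in> words \<times> S" if "i < length v" for i
    using assms that by (auto simp: vecs_def)
  ultimately show ?thesis
    using kernel_pos[of "length v" "\<lambda>i. snd (v ! i)" "\<lambda>i. fst (v ! i)"] by simp
qed

sublocale flow: semi_inner vecs append vscale vip
  by unfold_locales (auto simp: vip_append vip_scale vip_pos intro: vip_cnj)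

text \<open>\<open>gact t a\<close> is the operator \<open>j\<^sub>t a \<otimes> 1 + (1 - j\<^sub>t 1) \<otimes> \<pi> a\<close>, where \<open>\<pi>\<close> is the GNS
  representation; the second summand makes \<open>a \<mapsto> gact t a\<close> unital.\<close>

definition gact :: "real \<Rightarrow> 'a \<Rightarrow> 'a flow_vec \<Rightarrow> 'a flow_vec" where
  "gact t a v = concat (map (\<lambda>(k, u, x). [(k, push t a u, x), (k, u, a \<otimes> x), (- k, push t \<one> u, a \<otimes> x)]) v)"

lemma gact_simps [simp]:
  "gact t a [] = []"
  "gact t a ((k, u, x) # v) = (k, push t a u, x) # (k, u, a \<otimes> x) # (- k, push t \<one> u, a \<otimes> x) # gact t a v"
  by (simp_all add: gact_def)

lemma gact_vecs [simp]: "a \<in> S \<Longrightarrow> v \<in> vecs \<Longrightarrow> gact t a v \<in> vecs"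
  by (induction v) auto

lemma kernel_push_adjoint:
  "w \<in> words \<Longrightarrow> u \<in> words \<Longrightarrow> s \<ge> 0 \<Longrightarrow> a \<in> S \<Longrightarrow> kernel (push s a w, x) (u, y) = kernel (w, x) (push s (a\<^sup>\<star>) u, y)"
  by (simp add: kernel_def pairing_push_adjoint)

lemma kernel_mult_adjoint:
  "a \<in> S \<Longrightarrow> x \<in> S \<Longrightarrow> y \<in> S \<Longrightarrow> kernel (w, a \<otimes> x) (u, y) = kernel (w, x) (u, a\<^sup>\<star> \<otimes> y)"
  by (simp add: kernel_def star_mult mult_assoc)

lemma gact_adjoint:
  assumes a: "a \<in> S" and t: "t \<ge> 0" and v: "v \<in> vecs" and w: "w \<in> vecs"
  shows "vip (gact t a v) w = vip v (gact t (a\<^sup>\<star>) w)"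
  using v
proof (induction v)
  case (Cons p v)
  obtain k u x where p: "p = (k, u, x)" by (metis prod_cases3)
  have ux: "u \<in> words" "x \<in> S" "v \<in> vecs" using Cons.prems by (auto simp: p)
  have "vip (gact t a [p]) w = vip [p] (gact t (a\<^sup>\<star>) w)"
    using w
  proof (induction w)
    case (Cons q w)
    obtain l u' y where q: "q = (l, u', y)" by (metis prod_cases3)
    have uy: "u' \<in> words" "y \<in> S" "w \<in> vecs" using Cons.prems by (auto simp: q)
    have "vip (gact t a [p]) [q] = vip [p] (gact t (a\<^sup>\<star>) [q])"
      using ux uy a t
      by (simp add: p q vip_Cons(1)[of _ "_ # _"] vip_Cons(2)[of _ _ "_ # _"] vip_single
          kernel_push_adjoint kernel_mult_adjoint)
    moreover have "gact t (a\<^sup>\<star>) (q # w) = gact t (a\<^sup>\<star>) [q] @ gact t (a\<^sup>\<star>) w" by (simp add: q)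
    ultimately show ?case
      using Cons.IH uy by (simp add: vip_append vip_Cons(2)[of _ q w])
  qed simp
  moreover have "gact t a (p # v) = gact t a [p] @ gact t a v" by (simp add: p)
  ultimately show ?case using Cons.IH ux by (simp add: vip_append vip_Cons(1)[of p v])
qed simp

definition same :: "'a flow_vec \<Rightarrow> 'a flow_vec \<Rightarrow> bool" where
  "same v w \<longleftrightarrow> (\<forall>z\<in>vecs. vip z v = vip z w)"

lemma sameI_single:
  assumes "\<And>k u x. u \<in> words \<Longrightarrow> x \<in> S \<Longrightarrow> vip [(k, u, x)] v = vip [(k, u, x)] w"
  shows "same v w"
proof -
  have "vip z v = vip z w" if "z \<in> vecs" for z
    using that
  proof (induction z)
    case (Cons p z)
    then show ?case using assms by (cases p) (auto simp: vip_Cons(1)[of _ z])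
  qed simp
  then show ?thesis by (simp add: same_def)
qed

lemma same_append: "same v v' \<Longrightarrow> same w w' \<Longrightarrow> same (v @ w) (v' @ w')"
  by (simp add: same_def vip_append)

text \<open>By \<open>push_push\<close>, that is \<open>j\<^sub>t(a) p\<^sub>t = j\<^sub>t(a) =
  p\<^sub>t j\<^sub>t(a)\<close>, the mixed terms between the summands on \<open>p\<^sub>t\<close>
  and on \<open>1 - p\<^sub>t\<close> cancel.\<close>

lemma gact_mult:
  assumes a: "a \<in> S" and b: "b \<in> S" and t: "t \<ge> 0" and w: "w \<in> vecs"
  shows "same (gact t a (gact t b w)) (gact t (a \<otimes> b) w)"
  using w
proof (induction w)
  case (Cons q w)
  obtain l u' y where q: "q = (l, u', y)" by (metis prod_cases3)
  have uy: "u' \<in> words" "y \<in> S" "w \<in> vecs" using Cons.prems by (auto simp: q)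
  have "same (gact t a (gact t b [q])) (gact t (a \<otimes> b) [q])"
  proof (rule sameI_single)
    fix k u x assume "u \<in> words" "x \<in> S"
    then show "vip [(k, u, x)] (gact t a (gact t b [q])) = vip [(k, u, x)] (gact t (a \<otimes> b) [q])"
      using uy a b t
      by (simp add: q vip_Cons(2)[of _ _ "_ # _"] vip_single push_push mult_assoc algebra_simps)
  qed
  from same_append[OF this Cons.IH[OF uy(3)]] show ?case by (simp add: q)
qed (simp add: same_def)

lemma gact_linear:
  assumes a: "a \<in> S" and b: "b \<in> S" and t: "t \<ge> 0" and w: "w \<in> vecs"
  shows "same (gact t (a \<oplus> b) w) (gact t a w @ gact t b w)"
    and "same (gact t (c \<odot> a) w) (vscale c (gact t a w))"
proof -
  have "same (gact t (a \<oplus> b) w) (gact t a w @ gact t b w) \<and> same (gact t (c \<odot> a) w) (vscale c (gact t a w))"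
    using w
  proof (induction w)
    case (Cons q w)
    obtain l u' y where q: "q = (l, u', y)" by (metis prod_cases3)
    have uy: "u' \<in> words" "y \<in> S" "w \<in> vecs" using Cons.prems by (auto simp: q)
    have 1: "same (gact t (a \<oplus> b) [q]) (gact t a [q] @ gact t b [q])"
      and 2: "same (gact t (c \<odot> a) [q]) (vscale c (gact t a [q]))"
      by (rule sameI_single; use uy a b t in \<open>simp add: q vip_append vip_scale vip_Cons(2)[of _ _ "_ # _"] vip_single
        kernel_def pairing_push_linear distrib_left distrib_right smult_mult_left smult_mult_right \<omega>_simps algebra_simps\<close>)+
    have "vip z (gact t (a \<oplus> b) (q # w)) = vip z (gact t a (q # w) @ gact t b (q # w))
        \<and> vip z (gact t (c \<odot> a) (q # w)) = vip z (vscale c (gact t a (q # w)))" if "z \<in> vecs" for z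
    proof -
      have e: "gact t x (q # w) = gact t x [q] @ gact t x w" for x by (simp add: q)
      show ?thesis
        using 1 2 Cons.IH[OF uy(3)] that unfolding e same_def by (simp add: vip_append vip_scale algebra_simps)
    qed
    then show ?case by (simp add: same_def)
  qed (simp add: same_def vscale_def)
  then show "same (gact t (a \<oplus> b) w) (gact t a w @ gact t b w)" "same (gact t (c \<odot> a) w) (vscale c (gact t a w))"
    by auto
qed

lemma gact_one:
  assumes w: "w \<in> vecs" shows "same (gact t \<one> w) w"
  using w
proof (induction w)
  case (Cons q w)
  obtain l u' y where q: "q = (l, u', y)" by (metis prod_cases3)
  have uy: "u' \<in> words" "y \<in> S" "w \<in> vecs" using Cons.prems by (auto simp: q)
  have "same (gact t \<one> [q]) [q]"
    by (rule sameI_single) (use uy in \<open>simp add: q vip_Cons(2)[of _ _ "_ # _"] vip_single algebra_simps\<close>)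
  from same_append[OF this Cons.IH[OF uy(3)]] show ?case by (simp add: q)
qed (simp add: same_def)

text \<open>As for left multiplication in the GNS space:
  \<open>1 - a\<^sup>\<star> a / c\<^sup>2\<close> is a square \<open>b\<^sup>2\<close>, and
  multiplicativity turns this into an inequality of forms. The 1 in \<open>c\<close> avoids division
  by zero.\<close>

lemma gact_bounded:
  assumes a: "a \<in> S" and t: "t \<ge> 0" and v: "v \<in> vecs"
  shows "flow.vnorm (gact t a v) \<le> (\<parallel>a\<parallel> + 1) * flow.vnorm v"
proof -
  define c where "c = \<parallel>a\<parallel> + 1"
  have c: "c > 0" "\<parallel>a\<parallel> \<le> c" using a by (simp_all add: c_def add_nonneg_pos)
  let ?h = "complex_of_real (1/c\<^sup>2) \<odot> (a\<^sup>\<star> \<otimes> a)"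
  have h: "?h \<in> S" "?h\<^sup>\<star> = ?h" using a by (simp_all add: star_smult star_mult)
  have "\<parallel>?h\<parallel> \<le> 1" using a c norm_cstar[OF a] power_mono[OF c(2), of 2] by (simp add: norm_divide norm_power)
  from sqrt_one_minus[OF h this] obtain b where b: "b \<in> S" "b\<^sup>\<star> = b" "b \<otimes> b = \<one> \<ominus> ?h" by metis
  have sq: "vip (gact t x v) (gact t x v) = vip v (gact t (x\<^sup>\<star> \<otimes> x) v)" if "x \<in> S" for x
    using gact_adjoint[of x t v "gact t x v"] gact_mult[of "x\<^sup>\<star>" x t v] that t v by (simp add: same_def)
  have "b\<^sup>\<star> \<otimes> b = \<one> \<oplus> complex_of_real (- (1/c\<^sup>2)) \<odot> (a\<^sup>\<star> \<otimes> a)"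
    unfolding b(2,3) cs_sub_def using a by simp
  then have "vip (gact t b v) (gact t b v) = vip v v - complex_of_real (1/c\<^sup>2) * vip (gact t a v) (gact t a v)"
    using sq[OF b(1)] sq[OF a] gact_linear(1)[of \<one> "complex_of_real (- (1/c\<^sup>2)) \<odot> (a\<^sup>\<star> \<otimes> a)" t v]
      gact_linear(2)[of "a\<^sup>\<star> \<otimes> a" "a\<^sup>\<star> \<otimes> a" t v "complex_of_real (- (1/c\<^sup>2))"] gact_one[of v t] a t v
    by (simp add: same_def vip_append vip_scale)
  then have "0 \<le> Re (vip v v) - Re (vip (gact t a v) (gact t a v)) / c\<^sup>2"
    using vip_pos[of "gact t b v"] b(1) v by (simp flip: of_real_power)
  then have "(flow.vnorm (gact t a v))\<^sup>2 \<le> (c * flow.vnorm v)\<^sup>2"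
    using c a v by (simp add: flow.vnorm_power2 power_mult_distrib divide_le_eq mult.commute)
  then show ?thesis using c v by - (rule power2_le_imp_le, auto simp: c_def)
qed

section \<open>Expressions as bounded operators\<close>

primrec exprs :: "'a gen_expr \<Rightarrow> bool" where
  "exprs (Gen a t) \<longleftrightarrow> a \<in> S \<and> t \<ge> 0"
| "exprs (Plus e f) \<longleftrightarrow> exprs e \<and> exprs f"
| "exprs (Times e f) \<longleftrightarrow> exprs e \<and> exprs f"
| "exprs (Scale c e) \<longleftrightarrow> exprs e"

primrec adj :: "'a gen_expr \<Rightarrow> 'a gen_expr" where
  "adj (Gen a t) = Gen (a\<^sup>\<star>) t"
| "adj (Plus e f) = Plus (adj e) (adj f)"
| "adj (Times e f) = Times (adj f) (adj e)"
| "adj (Scale c e) = Scale (cnj c) (adj e)"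

primrec act :: "'a gen_expr \<Rightarrow> 'a flow_vec \<Rightarrow> 'a flow_vec" where
  "act (Gen a t) v = gact t a v"
| "act (Plus e f) v = act e v @ act f v"
| "act (Times e f) v = act e (act f v)"
| "act (Scale c e) v = vscale c (act e v)"

lemma exprs_shift [simp]: "exprs e \<Longrightarrow> r \<ge> 0 \<Longrightarrow> exprs (shift r e)"
  by (induction e) auto

lemma exprs_adj [simp]: "exprs e \<Longrightarrow> exprs (adj e)"
  by (induction e) auto

lemma shift_adj: "shift r (adj e) = adj (shift r e)"
  by (induction e) auto

lemma act_vecs [simp]: "exprs e \<Longrightarrow> v \<in> vecs \<Longrightarrow> act e v \<in> vecs"
  by (induction e arbitrary: v) auto

lemma vip_scale_left: "v \<in> vecs \<Longrightarrow> w \<in> vecs \<Longrightarrow> vip (vscale c v) w = cnj c * vip v w"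
  using vip_cnj[of "vscale c v" w] vip_cnj[of v w] by (metis complex_cnj_cnj complex_cnj_mult vip_scale vscale_vecs)

lemma act_adj: "exprs e \<Longrightarrow> v \<in> vecs \<Longrightarrow> w \<in> vecs \<Longrightarrow> vip v (act (adj e) w) = vip (act e v) w"
  by (induction e arbitrary: v w) (auto simp: gact_adjoint vip_append vip_scale vip_scale_left)

lemma vnorm_scale: "v \<in> vecs \<Longrightarrow> flow.vnorm (vscale c v) = cmod c * flow.vnorm v"
proof -
  assume v: "v \<in> vecs"
  have "vip (vscale c v) (vscale c v) = complex_of_real ((cmod c)\<^sup>2) * vip v v"
    using v by (simp only: vip_scale vip_scale_left vscale_vecs complex_norm_square) simp
  then show ?thesis by (simp add: flow.vnorm_def real_sqrt_mult)
qed

text \<open>The bound for a generator does not depend on its time, so one constant serves all shifts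
  at once and the supremum over shifts is finite.\<close>

lemma act_bounded:
  "exprs e \<Longrightarrow> \<exists>C\<ge>0. \<forall>r\<ge>0. \<forall>v\<in>vecs. flow.vnorm (act (shift r e) v) \<le> C * flow.vnorm v"
proof (induction e)
  case (Gen a t)
  then show ?case by (intro exI[of _ "\<parallel>a\<parallel> + 1"]) (auto intro: gact_bounded)
next
  case (Plus e f)
  then obtain C D where C: "C \<ge> 0" "D \<ge> 0"
    "\<And>r v. r \<ge> 0 \<Longrightarrow> v \<in> vecs \<Longrightarrow> flow.vnorm (act (shift r e) v) \<le> C * flow.vnorm v"
    "\<And>r v. r \<ge> 0 \<Longrightarrow> v \<in> vecs \<Longrightarrow> flow.vnorm (act (shift r f) v) \<le> D * flow.vnorm v"
    by (metis exprs.simps(2))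
  have "flow.vnorm (act (shift r (Plus e f)) v) \<le> (C + D) * flow.vnorm v" if "r \<ge> 0" "v \<in> vecs" for r v
    using flow.vnorm_add[of "act (shift r e) v" "act (shift r f) v"] C(3)[OF that] C(4)[OF that] Plus.prems that
    by (simp add: ring_distribs)
  then show ?case using C(1,2) by (intro exI[of _ "C + D"]) auto
next
  case (Times e f)
  then obtain C D where C: "C \<ge> 0" "D \<ge> 0"
    "\<And>r v. r \<ge> 0 \<Longrightarrow> v \<in> vecs \<Longrightarrow> flow.vnorm (act (shift r e) v) \<le> C * flow.vnorm v"
    "\<And>r v. r \<ge> 0 \<Longrightarrow> v \<in> vecs \<Longrightarrow> flow.vnorm (act (shift r f) v) \<le> D * flow.vnorm v"
    by (metis exprs.simps(3))
  have "flow.vnorm (act (shift r e) (act (shift r f) v)) \<le> C * D * flow.vnorm v" if "r \<ge> 0" "v \<in> vecs" for r v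
    using C(3)[of r "act (shift r f) v"] mult_left_mono[OF C(4)[OF that] C(1)] Times.prems that by simp
  then show ?case using C(1,2) by (intro exI[of _ "C * D"]) auto
next
  case (Scale c e)
  then obtain C where C: "C \<ge> 0"
    "\<And>r v. r \<ge> 0 \<Longrightarrow> v \<in> vecs \<Longrightarrow> flow.vnorm (act (shift r e) v) \<le> C * flow.vnorm v"
    by auto
  show ?case
  proof (intro exI[of _ "cmod c * C"] conjI allI impI ballI)
    fix r :: real and v assume "r \<ge> 0" "v \<in> vecs"
    then show "flow.vnorm (act (shift r (Scale c e)) v) \<le> cmod c * C * flow.vnorm v"
      using mult_left_mono[OF C(2)[of r v], of "cmod c"] Scale.prems by (simp add: vnorm_scale mult.assoc)
  qed (use C in simp)
qed

text \<open>The representation with index \<open>r\<close> first shifts an expression by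
  \<open>r\<close>, so shifting an element only translates the index of its coefficients.\<close>

sublocale flow: star_rep vecs append vscale vip
  "Collect exprs" Plus Scale Times adj "Gen \<one> 0" "{0..}" "\<lambda>r e. act (shift r e)"
proof unfold_locales
  show "\<exists>C. \<forall>r\<in>{0..}. \<forall>v\<in>vecs. flow.vnorm (act (shift r x) v) \<le> C * flow.vnorm v"
    if "x \<in> Collect exprs" for x
    using act_bounded[of x] that by auto
  show "vip v (act (shift r (Gen \<one> 0)) w) = vip v w" if "r \<in> {0..}" "v \<in> vecs" "w \<in> vecs" for r v w
    using gact_one[of w r] that by (simp add: same_def)
qed (auto simp: vip_append vip_scale shift_adj act_adj)

section \<open>Right multiplication, delay and the expectation\<close>

lemma head_zero: "u \<in> words \<Longrightarrow> head 0 u = pairing (\<lambda>_. \<one>) u"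
  unfolding head_def pairing_def by (simp add: supp_def Int_absorb2 Collect_mono subset_iff)

text \<open>Time 0 is contracted last and \<open>\<phi> 0\<close> is the identity, so the letters at
  0 enter as outer factors and can be replaced freely.\<close>

lemma pairing_zero:
  assumes "u \<in> words" "v \<in> words"
  obtains ts where "sorted (0 # ts)" "0 \<notin> set ts"
    "\<And>u' v'. u' \<in> words \<Longrightarrow> v' \<in> words \<Longrightarrow> (\<And>t. t \<noteq> 0 \<Longrightarrow> u' t = u t) \<Longrightarrow> (\<And>t. t \<noteq> 0 \<Longrightarrow> v' t = v t) \<Longrightarrow>
      pairing u' v' = (u' 0)\<^sup>\<star> \<otimes> contract 0 ts u v \<otimes> v' 0"
proof -
  define F where "F = supp u \<union> supp v - {0}"
  have F: "finite F" "F \<subseteq> {0<..}" using assms by (simp_all add: F_def wordsD) (auto simp: supp_def)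
  have s: "sorted (0 # sorted_list_of_set F)" using F by (intro sorted_list_Cons) auto
  have 0: "sorted_list_of_set (Set.insert 0 F) = 0 # sorted_list_of_set F"
    using F s sorted_list_of_set.idem_if_sorted_distinct[of "0 # sorted_list_of_set F"] by fastforce
  show ?thesis
  proof (rule that[OF s])
    show "0 \<notin> set (sorted_list_of_set F)" using F by auto
    fix u' v' assume w: "u' \<in> words" "v' \<in> words"
      and eq: "\<And>t. t \<noteq> 0 \<Longrightarrow> u' t = u t" "\<And>t. t \<noteq> 0 \<Longrightarrow> v' t = v t"
    have "supp u' \<union> supp v' \<subseteq> Set.insert 0 F" using eq by (auto simp: supp_def F_def)
    then have "pairing u' v' = contract 0 (0 # sorted_list_of_set F) u' v'"
      unfolding 0[symmetric] using w F by (intro pairing_eq) auto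
    also have "contract 0 (sorted_list_of_set F) u' v' = contract 0 (sorted_list_of_set F) u v"
      using F eq by (intro contract_cong) auto
    then have "contract 0 (0 # sorted_list_of_set F) u' v' = (u' 0)\<^sup>\<star> \<otimes> contract 0 (sorted_list_of_set F) u v \<otimes> v' 0"
      using w s assms by (simp add: wordsD)
    finally show "pairing u' v' = (u' 0)\<^sup>\<star> \<otimes> contract 0 (sorted_list_of_set F) u v \<otimes> v' 0" .
  qed
qed

text \<open>The right module structure of words over the algebra: it multiplies on the vacuum side,
  away from the operators.\<close>

definition rmul :: "'a \<Rightarrow> (real \<Rightarrow> 'a) \<Rightarrow> real \<Rightarrow> 'a" where
  "rmul x u = u(0 := u 0 \<otimes> x)"

lemma rmul_words [simp]: "u \<in> words \<Longrightarrow> x \<in> S \<Longrightarrow> rmul x u \<in> words"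
proof -
  assume *: "u \<in> words" "x \<in> S"
  have "supp (rmul x u) \<subseteq> Set.insert 0 (supp u)" by (auto simp: supp_def rmul_def)
  then have "finite (supp (rmul x u))" by (rule finite_subset) (simp add: wordsD(2) *)
  then show ?thesis using * by (auto simp: words_def rmul_def)
qed

lemma pairing_rmul:
  assumes "u \<in> words" "v \<in> words" "x \<in> S" "y \<in> S"
  shows "pairing (rmul y u) (rmul x v) = y\<^sup>\<star> \<otimes> (pairing u v \<otimes> x)"
proof -
  obtain ts where ts: "sorted (0 # ts)" "\<And>u' v'. u' \<in> words \<Longrightarrow> v' \<in> words \<Longrightarrow> (\<And>t. t \<noteq> 0 \<Longrightarrow> u' t = u t) \<Longrightarrow>
      (\<And>t. t \<noteq> 0 \<Longrightarrow> v' t = v t) \<Longrightarrow> pairing u' v' = (u' 0)\<^sup>\<star> \<otimes> contract 0 ts u v \<otimes> v' 0"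
    using pairing_zero[OF assms(1,2)] by metis
  have "pairing (rmul y u) (rmul x v) = (u 0 \<otimes> y)\<^sup>\<star> \<otimes> contract 0 ts u v \<otimes> (v 0 \<otimes> x)"
    using ts(2)[OF rmul_words[OF assms(1,4)] rmul_words[OF assms(2,3)]] by (simp add: rmul_def)
  moreover have "pairing u v = (u 0)\<^sup>\<star> \<otimes> contract 0 ts u v \<otimes> v 0" using ts(2) assms by simp
  ultimately show ?thesis using ts(1) assms by (simp add: wordsD star_mult mult_assoc)
qed

lemma rmul_one [simp]: "u \<in> words \<Longrightarrow> rmul \<one> u = u"
  by (auto simp: rmul_def wordsD)

text \<open>For \<open>t > 0\<close> the head does not involve time 0; for \<open>t = 0\<close> it
  is the pairing with the vacuum word, which is right linear.\<close>

lemma push_rmul: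
  assumes "u \<in> words" "a \<in> S" "x \<in> S" "t \<ge> 0"
  shows "push t a (rmul x u) = rmul x (push t a u)"
proof (cases "t = 0")
  case True
  have "head 0 (rmul x u) = head 0 u \<otimes> x"
    using pairing_rmul[of "\<lambda>_. \<one>" u x \<one>] assms by (simp add: head_zero)
  then show ?thesis using True assms by (auto simp: push_def rmul_def fun_eq_iff mult_assoc)
next
  case False
  have "supp (rmul x u) \<inter> {t..} = supp u \<inter> {t..}" using False assms by (auto simp: supp_def rmul_def)
  moreover have "contract t (sorted_list_of_set (supp u \<inter> {t..})) (\<lambda>_. \<one>) (rmul x u)
      = contract t (sorted_list_of_set (supp u \<inter> {t..})) (\<lambda>_. \<one>) u"
    using False assms by (intro contract_cong) (auto simp: rmul_def wordsD)
  ultimately have "head t (rmul x u) = head t u" by (simp add: head_def)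
  then show ?thesis using False assms by (auto simp: push_def rmul_def fun_eq_iff)
qed

definition delay :: "real \<Rightarrow> (real \<Rightarrow> 'a) \<Rightarrow> real \<Rightarrow> 'a" where
  "delay r u s = (if s < r then \<one> else u (s - r))"

lemma supp_delay: "r \<ge> 0 \<Longrightarrow> supp (delay r u) = (+) r ` supp u"
proof -
  assume "r \<ge> 0"
  then have "s \<in> supp (delay r u) \<longleftrightarrow> s - r \<in> supp u" for s by (auto simp: supp_def delay_def)
  moreover have "s \<in> (+) r ` supp u \<longleftrightarrow> s - r \<in> supp u" for s by (auto simp: image_iff intro!: bexI[of _ "s - r"])
  ultimately show ?thesis by auto
qed

lemma contract_delay:
  "(\<And>s. s \<in> set ts \<Longrightarrow> s \<ge> 0) \<Longrightarrow> contract (r + t) (map ((+) r) ts) (\<lambda>_. \<one>) (delay r u) = contract t ts (\<lambda>_. \<one>) u"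
proof (induction ts arbitrary: t)
  case (Cons s ts)
  have "delay r u (r + s) = u s" using Cons.prems[of s] by (simp add: delay_def)
  then show ?case using Cons by simp
qed simp

lemma sorted_list_translate: "finite F \<Longrightarrow> sorted_list_of_set ((+) (r::real) ` F) = map ((+) r) (sorted_list_of_set F)"
  using sorted_list_of_set.idem_if_sorted_distinct[of "map ((+) r) (sorted_list_of_set F)"]
  by (simp add: sorted_map distinct_map)

lemma head_delay:
  assumes "u \<in> words" "r \<ge> 0" "t \<ge> 0" shows "head (r + t) (delay r u) = head t u"
proof -
  have "supp (delay r u) \<inter> {r + t..} = (+) r ` (supp u \<inter> {t..})"
    using assms by (auto simp: supp_delay)
  then show ?thesis
    using assms unfolding head_def
    by (simp add: sorted_list_translate wordsD) (intro contract_delay, auto simp: wordsD)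
qed

lemma push_delay:
  "u \<in> words \<Longrightarrow> r \<ge> 0 \<Longrightarrow> t \<ge> 0 \<Longrightarrow> push (r + t) a (delay r u) = delay r (push t a u)"
  by (auto simp: push_def head_delay delay_def fun_eq_iff)

text \<open>Only the last step changes, from \<open>\<phi> t\<close> to
  \<open>\<phi> (r + t)\<close> with \<open>t\<close> the least time; the semigroup law splits off
  \<open>\<phi> r\<close>. With empty support the claim is unitality.\<close>

lemma pairing_delay:
  assumes u: "u \<in> words" and r: "r \<ge> 0"
  shows "pairing (\<lambda>_. \<one>) (delay r u) = \<phi> r (pairing (\<lambda>_. \<one>) u)"
proof -
  let ?ts = "sorted_list_of_set (supp u)"
  have s: "sorted (0 # ?ts)" using wordsD(2)[OF u] by (intro sorted_list_Cons) (auto simp: supp_def)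
  have "pairing (\<lambda>_. \<one>) (delay r u) = contract 0 (map ((+) r) ?ts) (\<lambda>_. \<one>) (delay r u)"
    using u r by (simp add: pairing_def supp_delay sorted_list_translate wordsD)
  also have "\<dots> = \<phi> r (contract 0 ?ts (\<lambda>_. \<one>) u)"
  proof (cases ?ts)
    case (Cons t ts)
    have "contract (r + t) (map ((+) r) ts) (\<lambda>_. \<one>) (delay r u) = contract t ts (\<lambda>_. \<one>) u"
      using s by (intro contract_delay) (auto simp: Cons)
    then show ?thesis using s u r by (simp add: Cons delay_def \<phi>_\<phi> wordsD)
  qed (use r in \<open>simp add: \<phi>_cp\<close>)
  finally show ?thesis by (simp add: pairing_def)
qed

definition vmap :: "((real \<Rightarrow> 'a) \<Rightarrow> real \<Rightarrow> 'a) \<Rightarrow> 'a flow_vec \<Rightarrow> 'a flow_vec" where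
  "vmap f = map (\<lambda>(k, u, x). (k, f u, x))"

lemma vmap_simps [simp]:
  "vmap f [] = []" "vmap f ((k, u, x) # v) = (k, f u, x) # vmap f v" "vmap f (v @ w) = vmap f v @ vmap f w"
  "vmap f (vscale c v) = vscale c (vmap f v)"
  by (auto simp: vmap_def vscale_def)

lemma act_rmul: "exprs e \<Longrightarrow> x \<in> S \<Longrightarrow> v \<in> vecs \<Longrightarrow> act e (vmap (rmul x) v) = vmap (rmul x) (act e v)"
proof (induction e arbitrary: v)
  case (Gen a t)
  from \<open>v \<in> vecs\<close> Gen show ?case by (induction v) (auto simp: push_rmul)
qed auto

text \<open>Delaying words intertwines an expression with its shift. It yields no norm estimate, as
  it need not preserve \<open>vip\<close> when \<open>\<omega>\<close> is not invariant under
  \<open>\<phi>\<close>.\<close>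

lemma act_delay: "exprs e \<Longrightarrow> r \<ge> 0 \<Longrightarrow> v \<in> vecs \<Longrightarrow> act (shift r e) (vmap (delay r) v) = vmap (delay r) (act e v)"
proof (induction e arbitrary: v)
  case (Gen a t)
  from \<open>v \<in> vecs\<close> Gen show ?case by (induction v) (auto simp: push_delay)
qed auto

definition vac :: "'a flow_vec" where
  "vac = [(1, \<lambda>_. \<one>, \<one>)]"

text \<open>The algebra-valued inner product with the vacuum: \<open>\<omega>\<close> is applied to
  the GNS component only.\<close>

primrec vexp :: "'a flow_vec \<Rightarrow> 'a" where
  "vexp [] = \<zero>"
| "vexp (p # v) = (fst p * \<omega> (snd (snd p))) \<odot> pairing (\<lambda>_. \<one>) (fst (snd p)) \<oplus> vexp v"

definition expect :: "'a gen_expr \<Rightarrow> 'a" where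
  "expect e = vexp (act e vac)"

lemma vac_vecs [simp]: "vac \<in> vecs"
  by (simp add: vac_def)

lemma vexp_closed [simp]: "v \<in> vecs \<Longrightarrow> vexp v \<in> S"
  by (induction v) auto

lemma expect_closed [simp]: "exprs e \<Longrightarrow> expect e \<in> S"
  by (simp add: expect_def)

lemma vexp_append: "v \<in> vecs \<Longrightarrow> w \<in> vecs \<Longrightarrow> vexp (v @ w) = vexp v \<oplus> vexp w"
  by (induction v) (auto simp: add_assoc)

lemma vexp_scale: "v \<in> vecs \<Longrightarrow> vexp (vscale c v) = c \<odot> vexp v"
  by (induction v) (auto simp: vscale_def smult_add_right mult.assoc)

lemma expect_Plus: "exprs e \<Longrightarrow> exprs f \<Longrightarrow> expect (Plus e f) = expect e \<oplus> expect f"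
  by (simp add: expect_def vexp_append)

lemma expect_Scale: "exprs e \<Longrightarrow> expect (Scale c e) = c \<odot> expect e"
  by (simp add: expect_def vexp_scale)

lemma vexp_delay: "v \<in> vecs \<Longrightarrow> r \<ge> 0 \<Longrightarrow> vexp (vmap (delay r) v) = \<phi> r (vexp v)"
proof (induction v)
  case Nil
  then show ?case using \<phi>_smult[of r \<zero> 0] by simp
qed (auto simp: pairing_delay \<phi>_add \<phi>_smult)

text \<open>Covariance on expressions: \<open>delay\<close> fixes the vacuum, and the vacuum
  expectation of a delayed vector is \<open>\<phi> r\<close> of the original one.\<close>

lemma expect_shift: "exprs e \<Longrightarrow> r \<ge> 0 \<Longrightarrow> expect (shift r e) = \<phi> r (expect e)"
proof -
  assume *: "exprs e" "r \<ge> 0"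
  have "vmap (delay r) vac = vac" by (simp add: vac_def delay_def fun_eq_iff)
  then show ?thesis using act_delay[OF * vac_vecs] * by (simp add: expect_def flip: vexp_delay)
qed

lemma pairing_one [simp]: "pairing (\<lambda>_. \<one>) (\<lambda>_. \<one>) = \<one>"
  by (simp add: pairing_def)

text \<open>The vacuum lies in the range of \<open>p\<^sub>0\<close>, so the summand with
  \<open>1 - p\<^sub>0\<close> contributes \<open>\<omega> a - \<omega> a\<close>, and only
  \<open>j\<^sub>0(a)\<close> remains.\<close>

lemma expect_Gen:
  assumes "a \<in> S" shows "expect (Gen a 0) = a"
proof -
  have "head 0 (\<lambda>_. \<one>) = \<one>" by (simp add: head_zero)
  then have p: "push 0 b (\<lambda>_. \<one>) = rmul b (\<lambda>_. \<one>)" if "b \<in> S" for b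
    using that by (auto simp: push_def rmul_def fun_eq_iff supp_def)
  have "pairing (\<lambda>_. \<one>) (push 0 b (\<lambda>_. \<one>)) = b" if "b \<in> S" for b
    using pairing_rmul[of "\<lambda>_. \<one>" "\<lambda>_. \<one>" b \<one>] that by (simp add: p)
  then show ?thesis
    using assms by (intro lin_eqI) (auto simp: expect_def vac_def lin_simps)
qed

text \<open>An isometric copy of the GNS space: the vacuum multiplied by \<open>x\<close> from the
  right.\<close>

definition vec :: "'a \<Rightarrow> 'a flow_vec" where
  "vec x = [(1, rmul x (\<lambda>_. \<one>), \<one>)]"

lemma vec_vecs [simp]: "x \<in> S \<Longrightarrow> vec x \<in> vecs"
  by (simp add: vec_def)

lemma vip_vec_rmul:
  assumes "v \<in> vecs" "x \<in> S" "y \<in> S"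
  shows "vip (vec y) (vmap (rmul x) v) = \<omega> (y\<^sup>\<star> \<otimes> (vexp v \<otimes> x))"
  using assms(1)
proof (induction v)
  case Nil
  then show ?case using assms by (simp add: \<omega>_simps)
next
  case (Cons q v)
  obtain k u z where q: "q = (k, u, z)" by (metis prod_cases3)
  have "vip (vec y) [(k, rmul x u, z)] = \<omega> (y\<^sup>\<star> \<otimes> (((k * \<omega> z) \<odot> pairing (\<lambda>_. \<one>) u) \<otimes> x))"
    using Cons.prems assms
    by (auto simp: q vec_def vip_single kernel_def pairing_rmul \<omega>_simps smult_mult_left smult_mult_right)
  then show ?case
    using Cons assms
    by (auto simp: q vip_Cons(2)[of _ _ "vmap _ _"] distrib_left distrib_right \<omega>_simps)
qed

text \<open>The expectation is the compression to the copy \<open>vec\<close> of the GNS space,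
  because right multiplication passes through \<open>act e\<close>. Norm, adjoint and positivity of
  \<open>expect\<close> rest on this.\<close>

lemma \<omega>_expect:
  assumes "exprs e" "x \<in> S" "y \<in> S"
  shows "\<omega> (y\<^sup>\<star> \<otimes> (expect e \<otimes> x)) = vip (vec y) (act e (vec x))"
proof -
  have "vec x = vmap (rmul x) vac" by (simp add: vec_def vac_def)
  then show ?thesis
    using act_rmul[OF assms(1,2) vac_vecs] vip_vec_rmul[of "act e vac" x y] assms by (simp add: expect_def)
qed

lemma vnorm_vec: "x \<in> S \<Longrightarrow> flow.vnorm (vec x) = gns.vnorm x"
  using pairing_rmul[of "\<lambda>_. \<one>" "\<lambda>_. \<one>" x x]
  by (simp add: flow.vnorm_def gns.vnorm_def vec_def vip_single kernel_def)

text \<open>Compression does not increase norms: index 0 and the vectors \<open>vec ?z\<close> and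
  \<open>vec y\<close> suffice, and \<open>norm_le_if_gns_bounded\<close> turns the estimate on
  vectors into one on the norm.\<close>

lemma expect_norm_le:
  assumes e: "exprs e" shows "\<parallel>expect e\<parallel> \<le> supnorm (flow.coeff e)"
proof (rule norm_le_if_gns_bounded)
  show nn: "0 \<le> supnorm (flow.coeff e)" using e by (simp add: supnorm_nonneg flow.bounded_coeff)
  fix y assume y: "y \<in> S"
  let ?z = "expect e \<otimes> y"
  have z: "?z \<in> S" using e y by simp
  show "gns.vnorm ?z \<le> supnorm (flow.coeff e) * gns.vnorm y"
  proof (cases "gns.vnorm ?z = 0")
    case True
    then show ?thesis using y nn by simp
  next
    case False
    then have p: "gns.vnorm ?z > 0" using z gns.vnorm_nonneg[of ?z] by linarith
    have "gns.vnorm ?z * gns.vnorm ?z = cmod (\<omega> (?z\<^sup>\<star> \<otimes> ?z))"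
      using gns.ip_self[OF z] by (simp add: power2_eq_square Real_Vector_Spaces.norm_mult)
    also have "\<dots> \<le> supnorm (flow.coeff e) * (gns.vnorm ?z * gns.vnorm y)"
      using flow.cmod_ip_le[of 0 e "vec ?z" "vec y"] e y z \<omega>_expect[OF e y z] by (simp add: vnorm_vec)
    finally show ?thesis using p by (simp add: mult_ac)
  qed
qed (use e in simp)

lemma expect_adj: "exprs e \<Longrightarrow> expect (adj e) = (expect e)\<^sup>\<star>"
proof (rule eq_if_\<omega>_sandwich_eq)
  fix x assume e: "exprs e" and x: "x \<in> S"
  have "\<omega> (x\<^sup>\<star> \<otimes> (expect (adj e) \<otimes> \<one>)) = vip (act e (vec x)) (vec \<one>)"
    using e x by (subst \<omega>_expect) (auto simp: act_adj)
  also have "\<dots> = cnj (vip (vec \<one>) (act e (vec x)))"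
    using e x by (intro vip_cnj) auto
  also have "\<dots> = cnj (\<omega> (\<one>\<^sup>\<star> \<otimes> (expect e \<otimes> x)))"
    using e x by (subst \<omega>_expect) auto
  also have "\<dots> = \<omega> ((expect e \<otimes> x)\<^sup>\<star> \<otimes> \<one>)"
    using e x \<omega>_star_mult[of "expect e \<otimes> x" \<one>] by simp
  also have "\<dots> = \<omega> (x\<^sup>\<star> \<otimes> ((expect e)\<^sup>\<star> \<otimes> \<one>))"
    using e x by (simp add: star_mult mult_assoc)
  finally show "\<omega> (x\<^sup>\<star> \<otimes> (expect (adj e) \<otimes> \<one>)) = \<omega> (x\<^sup>\<star> \<otimes> ((expect e)\<^sup>\<star> \<otimes> \<one>))" .
qed auto

lemma vip_sum_nonneg:
  fixes n :: nat
  assumes "\<And>i. i < n \<Longrightarrow> f i \<in> vecs"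
  shows "0 \<le> Re (\<Sum>i<n. \<Sum>j<n. vip (f i) (f j))"
proof -
  \<comment> \<open>The double sum is the square norm of the concatenation of all
    \<open>f i\<close>.\<close>
  let ?z = "\<lambda>n. concat (map f [0..<n])"
  have l: "vip (?z n) w = (\<Sum>i<n. vip (f i) w)" for w n by (induction n) (auto simp: vip_append)
  have r: "vip w (?z n) = (\<Sum>i<n. vip w (f i))" for w n by (induction n) (auto simp: vip_append)
  have "?z n \<in> vecs" using assms by (induction n) auto
  moreover have "vip (?z n) (?z n) = (\<Sum>i<n. \<Sum>j<n. vip (f i) (f j))" by (subst l) (simp only: r)
  ultimately show ?thesis using vip_pos[of "?z n"] by simp
qed

text \<open>For each \<open>k\<close> the double sum over \<open>i\<close> and \<open>j\<close> is
  the square norm of the sum over \<open>i\<close> of \<open>x k i\<close> acting on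
  \<open>vec (y i)\<close>.\<close>

lemma expect_square_nonneg:
  assumes x: "\<And>i k. i < n \<Longrightarrow> k < n \<Longrightarrow> exprs (x k i)" and y: "\<And>i. i < n \<Longrightarrow> y i \<in> S"
  shows "0 \<le> Re (\<Sum>i<n. \<Sum>j<n. \<omega> ((y i)\<^sup>\<star> \<otimes> (cs_sum A n (\<lambda>k. expect (Times (adj (x k i)) (x k j))) \<otimes> y j)))"
proof -
  have "(\<Sum>i<n. \<Sum>j<n. \<omega> ((y i)\<^sup>\<star> \<otimes> (cs_sum A n (\<lambda>k. expect (Times (adj (x k i)) (x k j))) \<otimes> y j)))
      = (\<Sum>i<n. \<Sum>j<n. \<Sum>k<n. vip (act (x k i) (vec (y i))) (act (x k j) (vec (y j))))"
    using x y by (intro sum.cong refl, subst lin_cs_sum[OF lin_sandwich[OF lin_\<omega>]])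
      (auto simp: \<omega>_expect act_adj)
  also have "\<dots> = (\<Sum>k<n. \<Sum>i<n. \<Sum>j<n. vip (act (x k i) (vec (y i))) (act (x k j) (vec (y j))))"
    by (subst (2) sum.swap, subst sum.swap) simp
  also have "Re \<dots> = (\<Sum>k<n. Re (\<Sum>i<n. \<Sum>j<n. vip (act (x k i) (vec (y i))) (act (x k j) (vec (y j)))))"
    by (rule Re_sum)
  also have "\<dots> \<ge> 0" using x y by (intro sum_nonneg vip_sum_nonneg) auto
  finally show ?thesis .
qed

end

section \<open>The dilation\<close>

context cp_flow
begin

abbreviation dil :: "(real \<times> 'a flow_vec \<times> 'a flow_vec \<Rightarrow> complex) cstar_alg" where
  "dil \<equiv> flow.completion"

definition embed :: "'a \<Rightarrow> real \<times> 'a flow_vec \<times> 'a flow_vec \<Rightarrow> complex" where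
  "embed a = flow.coeff (Gen a 0)"

text \<open>The value 0 at negative \<open>s\<close> repeats the default of \<open>coeff\<close>;
  without it, \<open>s + r\<close> could be nonnegative there and give another value.\<close>

definition dshift :: "real \<Rightarrow> (real \<times> 'a flow_vec \<times> 'a flow_vec \<Rightarrow> complex)
    \<Rightarrow> real \<times> 'a flow_vec \<times> 'a flow_vec \<Rightarrow> complex" where
  "dshift r F = (\<lambda>(s, v, w). if s \<ge> 0 then F (s + r, v, w) else 0)"

text \<open>The continuous extension of \<open>expect\<close> to limits;
  \<open>expect_approx_close\<close> makes it independent of the sequence.\<close>

definition dexp :: "(real \<times> 'a flow_vec \<times> 'a flow_vec \<Rightarrow> complex) \<Rightarrow> 'a" where
  "dexp F = (SOME a. a \<in> S \<and> (\<exists>x. flow.approx x F \<and> conv (\<lambda>n. expect (x n)) a))"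

lemma approx_exprs: "flow.approx x F \<Longrightarrow> exprs (x n)"
  using flow.approx_W by blast

lemma expect_diff_le:
  assumes e: "exprs e" and f: "exprs f" and c: "\<And>i. cmod (flow.coeff e i - flow.coeff f i) \<le> c"
  shows "\<parallel>expect e \<ominus> expect f\<parallel> \<le> c"
proof -
  have "\<parallel>expect (Plus e (Scale (-1) f))\<parallel> \<le> supnorm (flow.coeff (Plus e (Scale (-1) f)))"
    using e f by (intro expect_norm_le) simp
  also have "\<dots> \<le> c"
    using e f c flow.\<Phi>_add[of e "Scale (-1) f"] flow.\<Phi>_sm[of f "-1"] by (intro supnorm_le) simp
  finally show ?thesis using e f by (simp add: expect_Plus expect_Scale cs_sub_def)
qed

lemma expect_approx_close:
  assumes "flow.approx x F" "flow.approx y F" "e > 0"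
  shows "\<exists>N. \<forall>m\<ge>N. \<forall>n\<ge>N. \<parallel>expect (x m) \<ominus> expect (y n)\<parallel> < e"
proof -
  obtain N where N: "\<And>n i. n \<ge> N \<Longrightarrow> cmod (flow.coeff (x n) i - F i) < e/4"
    using flow.approxD[OF assms(1), of "e/4"] assms(3) by auto
  obtain M where M: "\<And>n i. n \<ge> M \<Longrightarrow> cmod (flow.coeff (y n) i - F i) < e/4"
    using flow.approxD[OF assms(2), of "e/4"] assms(3) by auto
  have "\<parallel>expect (x m) \<ominus> expect (y n)\<parallel> < e" if "m \<ge> max M N" "n \<ge> max M N" for m n
  proof -
    have "\<parallel>expect (x m) \<ominus> expect (y n)\<parallel> \<le> e/2"
    proof (rule expect_diff_le)
      fix i
      show "cmod (flow.coeff (x m) i - flow.coeff (y n) i) \<le> e/2"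
        using N[of m i] M[of n i] that
          norm_triangle_ineq4[of "flow.coeff (x m) i - F i" "flow.coeff (y n) i - F i"] by simp
    qed (use assms approx_exprs in blast)+
    then show ?thesis using assms(3) by simp
  qed
  then show ?thesis by blast
qed

lemma dexp_conv:
  assumes x: "flow.approx x F"
  shows "dexp F \<in> S" "conv (\<lambda>n. expect (x n)) (dexp F)"
proof -
  have "\<exists>a\<in>S. conv (\<lambda>n. expect (x n)) a"
    by (rule complete) (use approx_exprs[OF x] expect_approx_close[OF x x] in auto)
  then have "\<exists>a. a \<in> S \<and> (\<exists>x. flow.approx x F \<and> conv (\<lambda>n. expect (x n)) a)" using x by blast
  from someI_ex[OF this] obtain y where S: "dexp F \<in> S" and y: "flow.approx y F" "conv (\<lambda>n. expect (y n)) (dexp F)"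
    unfolding dexp_def by blast
  show "dexp F \<in> S" by fact
  have xy: "expect (x n) \<in> S" "expect (y n) \<in> S" for n using approx_exprs x y by auto
  show "conv (\<lambda>n. expect (x n)) (dexp F)"
  proof (rule conv_le)
    have "(\<lambda>n. \<parallel>expect (x n) \<ominus> expect (y n)\<parallel>) \<longlonglongrightarrow> 0"
      using expect_approx_close[OF x y(1)] xy by (fastforce intro!: LIMSEQ_I)
    then show "(\<lambda>n. \<parallel>expect (x n) \<ominus> expect (y n)\<parallel> + \<parallel>expect (y n) \<ominus> dexp F\<parallel>) \<longlonglongrightarrow> 0"
      using tendsto_add[OF _ y(2)[unfolded conv_def]] by fastforce
  qed (use xy S in \<open>auto intro: norm_sub_triangle\<close>)
qed

lemma dexp_eqI:
  assumes "flow.approx x F" "a \<in> S" "conv (\<lambda>n. expect (x n)) a"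
  shows "dexp F = a"
  using conv_unique[OF _ dexp_conv(1)[OF assms(1)] assms(2) dexp_conv(2)[OF assms(1)] assms(3)]
    approx_exprs[OF assms(1)] by simp

lemma dexp_embed: "a \<in> S \<Longrightarrow> dexp (embed a) = a"
  unfolding embed_def by (rule dexp_eqI[OF flow.approx_const]) (simp_all add: expect_Gen conv_const)

lemma dexp_linear: "linear_map dil A dexp"
  unfolding linear_map_def flow.completion_simps
proof (intro conjI ballI allI)
  fix F G and c :: complex assume "F \<in> flow.carrier"
  then obtain x where x: "flow.approx x F" by (rule flow.carrier_approx)
  note X = dexp_conv[OF x] approx_exprs[OF x]
  show "dexp F \<in> S" by fact
  show "dexp (\<lambda>i. c * F i) = c \<odot> dexp F"
    by (rule dexp_eqI[OF flow.approx_sm[OF x]]) (use X in \<open>simp_all add: expect_Scale conv_smult\<close>)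
  assume "G \<in> flow.carrier"
  then obtain y where y: "flow.approx y G" by (rule flow.carrier_approx)
  note Y = dexp_conv[OF y] approx_exprs[OF y]
  show "dexp (\<lambda>i. F i + G i) = dexp F \<oplus> dexp G"
    by (rule dexp_eqI[OF flow.approx_add[OF x y]]) (use X Y in \<open>simp_all add: expect_Plus conv_add\<close>)
qed

lemma coeff_shift:
  "r \<ge> 0 \<Longrightarrow> flow.coeff (shift r e) (s, v, w) = (if s \<ge> 0 then flow.coeff e (s + r, v, w) else 0)"
  by (simp add: flow.coeff_def)

lemma approx_shift:
  assumes x: "flow.approx x F" and r: "r \<ge> 0"
  shows "flow.approx (\<lambda>n. shift r (x n)) (dshift r F)"
proof (rule flow.approxI)
  fix e :: real assume e: "e > 0"
  obtain N where N: "\<And>n i. n \<ge> N \<Longrightarrow> cmod (flow.coeff (x n) i - F i) < e"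
    using flow.approxD[OF x e] by blast
  have "cmod (flow.coeff (shift r (x n)) i - dshift r F i) < e" if "n \<ge> N" for n i
    using N[OF that] e r by (cases i) (auto simp: coeff_shift dshift_def)
  then show "\<exists>N. \<forall>n\<ge>N. \<forall>i. cmod (flow.coeff (shift r (x n)) i - dshift r F i) < e" by blast
qed (use approx_exprs[OF x] r in simp)

lemma dexp_dshift:
  assumes "F \<in> flow.carrier" "r \<ge> 0" shows "dexp (dshift r F) = \<phi> r (dexp F)"
proof -
  obtain x where x: "flow.approx x F" using assms(1) by (rule flow.carrier_approx)
  note X = dexp_conv[OF x] approx_exprs[OF x]
  show ?thesis
    by (rule dexp_eqI[OF approx_shift[OF x assms(2)]]) (use X assms in \<open>simp_all add: expect_shift \<phi>_conv\<close>)
qed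

text \<open>The generator of \<open>\<one>\<close> acts as the identity up to null vectors at every
  time; this makes the shift unital.\<close>

lemma coeff_Gen_one: "t \<ge> 0 \<Longrightarrow> flow.coeff (Gen \<one> t) = flow.coeff (Gen \<one> 0)"
  by (rule flow.coeff_cong) (use gact_one in \<open>simp add: same_def\<close>)

lemma dshift_hom:
  assumes r: "r \<ge> 0" shows "unital_star_hom dil dil (dshift r)"
  unfolding unital_star_hom_def linear_map_def flow.completion_simps
proof (intro conjI ballI allI)
  fix F G and c :: complex assume "F \<in> flow.carrier"
  then obtain x where x: "flow.approx x F" by (rule flow.carrier_approx)
  show "dshift r F \<in> flow.carrier" using flow.approx_carrier[OF approx_shift[OF x r]] .
  show "dshift r (\<lambda>i. c * F i) = (\<lambda>i. c * dshift r F i)" by (auto simp: dshift_def fun_eq_iff)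
  show "dshift r (\<lambda>i. cnj (F (flow.flip i))) = (\<lambda>i. cnj (dshift r F (flow.flip i)))"
    by (auto simp: dshift_def fun_eq_iff flow.flip_def)
  show "dshift r (\<lambda>i. F i + G i) = (\<lambda>i. dshift r F i + dshift r G i)" by (auto simp: dshift_def fun_eq_iff)
  assume "G \<in> flow.carrier"
  then obtain y where y: "flow.approx y G" by (rule flow.carrier_approx)
  show "dshift r (flow.mulC F G) = flow.mulC (dshift r F) (dshift r G)"
    by (rule flow.approx_unique[OF approx_shift[OF flow.approx_mul[OF x y] r]
          flow.approx_mul[OF approx_shift[OF x r] approx_shift[OF y r]]]) simp
next
  show "dshift r (flow.coeff (Gen \<one> 0)) = flow.coeff (Gen \<one> 0)"
    by (rule flow.approx_unique[OF approx_shift[OF flow.approx_const r] flow.approx_const])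
      (use coeff_Gen_one[OF r] in simp_all)
qed

lemma dshift_e0: "e0_semigroup dil dshift"
  unfolding e0_semigroup_def flow.completion_simps
proof (intro conjI ballI allI impI)
  fix F assume "F \<in> flow.carrier"
  then obtain x where x: "flow.approx x F" by (rule flow.carrier_approx)
  show "dshift 0 F = F" by (rule flow.approx_unique[OF approx_shift[OF x] x]) simp_all
  fix s t :: real assume s: "s \<ge> 0" and t: "t \<ge> 0"
  then have st: "s + t \<ge> 0" by simp
  show "dshift s (dshift t F) = dshift (s + t) F"
    by (rule flow.approx_unique[OF approx_shift[OF approx_shift[OF x t] s] approx_shift[OF x st]]) simp
qed (rule dshift_hom)

lemma embed_hom: "unital_star_hom A dil embed"
  unfolding unital_star_hom_def linear_map_def flow.completion_simps embed_def
proof (intro conjI ballI allI)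
  fix a b and c :: complex assume a: "a \<in> S"
  then have ea: "Gen a 0 \<in> Collect exprs" by simp
  show "flow.coeff (Gen a 0) \<in> flow.carrier" using flow.approx_carrier[OF flow.approx_const[OF ea]] .
  have "flow.coeff (Gen (c \<odot> a) 0) = flow.coeff (Scale c (Gen a 0))"
    by (rule flow.coeff_cong) (use gact_linear(2)[OF a a] in \<open>simp add: same_def\<close>)
  then show "flow.coeff (Gen (c \<odot> a) 0) = (\<lambda>i. c * flow.coeff (Gen a 0) i)"
    using flow.\<Phi>_sm[OF ea] by (simp add: fun_eq_iff)
  have "flow.coeff (Gen (a\<^sup>\<star>) 0) = flow.coeff (adj (Gen a 0))" by simp
  then show "flow.coeff (Gen (a\<^sup>\<star>) 0) = (\<lambda>i. cnj (flow.coeff (Gen a 0) (flow.flip i)))"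
    using flow.\<Phi>_st[OF ea] by (simp add: fun_eq_iff)
  assume b: "b \<in> S"
  then have eb: "Gen b 0 \<in> Collect exprs" by simp
  have "flow.coeff (Gen (a \<oplus> b) 0) = flow.coeff (Plus (Gen a 0) (Gen b 0))"
    by (rule flow.coeff_cong) (use gact_linear(1)[OF a b] in \<open>simp add: same_def\<close>)
  then show "flow.coeff (Gen (a \<oplus> b) 0) = (\<lambda>i. flow.coeff (Gen a 0) i + flow.coeff (Gen b 0) i)"
    using flow.\<Phi>_add[OF ea eb] by (simp add: fun_eq_iff)
  have "flow.coeff (Gen (a \<otimes> b) 0) = flow.coeff (Times (Gen a 0) (Gen b 0))"
    by (rule flow.coeff_cong) (use gact_mult[OF a b] in \<open>simp add: same_def\<close>)
  then show "flow.coeff (Gen (a \<otimes> b) 0) = flow.mulC (flow.coeff (Gen a 0)) (flow.coeff (Gen b 0))"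
    using flow.\<Phi>_mulC[OF ea eb] by simp
qed simp

lemma embed_inj: "inj_on embed S"
  by (metis dexp_embed inj_onI)

text \<open>The grammar has no zero, so the empty sum is a multiple by 0.\<close>

primrec expr_sum :: "nat \<Rightarrow> (nat \<Rightarrow> 'a gen_expr) \<Rightarrow> 'a gen_expr" where
  "expr_sum 0 f = Scale 0 (Gen \<one> 0)"
| "expr_sum (Suc n) f = Plus (expr_sum n f) (f n)"

lemma exprs_expr_sum [simp]: "(\<And>k. k < n \<Longrightarrow> exprs (f k)) \<Longrightarrow> exprs (expr_sum n f)"
  by (induction n) auto

lemma expect_expr_sum: "(\<And>k. k < n \<Longrightarrow> exprs (f k)) \<Longrightarrow> expect (expr_sum n f) = cs_sum A n (\<lambda>k. expect (f k))"
  by (induction n) (auto simp: expect_Plus expect_Scale expect_Gen)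

lemma approx_expr_sum:
  "(\<And>k. k < n \<Longrightarrow> flow.approx (x k) (F k)) \<Longrightarrow> flow.approx (\<lambda>m. expr_sum n (\<lambda>k. x k m)) (cs_sum dil n F)"
proof (induction n)
  case 0
  show ?case using flow.approx_sm[OF flow.approx_const[of "Gen \<one> 0"], of 0] by simp
next
  case (Suc n)
  then show ?case using flow.approx_add[of "\<lambda>m. expr_sum n (\<lambda>k. x k m)" "cs_sum dil n F" "x n" "F n"] by simp
qed

lemma adj_adj: "exprs e \<Longrightarrow> adj (adj e) = e"
  by (induction e) auto

text \<open>Expressions approximating the entries of a factor \<open>X\<close> give approximants
  \<open>G\<close> whose quadratic forms are nonnegative. Factorisations of the \<open>G\<close>
  need not converge, but the criterion \<open>mat_posI\<close> survives the limit.\<close>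

theorem dexp_cp: "cp_map dil A dexp"
  unfolding cp_map_def
proof (intro conjI allI impI dexp_linear)
  fix n M assume "mat_pos dil n M"
  then obtain X where X: "\<And>i j. i < n \<Longrightarrow> j < n \<Longrightarrow> X i j \<in> cs_carrier dil"
    and MX: "\<And>i j. i < n \<Longrightarrow> j < n \<Longrightarrow> M i j = cs_sum dil n (\<lambda>k. cs_mult dil (cs_star dil (X k i)) (X k j))"
    by (rule mat_posE) blast
  have "\<exists>x. flow.approx x (X k i)" if "k < n" "i < n" for k i
    using X[OF that] by (auto elim: flow.carrier_approx)
  then obtain x where x: "\<And>k i. k < n \<Longrightarrow> i < n \<Longrightarrow> flow.approx (x k i) (X k i)" by metis
  have xe: "exprs (x k i m)" if "k < n" "i < n" for k i m using approx_exprs[OF x[OF that]] .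
  define G where "G i j m = cs_sum A n (\<lambda>k. expect (Times (adj (x k i m)) (x k j m)))" for i j m
  have GS: "G i j m \<in> S" if "i < n" "j < n" for i j m using that xe by (simp add: G_def)
  have G: "dexp (M i j) \<in> S" "conv (G i j) (dexp (M i j))" if "i < n" "j < n" for i j
  proof -
    have a: "flow.approx (\<lambda>m. expr_sum n (\<lambda>k. Times (adj (x k i m)) (x k j m))) (M i j)"
      unfolding MX[OF that] using that x
      by (intro approx_expr_sum) (simp add: flow.approx_mul flow.approx_st)
    show "dexp (M i j) \<in> S" by (rule dexp_conv[OF a])
    have "(\<lambda>m. expect (expr_sum n (\<lambda>k. Times (adj (x k i m)) (x k j m)))) = G i j"
      using that xe by (simp add: fun_eq_iff G_def expect_expr_sum)
    then show "conv (G i j) (dexp (M i j))" using dexp_conv(2)[OF a] by simp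
  qed
  show "mat_pos A n (\<lambda>i j. dexp (M i j))"
  proof (rule mat_posI)
    show "(\<lambda>i j. dexp (M i j)) \<in> mats n" using G by (simp add: mats_def)
    fix i j assume ij: "i < n" "j < n"
    have "(G j i m)\<^sup>\<star> = G i j m" for m
    proof -
      have "(G j i m)\<^sup>\<star> = cs_sum A n (\<lambda>k. (expect (Times (adj (x k j m)) (x k i m)))\<^sup>\<star>)"
        unfolding G_def using ij xe by (intro star_cs_sum) simp
      also have "\<dots> = G i j m"
        unfolding G_def using ij xe by (intro cs_sum_cong) (simp add: adj_adj flip: expect_adj)
      finally show ?thesis .
    qed
    then have "conv (G i j) ((dexp (M j i))\<^sup>\<star>)"
      using conv_star[OF GS[OF ij(2,1)] G[OF ij(2,1)]] by simp
    then show "(dexp (M j i))\<^sup>\<star> = dexp (M i j)"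
      using conv_unique[OF GS[OF ij] _ G(1)[OF ij] _ G(2)[OF ij]] G(1)[OF ij(2,1)] by simp
  next
    fix v assume v: "v \<in> mat_vecs n"
    have "(\<lambda>m. Re (\<Sum>i<n. \<Sum>j<n. \<omega> ((v i)\<^sup>\<star> \<otimes> (G i j m \<otimes> v j))))
        \<longlonglongrightarrow> Re (\<Sum>i<n. \<Sum>j<n. \<omega> ((v i)\<^sup>\<star> \<otimes> (dexp (M i j) \<otimes> v j)))"
      using G GS mat_vecsD[OF v] by (intro tendsto_Re tendsto_sum \<omega>_sandwich_limit) auto
    moreover have "0 \<le> Re (\<Sum>i<n. \<Sum>j<n. \<omega> ((v i)\<^sup>\<star> \<otimes> (G i j m \<otimes> v j)))" for m
      unfolding G_def using xe mat_vecsD[OF v] by (intro expect_square_nonneg) auto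
    ultimately show "0 \<le> Re (\<Sum>i<n. \<Sum>j<n. \<omega> ((v i)\<^sup>\<star> \<otimes> (dexp (M i j) \<otimes> v j)))"
      by (intro LIMSEQ_le_const) auto
  qed
qed

end

section \<open>Transport of the dilating algebra\<close>

text \<open>Expressions are written in prefix notation over the alphabet \<open>'a \<times> real\<close>; the real
  components \<open>0\<close> to \<open>3\<close> encode the constructors.\<close>

primrec expr_tokens :: "'a gen_expr \<Rightarrow> ('a \<times> real) list" where
  "expr_tokens (Gen a t) = [(undefined, 0), (a, t)]"
| "expr_tokens (Plus e f) = (undefined, 1) # expr_tokens e @ expr_tokens f"
| "expr_tokens (Times e f) = (undefined, 2) # expr_tokens e @ expr_tokens f"
| "expr_tokens (Scale c e) = (undefined, 3) # (undefined, Re c) # (undefined, Im c) # expr_tokens e"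

text \<open>The leading tag fixes the constructor and thereby the number of parts to follow, so a
  token string determines where its expression ends.\<close>

lemma expr_tokens_prefix_free: "expr_tokens e @ xs = expr_tokens f @ ys \<Longrightarrow> e = f \<and> xs = ys"
proof (induction e arbitrary: f xs ys)
  case (Gen a t)
  then show ?case by (cases f) auto
next
  case (Plus e1 e2)
  obtain f1 f2 where f: "f = Plus f1 f2" using Plus.prems by (cases f) auto
  then have "expr_tokens e1 @ (expr_tokens e2 @ xs) = expr_tokens f1 @ (expr_tokens f2 @ ys)"
    using Plus.prems by simp
  from Plus.IH(1)[OF this] Plus.IH(2)[of xs f2 ys] show ?case by (simp add: f)
next
  case (Times e1 e2)
  obtain f1 f2 where f: "f = Times f1 f2" using Times.prems by (cases f) auto
  then have "expr_tokens e1 @ (expr_tokens e2 @ xs) = expr_tokens f1 @ (expr_tokens f2 @ ys)"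
    using Times.prems by simp
  from Times.IH(1)[OF this] Times.IH(2)[of xs f2 ys] show ?case by (simp add: f)
next
  case (Scale c e)
  obtain d f' where f: "f = Scale d f'" using Scale.prems by (cases f) auto
  then show ?case using Scale.prems Scale.IH[of xs f' ys] by (simp add: complex_eq_iff)
qed

text \<open>Position 0 holds the length, since entries read beyond the end of a list carry no
  information; the list itself starts at position 1.\<close>

definition list_code :: "('a \<times> real) list \<Rightarrow> nat \<Rightarrow> 'a \<times> real" where
  "list_code xs n = (if n = 0 then (undefined, real (length xs)) else xs ! (n - 1))"

lemma list_code_inj: "list_code xs = list_code ys \<Longrightarrow> xs = ys"
proof (rule nth_equalityI)
  assume eq: "list_code xs = list_code ys"
  show "length xs = length ys" using fun_cong[OF eq, of 0] by (simp add: list_code_def)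
  show "xs ! i = ys ! i" for i using fun_cong[OF eq, of "Suc i"] by (simp add: list_code_def)
qed

definition seq_code :: "(nat \<Rightarrow> 'a gen_expr) \<Rightarrow> nat \<Rightarrow> 'a \<times> real" where
  "seq_code x n = (case prod_decode n of (i, j) \<Rightarrow> list_code (expr_tokens (x i)) j)"

lemma seq_code_inj: "seq_code x = seq_code y \<Longrightarrow> x = y"
proof
  fix i assume eq: "seq_code x = seq_code y"
  have "list_code (expr_tokens (x i)) = list_code (expr_tokens (y i))"
  proof
    fix j show "list_code (expr_tokens (x i)) j = list_code (expr_tokens (y i)) j"
      using fun_cong[OF eq, of "prod_encode (i, j)"] by (simp add: seq_code_def)
  qed
  then show "x i = y i" using list_code_inj expr_tokens_prefix_free[of "x i" "[]" "y i" "[]"] by auto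
qed

section \<open>Transport of structure along an injection\<close>

definition transport :: "('b \<Rightarrow> 'c) \<Rightarrow> 'b cstar_alg \<Rightarrow> 'c cstar_alg" where
  "transport g B = (let h = inv_into (cs_carrier B) g in
     \<lparr>cs_carrier = g ` cs_carrier B, cs_add = (\<lambda>x y. g (cs_add B (h x) (h y))),
      cs_smult = (\<lambda>c x. g (cs_smult B c (h x))), cs_mult = (\<lambda>x y. g (cs_mult B (h x) (h y))),
      cs_star = (\<lambda>x. g (cs_star B (h x))), cs_norm = (\<lambda>x. cs_norm B (h x)),
      cs_zero = g (cs_zero B), cs_one = g (cs_one B)\<rparr>)"

locale cstar_transport = cstar B for B :: "'b cstar_alg" (structure) +
  fixes g :: "'b \<Rightarrow> 'c"
  assumes inj: "inj_on g (cs_carrier B)"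
begin

abbreviation h :: "'c \<Rightarrow> 'b" where "h \<equiv> inv_into S g"

lemma h_g [simp]: "x \<in> S \<Longrightarrow> h (g x) = x"
  by (simp add: inj)

lemma g_eq [simp]: "x \<in> S \<Longrightarrow> y \<in> S \<Longrightarrow> g x = g y \<longleftrightarrow> x = y"
  by (rule inj_on_eq_iff[OF inj])

lemma transport_simps [simp]:
  "cs_carrier (transport g B) = g ` S" "cs_add (transport g B) x y = g (h x \<oplus> h y)"
  "cs_smult (transport g B) c x = g (c \<odot> h x)" "cs_mult (transport g B) x y = g (h x \<otimes> h y)"
  "cs_star (transport g B) x = g ((h x)\<^sup>\<star>)" "cs_norm (transport g B) x = \<parallel>h x\<parallel>"
  "cs_zero (transport g B) = g \<zero>" "cs_one (transport g B) = g \<one>"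
  by (simp_all add: transport_def Let_def)

lemma transport_cstar: "unital_cstar_algebra (transport g B)"
proof -
  have compl: "\<exists>x\<in>S. (\<lambda>n. \<parallel>h (cs_sub (transport g B) (X n) (g x))\<parallel>) \<longlonglongrightarrow> 0"
    if X: "\<forall>n. X n \<in> g ` S"
      and C: "\<forall>e>0. \<exists>N. \<forall>m\<ge>N. \<forall>n\<ge>N. \<parallel>h (cs_sub (transport g B) (X m) (X n))\<parallel> < e"
    for X :: "nat \<Rightarrow> 'c"
  proof -
    have hX: "h (X n) \<in> S" for n using X inv_into_into by metis
    have sub: "h (cs_sub (transport g B) x y) = h x \<ominus> h y" if "h x \<in> S" "h y \<in> S" for x y
      using that by (simp add: cs_sub_def)
    obtain a where a: "a \<in> S" "conv (\<lambda>n. h (X n)) a"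
      using complete[of "\<lambda>n. h (X n)"] hX C by (auto simp: sub)
    then show ?thesis using hX by (intro bexI[of _ a]) (auto simp: sub conv_def)
  qed
  have neg: "\<exists>y\<in>S. x \<oplus> y = \<zero>" if "x \<in> S" for x
    using that sub_self[OF that] unfolding cs_sub_def by (intro bexI[of _ "(-1) \<odot> x"]) auto
  show ?thesis
    unfolding unital_cstar_algebra_def Let_def transport_simps ball_simps bex_simps
    by (intro conjI ballI allI impI)
      (auto simp: add_assoc smult_add_left smult_add_right mult_assoc distrib_left distrib_right
        smult_mult_left smult_mult_right star_add star_smult star_mult norm_eq_0 norm_triangle
        norm_mult norm_cstar neg intro: add_comm compl)
qed

lemma transport_hom_into:
  "unital_star_hom A B f \<Longrightarrow> unital_star_hom A (transport g B) (\<lambda>x. g (f x))"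
  by (simp add: unital_star_hom_def linear_map_def)

lemma transport_hom:
  "unital_star_hom B B f \<Longrightarrow> unital_star_hom (transport g B) (transport g B) (\<lambda>x. g (f (h x)))"
  by (auto simp: unital_star_hom_def linear_map_def)

lemma transport_e0:
  assumes "e0_semigroup B \<sigma>"
  shows "e0_semigroup (transport g B) (\<lambda>t x. g (\<sigma> t (h x)))"
proof -
  have "\<sigma> t x \<in> S" if "t \<ge> 0" "x \<in> S" for t x
    using assms that by (auto simp: e0_semigroup_def unital_star_hom_def linear_map_def)
  then show ?thesis
    using assms transport_hom unfolding e0_semigroup_def by auto
qed

lemma transport_cs_sum:
  "(\<And>k. k < n \<Longrightarrow> f k \<in> S) \<Longrightarrow> cs_sum (transport g B) n (\<lambda>k. g (f k)) = g (cs_sum B n f)"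
  by (induction n) simp_all

lemma transport_cs_sum_cong:
  "(\<And>k. k < n \<Longrightarrow> f k = f' k) \<Longrightarrow> cs_sum (transport g B) n f = cs_sum (transport g B) n f'"
  by (induction n) auto

lemma transport_cp:
  assumes "cp_map B A E" shows "cp_map (transport g B) A (\<lambda>x. E (h x))"
  unfolding cp_map_def
proof (intro conjI allI impI)
  show "linear_map (transport g B) A (\<lambda>x. E (h x))"
    using assms by (simp add: cp_map_def linear_map_def)
  fix n M assume M: "mat_pos (transport g B) n M"
  then obtain X where X: "\<And>i j. i < n \<Longrightarrow> j < n \<Longrightarrow> X i j \<in> cs_carrier (transport g B)"
    and MX: "\<And>i j. i < n \<Longrightarrow> j < n \<Longrightarrow> M i j = cs_sum (transport g B) n
      (\<lambda>k. cs_mult (transport g B) (cs_star (transport g B) (X k i)) (X k j))"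
    by (rule mat_posE) blast
  have hX: "h (X i j) \<in> S" if "i < n" "j < n" for i j
    using X[OF that] by (auto simp: inv_into_into)
  have hM: "h (M i j) = cs_sum B n (\<lambda>k. (h (X k i))\<^sup>\<star> \<otimes> h (X k j))" if "i < n" "j < n" for i j
  proof -
    have "M i j = cs_sum (transport g B) n (\<lambda>k. g ((h (X k i))\<^sup>\<star> \<otimes> h (X k j)))"
      unfolding MX[OF that] using that hX by (intro transport_cs_sum_cong) simp
    also have "\<dots> = g (cs_sum B n (\<lambda>k. (h (X k i))\<^sup>\<star> \<otimes> h (X k j)))"
      using that hX by (intro transport_cs_sum) simp
    finally show ?thesis using that hX by simp
  qed
  then have "mat_pos B n (\<lambda>i j. h (M i j))"
    unfolding mat_pos_def using hX by (intro conjI exI[of _ "\<lambda>i j. h (X i j)"]) auto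
  then show "mat_pos A n (\<lambda>i j. E (h (M i j)))"
    using assms unfolding cp_map_def by (elim conjE allE impE) assumption
qed

end

theorem theorem4p12:
  fixes A :: "'a cstar_alg" and \<phi> :: "real \<Rightarrow> 'a \<Rightarrow> 'a"
  assumes "unital_cstar_algebra A"
    and "\<exists>\<omega>. faithful_state A \<omega>"
    and "cp0_semigroup A \<phi>"
  shows "\<exists>(\<AA> :: (nat \<Rightarrow> 'a \<times> real) cstar_alg) i E \<sigma>.
           unital_cstar_algebra \<AA> \<and>
           unital_star_hom A \<AA> i \<and> inj_on i (cs_carrier A) \<and>
           cp_map \<AA> A E \<and> (\<forall>a\<in>cs_carrier A. E (i a) = a) \<and>
           e0_semigroup \<AA> \<sigma> \<and>
           (\<forall>t\<ge>0. \<forall>x\<in>cs_carrier \<AA>. E (\<sigma> t x) = \<phi> t (E x))"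
proof -
  obtain \<omega> where \<omega>: "faithful_state A \<omega>" using assms(2) by blast
  interpret cp_flow A \<omega> \<phi>
    using assms \<omega> by unfold_locales
  \<comment> \<open>An element is coded by one chosen sequence of expressions converging to it; the
    sequence determines its limit, so \<open>g\<close> is injective.\<close>
  define g where "g F = seq_code (SOME x. flow.approx x F)" for F
  have g: "inj_on g flow.carrier"
  proof (rule inj_onI)
    fix F G assume FG: "F \<in> flow.carrier" "G \<in> flow.carrier" "g F = g G"
    have *: "flow.approx (SOME x. flow.approx x H) H" if "H \<in> flow.carrier" for H
    proof -
      obtain x where "flow.approx x H" using flow.carrier_approx[OF \<open>H \<in> flow.carrier\<close>] .
      then show ?thesis by (rule someI[where P = "\<lambda>x. flow.approx x H"])
    qed
    have "(SOME x. flow.approx x F) = (SOME x. flow.approx x G)"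
      using FG(3) unfolding g_def by (rule seq_code_inj)
    then show "F = G" using flow.approx_unique[OF *[OF FG(1)] *[OF FG(2)]] by simp
  qed
  interpret T: cstar_transport dil g
    by unfold_locales (use flow.completion_cstar g in simp_all)
  have embed: "embed a \<in> cs_carrier dil" if "a \<in> S" for a
    using embed_hom that by (simp only: unital_star_hom_def linear_map_def)
  have dshift: "dshift t F \<in> cs_carrier dil" if "t \<ge> 0" "F \<in> cs_carrier dil" for t F
    using dshift_hom that by (simp only: unital_star_hom_def linear_map_def)
  show ?thesis
  proof (intro exI conjI)
    show "unital_cstar_algebra (transport g dil)" by (rule T.transport_cstar)
    show "unital_star_hom A (transport g dil) (\<lambda>a. g (embed a))" by (rule T.transport_hom_into[OF embed_hom])
    show "inj_on (\<lambda>a. g (embed a)) S"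
      using comp_inj_on[OF embed_inj inj_on_subset[OF g]] embed by (auto simp: comp_def)
    show "cp_map (transport g dil) A (\<lambda>x. dexp (T.h x))" by (rule T.transport_cp[OF dexp_cp])
    show "\<forall>a\<in>S. dexp (T.h (g (embed a))) = a"
      using T.h_g[OF embed] dexp_embed by simp
    show "e0_semigroup (transport g dil) (\<lambda>t x. g (dshift t (T.h x)))" by (rule T.transport_e0[OF dshift_e0])
    show "\<forall>t\<ge>0. \<forall>x\<in>cs_carrier (transport g dil). dexp (T.h (g (dshift t (T.h x)))) = \<phi> t (dexp (T.h x))"
    proof (intro allI impI ballI)
      fix t :: real and x assume t: "t \<ge> 0" and x: "x \<in> cs_carrier (transport g dil)"
      then obtain F where F: "F \<in> cs_carrier dil" "x = g F" by auto
      show "dexp (T.h (g (dshift t (T.h x)))) = \<phi> t (dexp (T.h x))"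
        unfolding F(2) T.h_g[OF F(1)] T.h_g[OF dshift[OF t F(1)]]
        using F(1) t by (intro dexp_dshift) auto
    qed
  qed
qed

end
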